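(* Let $\mathbf{k}$ be a field of characteristic $0$ and $\lambda\in\mathbf{k}$. Let $\mathfrak{RBL}_{\lambda,\infty}$ and $\mathfrak{RBA}_{\mathbb{S},\lambda,\infty}$ be the minimal models of the symmetric operads of Rota-Baxter Lie algebras and of Rota-Baxter associative algebras of weight $\lambda$, as described explicitly in the context. There is a morphism of dg operads $$\Phi:\mathfrak{RBL}_{\lambda,\infty}\to\mathfrak{RBA}_{\mathbb{S},\lambda,\infty}$$ given on generators by anti-symmetrization: $$\ell_n\mapsto\sum_{\sigma\in S_n}\mathrm{sgn}(\sigma)\,\mu_n\otimes\sigma\quad(n\ge2),\qquad T_n\mapsto\sum_{\sigma\in S_n}\mathrm{sgn}(\sigma)\,R_n\otimes\sigma\quad(n\ge1).$$
   Context: Homological grading and the Koszul sign rule are used; for tree monomials, decorations are read in the planar (depth-first, left-to-right, parent first) order. A shuffle tree is a planar rooted tree with leaves bijectively labelled $1,\dots,n$ such that at each vertex, children (each assigned the minimal label among its descendant leaves) have increasing labels from left to right. For a trivially labelled tree (labels increasing from left to right) and $\sigma\in S_n$, the action by $\sigma$ replaces each label $i$ by $\sigma^{-1}(i)$. Set, for the indices below, $$\alpha'=1+\sum_{j=1}^k(k-j)(l_j-1),\qquad\beta'=1+i+\Big(p+\sum_{j=2}^q(r_j-1)\Big)(r_1-i)+\sum_{j=2}^q(r_j-1)(p-k_{j-1}).$$ For operations $a$ of arity $k$ and $b_1,\dots,b_k$, $a[b_1,\dots,b_k]$ denotes $b_j$ grafted on the $j$-th input of $a$; $a[b_2,\dots,b_q]_{k_1,\dots,k_{q-1}}$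 denotes $b_{j+1}$ grafted on input $k_j$ of $a$, the other inputs being left free. **$\mathfrak{RBL}_{\lambda,\infty}$**: the free graded symmetric operad generated by $\ell_n$ ($n\ge2$, $|\ell_n|=n-2$) and $T_n$ ($n\ge1$, $|T_n|=n-1$) with $\ell_n\cdot\sigma=\mathrm{sgn}(\sigma)\ell_n$, $T_n\cdot\sigma=\mathrm{sgn}(\sigma)T_n$, with differential $$\partial\ell_n=\sum_{j=2}^{n-1}\sum_{i=1}^{n-j+1}\sum_\sigma(-1)^{i+j(n-i)}\mathrm{sgn}(\sigma)(\ell_{n-j+1}\circ_i\ell_j)\cdot\sigma,$$ $$\partial T_n=\sum_{k=2}^n\sum_{\substack{l_1+\cdots+l_k=n\\ l_j\ge1}}\sum_\sigma(-1)^{\alpha'}\mathrm{sgn}(\sigma)\,\ell_k[T_{l_1},\dots,T_{l_k}]\cdot\sigma+\sum_{\substack{2\le p\le n\\1\le q\le p}}\sum_{\substack{r_1+\cdots+r_q+p-q=n\\ r_j\ge1,\ 1\le i\le r_1\\1\le k_1<\cdots<k_{q-1}\le p}}\sum_\sigma(-1)^{\beta'}\mathrm{sgn}(\sigma)\lambda^{p-q}\big(T_{r_1}\circ_i\ell_p[T_{r_2},\dots,T_{r_q}]_{k_1,\dots,k_{q-1}}\big)\cdot\sigma,$$ where each $\sum_\sigma$ is over the $\sigma\in S_n$ that make the tree monomial a shuffle tree monomial. **$\mathfrak{RBA}_{\mathbb{S},\lambda,\infty}$**: the regular symmetric operad (arity $n$ part tensored with $\mathbf{k}[S_n]$) associated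 with the non-symmetric dg operad that is free on $\mu_n$ ($n\ge2$, $|\mu_n|=n-2$) and $R_n$ ($n\ge1$, $|R_n|=n-1$) with differential $$\partial\mu_n=\sum_{j=2}^{n-1}\sum_{i=1}^{n-j+1}(-1)^{i+j(n-i)}\mu_{n-j+1}\circ_i\mu_j,$$ $$\partial R_n=\sum_{k=2}^n\sum_{\substack{l_1+\cdots+l_k=n\\ l_j\ge1}}(-1)^{\alpha'}\mu_k[R_{l_1},\dots,R_{l_k}]+\sum_{\substack{2\le p\le n\\1\le q\le p}}\sum_{\substack{r_1+\cdots+r_q+p-q=n\\ r_j\ge1,\ 1\le i\le r_1\\1\le k_1<\cdots<k_{q-1}\le p}}(-1)^{\beta'}\lambda^{p-q}R_{r_1}\circ_i\mu_p[R_{r_2},\dots,R_{r_q}]_{k_1,\dots,k_{q-1}}.$$ So it is freely generated, as a symmetric operad, by the regular representations spanned by the $\mu_n\otimes\sigma$ and $R_n\otimes\sigma$, $\sigma\in S_n$, with $\partial(\mu_n\otimes\sigma)=(\partial\mu_n)\cdot\sigma$ and $\partial(R_n\otimes\sigma)=(\partial R_n)\cdot\sigma$. *)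

theory Defs
  imports "HOL-Library.Poly_Mapping" "HOL-Combinatorics.Permutations"
begin

section \<open>Symmetric dg operads: data, morphisms, quotients\<close>

text \<open>
  \<open>Carrier P n\<close> is the arity \<open>n\<close> component and \<open>Homog P n d\<close> its homogeneous part of degree \<open>d\<close>.
  \<open>Compose P m n i x y\<close> is the partial composition of \<open>x\<close> (arity \<open>m\<close>) with \<open>y\<close> (arity \<open>n\<close>) at
  the \<open>i\<close>-th input, \<open>1 \<le> i \<le> m\<close>; \<open>Act P n s x\<close> is the right action of a permutation \<open>s\<close> of
  \<open>{1..n}\<close>. The record only holds the operations, not the axioms.
\<close>

record ('k, 'v) dg_operad =
  Carrier :: "nat \<Rightarrow> 'v set"
  Homog :: "nat \<Rightarrow> int \<Rightarrow> 'v set"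
  Zero :: "nat \<Rightarrow> 'v"
  Add :: "nat \<Rightarrow> 'v \<Rightarrow> 'v \<Rightarrow> 'v"
  Smult :: "nat \<Rightarrow> 'k \<Rightarrow> 'v \<Rightarrow> 'v"
  Unit :: "'v"
  Compose :: "nat \<Rightarrow> nat \<Rightarrow> nat \<Rightarrow> 'v \<Rightarrow> 'v \<Rightarrow> 'v"
  Act :: "nat \<Rightarrow> (nat \<Rightarrow> nat) \<Rightarrow> 'v \<Rightarrow> 'v"
  Diff :: "nat \<Rightarrow> 'v \<Rightarrow> 'v"

definition dg_operad_morphism ::
  "('k, 'v) dg_operad \<Rightarrow> ('k, 'w) dg_operad \<Rightarrow> (nat \<Rightarrow> 'v \<Rightarrow> 'w) \<Rightarrow> bool" where
  "dg_operad_morphism P Q f \<longleftrightarrow>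
    (\<forall>n. \<forall>x\<in>Carrier P n. f n x \<in> Carrier Q n) \<and>
    (\<forall>n d. \<forall>x\<in>Homog P n d. f n x \<in> Homog Q n d) \<and>
    (\<forall>n. \<forall>x\<in>Carrier P n. \<forall>y\<in>Carrier P n. f n (Add P n x y) = Add Q n (f n x) (f n y)) \<and>
    (\<forall>n c. \<forall>x\<in>Carrier P n. f n (Smult P n c x) = Smult Q n c (f n x)) \<and>
    f 1 (Unit P) = Unit Q \<and>
    (\<forall>m n. \<forall>i\<in>{1..m}. \<forall>x\<in>Carrier P m. \<forall>y\<in>Carrier P n.
       f (m + n - 1) (Compose P m n i x y) = Compose Q m n i (f m x) (f n y)) \<and>
    (\<forall>n s. \<forall>x\<in>Carrier P n. s permutes {1..n} \<longrightarrow> f n (Act P n s x) = Act Q n s (f n x)) \<and>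
    (\<forall>n. \<forall>x\<in>Carrier P n. f n (Diff P n x) = Diff Q n (f n x))"

text \<open>The operadic ideal generated by relations \<open>R n \<subseteq> Carrier P n\<close>.\<close>

inductive operad_ideal ::
  "('k, 'v) dg_operad \<Rightarrow> (nat \<Rightarrow> 'v set) \<Rightarrow> nat \<Rightarrow> 'v \<Rightarrow> bool"
  for P :: "('k, 'v) dg_operad" and R :: "nat \<Rightarrow> 'v set" where
  rel: "x \<in> R n \<Longrightarrow> operad_ideal P R n x"
| zero: "operad_ideal P R n (Zero P n)"
| add: "operad_ideal P R n x \<Longrightarrow> operad_ideal P R n y \<Longrightarrow> operad_ideal P R n (Add P n x y)"
| smult: "operad_ideal P R n x \<Longrightarrow> operad_ideal P R n (Smult P n c x)"
| act: "operad_ideal P R n x \<Longrightarrow> s permutes {1..n} \<Longrightarrow> operad_ideal P R n (Act P n s x)"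
| comp_left: "operad_ideal P R m x \<Longrightarrow> y \<in> Carrier P n \<Longrightarrow> i \<in> {1..m} \<Longrightarrow>
    operad_ideal P R (m + n - 1) (Compose P m n i x y)"
| comp_right: "x \<in> Carrier P m \<Longrightarrow> operad_ideal P R n y \<Longrightarrow> i \<in> {1..m} \<Longrightarrow>
    operad_ideal P R (m + n - 1) (Compose P m n i x y)"

definition coset :: "('k, 'v) dg_operad \<Rightarrow> (nat \<Rightarrow> 'v \<Rightarrow> bool) \<Rightarrow> nat \<Rightarrow> 'v \<Rightarrow> 'v set" where
  "coset P I n x = {Add P n x z | z. I n z}"

text \<open>
  Elements of the quotient are cosets. An operation on cosets is the union of the cosets of its
  values on all representatives, which is a single coset as soon as it is well defined.
\<close>

definition quotient_operad ::
  "('k, 'v) dg_operad \<Rightarrow> (nat \<Rightarrow> 'v \<Rightarrow> bool) \<Rightarrow> ('k, 'v set) dg_operad" where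
  "quotient_operad P I = \<lparr>
     Carrier = (\<lambda>n. coset P I n ` Carrier P n),
     Homog = (\<lambda>n d. coset P I n ` Homog P n d),
     Zero = (\<lambda>n. coset P I n (Zero P n)),
     Add = (\<lambda>n X Y. \<Union>x\<in>X. \<Union>y\<in>Y. coset P I n (Add P n x y)),
     Smult = (\<lambda>n c X. \<Union>x\<in>X. coset P I n (Smult P n c x)),
     Unit = coset P I 1 (Unit P),
     Compose = (\<lambda>m n i X Y. \<Union>x\<in>X. \<Union>y\<in>Y. coset P I (m + n - 1) (Compose P m n i x y)),
     Act = (\<lambda>n s X. \<Union>x\<in>X. coset P I n (Act P n s x)),
     Diff = (\<lambda>n X. \<Union>x\<in>X. coset P I n (Diff P n x)) \<rparr>"

section \<open>Tree monomials\<close>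

text \<open>
  One alphabet of generators serves both operads: \<open>Op n\<close> stands for \<open>\<ell>\<^sub>n\<close> resp. \<open>\<mu>\<^sub>n\<close>, and \<open>RB n\<close>
  for \<open>T\<^sub>n\<close> resp. \<open>R\<^sub>n\<close>.
\<close>

datatype rb_gen = Op nat | RB nat

fun arity :: "rb_gen \<Rightarrow> nat" where
  "arity (Op n) = n"
| "arity (RB n) = n"

fun gdeg :: "rb_gen \<Rightarrow> nat" where
  "gdeg (Op n) = n - 2"
| "gdeg (RB n) = n - 1"

fun is_gen :: "rb_gen \<Rightarrow> bool" where
  "is_gen (Op n) = (2 \<le> n)"
| "is_gen (RB n) = (1 \<le> n)"

datatype tree = Leaf nat | Node rb_gen "tree list"

fun leaves :: "tree \<Rightarrow> nat list" where
  "leaves (Leaf i) = [i]"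
| "leaves (Node g ts) = concat (map leaves ts)"

fun tdeg :: "tree \<Rightarrow> nat" where
  "tdeg (Leaf i) = 0"
| "tdeg (Node g ts) = gdeg g + sum_list (map tdeg ts)"

fun well_formed :: "tree \<Rightarrow> bool" where
  "well_formed (Leaf i) = True"
| "well_formed (Node g ts) = (is_gen g \<and> length ts = arity g \<and> (\<forall>t\<in>set ts. well_formed t))"

definition tree_monomials :: "nat \<Rightarrow> tree set" where
  "tree_monomials n = {t. well_formed t \<and> distinct (leaves t) \<and> set (leaves t) = {1..n}}"

fun shuffle_tree :: "tree \<Rightarrow> bool" where
  "shuffle_tree (Leaf i) = True"
| "shuffle_tree (Node g ts) =
    (sorted_wrt (<) (map (\<lambda>t. Min (set (leaves t))) ts) \<and> (\<forall>t\<in>set ts. shuffle_tree t))"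

fun tsubst :: "(nat \<Rightarrow> tree) \<Rightarrow> tree \<Rightarrow> tree" where
  "tsubst f (Leaf i) = f i"
| "tsubst f (Node g ts) = Node g (map (tsubst f) ts)"

definition relabel :: "(nat \<Rightarrow> nat) \<Rightarrow> tree \<Rightarrow> tree" where
  "relabel f = tsubst (\<lambda>i. Leaf (f i))"

definition tact :: "(nat \<Rightarrow> nat) \<Rightarrow> tree \<Rightarrow> tree" where
  "tact s = relabel (inv s)"

text \<open>Trivial labelling: \<open>number c t\<close> relabels the leaves by \<open>c, c + 1, \<dots>\<close> from left to right.\<close>

fun number :: "nat \<Rightarrow> tree \<Rightarrow> tree" and number_list :: "nat \<Rightarrow> tree list \<Rightarrow> tree list" where
  "number c (Leaf i) = Leaf c"
| "number c (Node g ts) = Node g (number_list c ts)"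
| "number_list c [] = []"
| "number_list c (t # ts) = number c t # number_list (c + length (leaves t)) ts"

text \<open>
  \<open>graft g [(k\<^sub>1, b\<^sub>1), \<dots>]\<close> is the trivially labelled tree monomial with root \<open>g\<close>, the tree \<open>b\<^sub>j\<close>
  grafted on input \<open>k\<^sub>j\<close> of \<open>g\<close>, the other inputs being left free.
\<close>

definition graft :: "rb_gen \<Rightarrow> (nat \<times> tree) list \<Rightarrow> tree" where
  "graft g kbs = number 1 (Node g
     (map (\<lambda>c. case map_of kbs c of None \<Rightarrow> Leaf 1 | Some b \<Rightarrow> b) [1..<arity g + 1]))"

definition corolla :: "rb_gen \<Rightarrow> tree" where
  "corolla g = graft g []"

section \<open>Linear combinations and Koszul signs\<close>

definition smul :: "'k::comm_ring_1 \<Rightarrow> ('a \<Rightarrow>\<^sub>0 'k) \<Rightarrow> ('a \<Rightarrow>\<^sub>0 'k)" where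
  "smul c = Poly_Mapping.map ((*) c)"

definition monomial :: "'a \<Rightarrow> ('a \<Rightarrow>\<^sub>0 'k::comm_ring_1)" where
  "monomial t = Poly_Mapping.single t 1"

definition lin :: "('a \<Rightarrow> ('b \<Rightarrow>\<^sub>0 'k)) \<Rightarrow> ('a \<Rightarrow>\<^sub>0 'k) \<Rightarrow> ('b \<Rightarrow>\<^sub>0 'k::comm_ring_1)" where
  "lin f x = (\<Sum>t\<in>Poly_Mapping.keys x. smul (Poly_Mapping.lookup x t) (f t))"

text \<open>
  Each entry \<open>(a, d)\<close> is a symbol of degree \<open>d\<close> at rank \<open>a\<close>; the sign is that of the stable
  reordering of the word by rank.
\<close>

fun koszul_sign :: "(nat \<times> nat) list \<Rightarrow> 'k::comm_ring_1" where
  "koszul_sign [] = 1"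
| "koszul_sign ((a, d) # xs) =
    (-1) ^ (d * sum_list (map snd (filter (\<lambda>(b, e). b < a) xs))) * koszul_sign xs"

fun symbols :: "(nat \<Rightarrow> nat) \<Rightarrow> tree \<Rightarrow> (nat \<times> nat) list" where
  "symbols d (Leaf i) = [(i, d i)]"
| "symbols d (Node g ts) = (0, gdeg g) # concat (map (symbols d) ts)"

text \<open>
  The composite \<open>t(s 1, s 2, \<dots>)\<close> of tree monomials. The formal word \<open>t s\<^sub>1 s\<^sub>2 \<dots>\<close> (vertices of \<open>t\<close>
  at rank 0, the subtree put at leaf \<open>i\<close> at rank \<open>i\<close>) is reordered to the planar reading order of
  the resulting tree.
\<close>

definition compose_all :: "tree \<Rightarrow> (nat \<Rightarrow> tree) \<Rightarrow> (tree \<Rightarrow>\<^sub>0 'k::comm_ring_1)" where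
  "compose_all t s = smul (koszul_sign (symbols (\<lambda>i. tdeg (s i)) t)) (monomial (tsubst s t))"

definition compose_at :: "nat \<Rightarrow> nat \<Rightarrow> tree \<Rightarrow> tree \<Rightarrow> (tree \<Rightarrow>\<^sub>0 'k::comm_ring_1)" where
  "compose_at n i t u = compose_all t (\<lambda>j.
     if j < i then Leaf j
     else if j = i then relabel (\<lambda>l. l + i - 1) u
     else Leaf (j + n - 1))"

text \<open>The derivation with prescribed values \<open>D\<close> on the generators.\<close>

fun derivation :: "(rb_gen \<Rightarrow> (tree \<Rightarrow>\<^sub>0 'k)) \<Rightarrow> tree \<Rightarrow> (tree \<Rightarrow>\<^sub>0 'k::comm_ring_1)" where
  "derivation D (Leaf i) = 0"
| "derivation D (Node g ts) =
    lin (\<lambda>m. compose_all m (\<lambda>i. ts ! (i - 1))) (D g) +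
    (\<Sum>j<length ts. smul ((-1) ^ (gdeg g + sum_list (map tdeg (take j ts))))
       (lin (\<lambda>u. monomial (Node g (ts[j := u]))) (map (derivation D) ts ! j)))"

section \<open>The two dg operads\<close>

text \<open>
  The symmetric operad freely generated by the regular representations of the generators: its
  arity \<open>n\<close> part has as basis the planar trees with leaves labelled bijectively by \<open>1, \<dots>, n\<close>. For
  a trivially labelled planar tree \<open>t\<close>, the basis element \<open>t \<otimes> s\<close> of (planar trees) \<open>\<otimes> k[S\<^sub>n]\<close> is
  \<open>tact s t\<close>, so this is the regular operad of the free non-symmetric operad.
\<close>

definition free_regular_operad ::
  "(rb_gen \<Rightarrow> (tree \<Rightarrow>\<^sub>0 'k)) \<Rightarrow> ('k::comm_ring_1, tree \<Rightarrow>\<^sub>0 'k) dg_operad" where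
  "free_regular_operad D = \<lparr>
     Carrier = (\<lambda>n. {x. Poly_Mapping.keys x \<subseteq> tree_monomials n}),
     Homog = (\<lambda>n d. {x. Poly_Mapping.keys x \<subseteq> {t \<in> tree_monomials n. int (tdeg t) = d}}),
     Zero = (\<lambda>n. 0),
     Add = (\<lambda>n. (+)),
     Smult = (\<lambda>n. smul),
     Unit = monomial (Leaf 1),
     Compose = (\<lambda>m n i x y. lin (\<lambda>t. lin (compose_at n i t) y) x),
     Act = (\<lambda>n s. lin (\<lambda>t. monomial (tact s t))),
     Diff = (\<lambda>n. lin (derivation D)) \<rparr>"

text \<open>
  The exponents \<open>\<alpha>'\<close> and \<open>\<beta>'\<close>; the families \<open>l\<^sub>1, l\<^sub>2, \<dots>\<close> etc. are lists, so \<open>l\<^sub>j\<close> is \<open>ls ! (j - 1)\<close>.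
  All subtractions are of natural numbers in the right order.
\<close>

definition alpha' :: "nat list \<Rightarrow> nat" where
  "alpha' ls = (let k = length ls in 1 + (\<Sum>j=1..k. (k - j) * (ls ! (j - 1) - 1)))"

definition beta' :: "nat \<Rightarrow> nat list \<Rightarrow> nat \<Rightarrow> nat list \<Rightarrow> nat" where
  "beta' p rs i ks = (let q = length rs in
     1 + i + (p + (\<Sum>j=2..q. rs ! (j - 1) - 1)) * (rs ! 0 - i)
     + (\<Sum>j=2..q. (rs ! (j - 1) - 1) * (p - ks ! (j - 2))))"

text \<open>
  The differential on generators. \<open>E\<close> says what each trivially labelled tree monomial of the
  formula contributes: itself in the associative case, the signed sum of its shuffle relabellings
  in the Lie case.
\<close>

fun diff_gen :: "(tree \<Rightarrow> (tree \<Rightarrow>\<^sub>0 'k)) \<Rightarrow> 'k \<Rightarrow> rb_gen \<Rightarrow> (tree \<Rightarrow>\<^sub>0 'k::comm_ring_1)" where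
  "diff_gen E lam (Op n) =
    (\<Sum>j\<in>{2..n-1}. \<Sum>i\<in>{1..n-j+1}.
       smul ((-1) ^ (i + j * (n - i))) (E (graft (Op (n - j + 1)) [(i, corolla (Op j))])))"
| "diff_gen E lam (RB n) =
    (\<Sum>k\<in>{2..n}. \<Sum>ls\<in>{ls. length ls = k \<and> sum_list ls = n \<and> (\<forall>l\<in>set ls. 1 \<le> l)}.
       smul ((-1) ^ alpha' ls)
         (E (graft (Op k) (zip [1..<k+1] (map (\<lambda>l. corolla (RB l)) ls))))) +
    (\<Sum>p\<in>{2..n}. \<Sum>q\<in>{1..p}.
     \<Sum>rs\<in>{rs. length rs = q \<and> sum_list rs + (p - q) = n \<and> (\<forall>r\<in>set rs. 1 \<le> r)}.
     \<Sum>i\<in>{1..rs ! 0}.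
     \<Sum>ks\<in>{ks. length ks = q - 1 \<and> sorted_wrt (<) ks \<and> set ks \<subseteq> {1..p}}.
       smul ((-1) ^ beta' p rs i ks * lam ^ (p - q))
         (E (graft (RB (rs ! 0))
              [(i, graft (Op p) (zip ks (map (\<lambda>r. corolla (RB r)) (tl rs))))])))"

definition shuffle_sum :: "tree \<Rightarrow> (tree \<Rightarrow>\<^sub>0 'k::comm_ring_1)" where
  "shuffle_sum t =
    (\<Sum>s\<in>{s. s permutes {1..length (leaves t)} \<and> shuffle_tree (tact s t)}.
       smul (of_int (sign s)) (monomial (tact s t)))"

definition RBA_inf :: "'k \<Rightarrow> ('k::comm_ring_1, tree \<Rightarrow>\<^sub>0 'k) dg_operad" where
  "RBA_inf lam = free_regular_operad (diff_gen monomial lam)"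

text \<open>\<open>gen_tensor g s\<close> is \<open>g \<otimes> s\<close> in the regular representation spanned by the generator \<open>g\<close>.\<close>

definition gen_tensor :: "rb_gen \<Rightarrow> (nat \<Rightarrow> nat) \<Rightarrow> (tree \<Rightarrow>\<^sub>0 'k::comm_ring_1)" where
  "gen_tensor g s = monomial (tact s (corolla g))"

text \<open>
  The free operad on generators with \<open>g \<cdot> s = sgn(s) g\<close> is the free operad on the regular
  representations modulo the operadic ideal generated by these relations.
\<close>

definition sign_relations :: "nat \<Rightarrow> (tree \<Rightarrow>\<^sub>0 'k::comm_ring_1) set" where
  "sign_relations n = {gen_tensor g s - smul (of_int (sign s)) (monomial (corolla g)) | g s.
     is_gen g \<and> arity g = n \<and> s permutes {1..n}}"

definition RBL_free :: "'k \<Rightarrow> ('k::comm_ring_1, tree \<Rightarrow>\<^sub>0 'k) dg_operad" where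
  "RBL_free lam = free_regular_operad (diff_gen shuffle_sum lam)"

definition RBL_ideal :: "'k::comm_ring_1 \<Rightarrow> nat \<Rightarrow> (tree \<Rightarrow>\<^sub>0 'k) \<Rightarrow> bool" where
  "RBL_ideal lam = operad_ideal (RBL_free lam) sign_relations"

definition RBL_inf :: "'k \<Rightarrow> ('k::comm_ring_1, (tree \<Rightarrow>\<^sub>0 'k) set) dg_operad" where
  "RBL_inf lam = quotient_operad (RBL_free lam) (RBL_ideal lam)"

definition RBL_gen :: "'k \<Rightarrow> rb_gen \<Rightarrow> (tree \<Rightarrow>\<^sub>0 'k::comm_ring_1) set" where
  "RBL_gen lam g = coset (RBL_free lam) (RBL_ideal lam) (arity g) (monomial (corolla g))"

end

theory Submission
  imports Defs
begin

text \<open>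
  A planar labelled tree has a class of rearrangements, obtained by permuting the inputs of its
  vertices, and with distinct leaf labels no rearrangement is obtained in two ways. Hence the
  total sign of a rearrangement (signature times Koszul sign) is a quotient of two values of a
  function \<open>orient\<close> on trees, and the antisymmetrization of \<open>t\<close> is the sum of \<open>orient t * orient t'\<close>
  times \<open>t'\<close> over the class of \<open>t\<close>. Compatibility with compositions is then a bijection between
  classes together with the invariance of one sign.

  For the differential, the tree monomials in the differential of a generator, with all
  labellings, are closed under rearrangement. Both \<open>\<alpha>'\<close> and \<open>\<beta>'\<close>, as well as the
  exponent in the differential of \<open>\<ell>\<^sub>n\<close>, equal \<open>\<Sum> (k - j) (l\<^sub>j - 1)\<close>
  over the inputs of all vertices, up to a constant on classes; here \<open>k\<close> is the number of inputs of
  the vertex and \<open>l\<^sub>j\<close> the number of leaves above input \<open>j\<close>. With this form the signs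
  transform under rearrangements like \<open>orient\<close> times the signature of the labelling. Since each class
  contains exactly one shuffle tree, antisymmetrizing the shuffle sums yields every labelling once.
\<close>

section \<open>Linear combinations and inversion signs\<close>

text \<open>The Lie side is a quotient by an ideal, and no basis of it is at hand. All computations
  therefore take place on planar labelled trees: \<open>alternate\<close> is extended linearly to
  the free operad on regular representations, and the map on cosets makes sense because the sign
  relations, hence the whole ideal, are sent to 0. The obstacle is that three kinds of signs are
  coupled: signatures of labellings, Koszul signs of exchanged subtrees, and the signs written in
  the differentials. Each is brought into the form (-1)^N, where N is a sum of weights
  \<open>c x y\<close> over pairs of siblings with \<open>x\<close> before \<open>y\<close>.
  Invariance of a product of such signs then reduces to one exchange of adjacent siblings, that is,
  to the parity of \<open>c x y + c y x\<close>. The reference point of \<open>orient\<close> is the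
  shuffle tree in the class, where it equals 1.\<close>

lemma lookup_smul [simp]: "Poly_Mapping.lookup (smul c x) t = c * Poly_Mapping.lookup x t"
  by (simp add: smul_def map.rep_eq when_def)

lemma smul_add: "smul c (x + y) = smul c x + smul c y"
  by (rule poly_mapping_eqI) (simp add: lookup_add algebra_simps)

lemma smul_add_left: "smul (a + b) x = smul a x + smul b x"
  by (rule poly_mapping_eqI) (simp add: lookup_add algebra_simps)

lemma smul_smul [simp]: "smul a (smul b x) = smul (a * b) x"
  by (rule poly_mapping_eqI) (simp add: algebra_simps)

lemma smul_1 [simp]: "smul 1 x = x"
  by (rule poly_mapping_eqI) simp


lemma smul_0 [simp]: "smul 0 x = 0"
  by (rule poly_mapping_eqI) simp

lemma smul_zero [simp]: "smul c 0 = 0"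
  by (rule poly_mapping_eqI) simp

lemma smul_sum: "smul c (\<Sum>i\<in>A. f i) = (\<Sum>i\<in>A. smul c (f i))"
  by (induction A rule: infinite_finite_induct) (simp_all add: smul_add)

lemma keys_smul: "Poly_Mapping.keys (smul c x) \<subseteq> Poly_Mapping.keys x"
  by (auto simp: in_keys_iff)

lemma keys_monomial: "Poly_Mapping.keys (monomial t) \<subseteq> {t}"
  by (auto simp: monomial_def)

text \<open>\<open>lin\<close> sums over the exact support, which may shrink in sums; any finite set
  containing it serves as well.\<close>

lemma lin_superset:
  assumes "finite A" "Poly_Mapping.keys x \<subseteq> A"
  shows "lin f x = (\<Sum>t\<in>A. smul (Poly_Mapping.lookup x t) (f t))"
  unfolding lin_def using assms by (intro sum.mono_neutral_left) (auto simp: in_keys_iff)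

lemma lin_0 [simp]: "lin f 0 = 0"
  by (simp add: lin_def)

lemma lin_add: "lin f (x + y) = lin f x + lin f y"
proof -
  let ?A = "Poly_Mapping.keys x \<union> Poly_Mapping.keys y"
  have "lin f (x + y) = (\<Sum>t\<in>?A. smul (Poly_Mapping.lookup (x + y) t) (f t))"
    by (intro lin_superset) (auto simp: Poly_Mapping.keys_add)
  moreover have "lin f x = (\<Sum>t\<in>?A. smul (Poly_Mapping.lookup x t) (f t))"
    by (intro lin_superset) auto
  moreover have "lin f y = (\<Sum>t\<in>?A. smul (Poly_Mapping.lookup y t) (f t))"
    by (intro lin_superset) auto
  ultimately show ?thesis by (simp add: lookup_add smul_add_left sum.distrib)
qed

lemma lin_smul: "lin f (smul c x) = smul c (lin f x)"
proof -
  have "lin f (smul c x) = (\<Sum>t\<in>Poly_Mapping.keys x. smul (Poly_Mapping.lookup (smul c x) t) (f t))"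
    by (intro lin_superset keys_smul) auto
  then show ?thesis by (simp add: smul_sum lin_def)
qed

lemma lin_sum: "lin f (\<Sum>i\<in>A. g i) = (\<Sum>i\<in>A. lin f (g i))"
  by (induction A rule: infinite_finite_induct) (simp_all add: lin_add)

lemma lin_monomial [simp]: "lin f (monomial t) = f t"
proof -
  have "lin f (monomial t) = (\<Sum>u\<in>{t}. smul (Poly_Mapping.lookup (monomial t) u) (f u))"
    by (intro lin_superset keys_monomial) auto
  then show ?thesis by (simp add: monomial_def)
qed

lemma lin_cong: "(\<And>t. t \<in> Poly_Mapping.keys x \<Longrightarrow> f t = g t) \<Longrightarrow> lin f x = lin g x"
  by (simp add: lin_def)

lemma lin_lin: "lin f (lin g x) = lin (\<lambda>t. lin f (g t)) x"
  by (simp add: lin_def[of "\<lambda>t. lin f (g t)"] lin_def[of g] lin_sum lin_smul)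


lemma lin_fun_smul: "lin (\<lambda>t. smul c (f t)) x = smul c (lin f x)"
  by (simp add: lin_def smul_sum mult.commute)

lemma lin_fun_sum: "lin (\<lambda>t. \<Sum>i\<in>A. f i t) x = (\<Sum>i\<in>A. lin (f i) x)"
  unfolding lin_def by (simp add: smul_sum) (rule sum.swap)


lemma lin_fun_0 [simp]: "lin (\<lambda>t. 0) x = 0"
  by (simp add: lin_def)

lemma keys_sum_subset:
  "(\<And>i. i \<in> A \<Longrightarrow> Poly_Mapping.keys (f i) \<subseteq> S) \<Longrightarrow> Poly_Mapping.keys (\<Sum>i\<in>A. f i) \<subseteq> S"
proof (induction A rule: infinite_finite_induct)
  case (insert i A)
  then show ?case using Poly_Mapping.keys_add[of "f i" "sum f A"] by auto
qed simp_all

lemma keys_lin: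
  assumes "\<And>t. t \<in> Poly_Mapping.keys x \<Longrightarrow> Poly_Mapping.keys (f t) \<subseteq> S"
  shows "Poly_Mapping.keys (lin f x) \<subseteq> S"
  unfolding lin_def
proof (rule keys_sum_subset)
  fix t assume "t \<in> Poly_Mapping.keys x"
  then show "Poly_Mapping.keys (smul (Poly_Mapping.lookup x t) (f t)) \<subseteq> S"
    by (rule order_trans[OF keys_smul assms])
qed

section \<open>Signs of words as sums of weights over pairs of entries\<close>

definition adj_swap :: "'a list \<Rightarrow> 'a list \<Rightarrow> bool" where
  "adj_swap xs ys \<longleftrightarrow> (\<exists>as x y bs. xs = as @ x # y # bs \<and> ys = as @ y # x # bs)"

lemma adj_swap_Cons: "adj_swap xs ys \<Longrightarrow> adj_swap (z # xs) (z # ys)"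
  unfolding adj_swap_def by (elim exE conjE) (intro exI[of _ "z # _"] exI conjI, auto)

lemma adj_swaps_Cons: "adj_swap\<^sup>*\<^sup>* xs ys \<Longrightarrow> adj_swap\<^sup>*\<^sup>* (z # xs) (z # ys)"
  by (induction rule: rtranclp_induct) (auto intro: rtranclp.rtrancl_into_rtrancl adj_swap_Cons)

lemma adj_swaps_move: "adj_swap\<^sup>*\<^sup>* (x # us @ vs) (us @ x # vs)"
proof (induction us)
  case (Cons u us)
  have "adj_swap (x # (u # us) @ vs) (u # x # us @ vs)"
    unfolding adj_swap_def by (intro exI[of _ "[]"] exI[of _ x] exI[of _ u] exI[of _ "us @ vs"]) simp
  also have "adj_swap\<^sup>*\<^sup>* (u # x # us @ vs) (u # us @ x # vs)"
    using Cons by (rule adj_swaps_Cons)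
  finally (converse_rtranclp_into_rtranclp) show ?case by simp
qed simp

lemma mset_eq_adj_swaps: "mset xs = mset ys \<Longrightarrow> adj_swap\<^sup>*\<^sup>* xs ys"
proof (induction xs arbitrary: ys)
  case (Cons x xs)
  then have "x \<in> set ys" by (metis list.set_intros(1) mset_eq_setD)
  then obtain us vs where ys: "ys = us @ x # vs" by (meson split_list)
  with Cons have "adj_swap\<^sup>*\<^sup>* xs (us @ vs)" by simp
  then have "adj_swap\<^sup>*\<^sup>* (x # xs) (x # us @ vs)" by (rule adj_swaps_Cons)
  also have "adj_swap\<^sup>*\<^sup>* (x # us @ vs) ys" unfolding ys by (rule adj_swaps_move)
  finally show ?case .
qed simp

text \<open>The exponent is the sum of \<open>c x y\<close> over all pairs with \<open>x\<close>
  before \<open>y\<close>. Signatures, Koszul signs and the signs attached to a list of siblings are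
  instances with different weights. Values are integers, so signs are compared before they enter the
  coefficient ring.\<close>

fun isgn :: "('a \<Rightarrow> 'a \<Rightarrow> nat) \<Rightarrow> 'a list \<Rightarrow> int" where
  "isgn c [] = 1"
| "isgn c (x # xs) = (-1) ^ sum_list (map (c x) xs) * isgn c xs"

definition cross :: "('a \<Rightarrow> 'b \<Rightarrow> nat) \<Rightarrow> 'a list \<Rightarrow> 'b list \<Rightarrow> nat" where
  "cross c xs ys = (\<Sum>x\<leftarrow>xs. \<Sum>y\<leftarrow>ys. c x y)"

lemma cross_simps [simp]:
  "cross c [] ys = 0"
  "cross c xs [] = 0"
  "cross c (x # xs) ys = sum_list (map (c x) ys) + cross c xs ys"
  "cross c (xs @ xs') ys = cross c xs ys + cross c xs' ys"
  "cross c xs (ys @ ys') = cross c xs ys + cross c xs ys'"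
  by (simp_all add: cross_def sum_list_addf)

lemma cross_Cons_right [simp]: "cross c xs (y # ys) = sum_list (map (\<lambda>x. c x y) xs) + cross c xs ys"
  by (simp add: cross_def sum_list_addf)


lemma cross_mset_cong:
  assumes "mset xs = mset xs'" "mset ys = mset ys'"
  shows "cross c xs ys = cross c xs' ys'"
proof -
  have *: "mset as = mset bs \<Longrightarrow> sum_list (map f as) = sum_list (map f bs)"
    for as bs :: "'d list" and f :: "'d \<Rightarrow> nat"
    by (metis mset_map sum_mset_sum_list)
  show ?thesis unfolding cross_def *[OF assms(2)] by (rule *[OF assms(1)])
qed

lemma cross_cong:
  "(\<And>x y. x \<in> set xs \<Longrightarrow> y \<in> set ys \<Longrightarrow> c x y = d x y) \<Longrightarrow> cross c xs ys = cross d xs ys"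
  unfolding cross_def by (intro arg_cong[where f = sum_list] map_cong refl) simp


lemma isgn_append: "isgn c (xs @ ys) = isgn c xs * isgn c ys * (-1) ^ cross c xs ys"
  by (induction xs) (simp_all add: power_add algebra_simps)

lemma isgn_cases: "isgn c xs = 1 \<or> isgn c xs = -1"
  by (induction xs) (auto simp: uminus_power_if)

lemma isgn_square [simp]: "isgn c xs * isgn c xs = 1"
  using isgn_cases[of c xs] by auto

lemma neg_one_power_eq: "even (a + b) \<Longrightarrow> (-1 :: 'a::comm_ring_1) ^ a = (-1) ^ b"
  by (cases "even a") simp_all

lemma isgn_adj_swap:
  assumes "even (c x y + c y x)"
  shows "isgn c (as @ x # y # bs) = isgn c (as @ y # x # bs)"
proof -
  have "(-1 :: int) ^ c x y = (-1) ^ c y x" using assms by (rule neg_one_power_eq)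
  then show ?thesis by (simp add: isgn_append power_add algebra_simps)
qed

text \<open>An exchange of adjacent entries \<open>x\<close>, \<open>y\<close> replaces
  \<open>c x y\<close> by \<open>c y x\<close> in the exponent and changes nothing else. Even sums
  keep the sign, and adjacent exchanges generate all reorderings.\<close>

lemma isgn_mset_cong:
  assumes "mset xs = mset ys" "\<And>x y. x \<in> set xs \<Longrightarrow> y \<in> set xs \<Longrightarrow> even (c x y + c y x)"
  shows "isgn c xs = isgn c ys"
proof -
  have "adj_swap\<^sup>*\<^sup>* xs ys" using assms(1) by (rule mset_eq_adj_swaps)
  then have "isgn c xs = isgn c ys \<and> set xs = set ys"
  proof (induction rule: rtranclp_induct)
    case (step us vs)
    from step(2) obtain as x y bs where "us = as @ x # y # bs" "vs = as @ y # x # bs"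
      unfolding adj_swap_def by blast
    with step(3) isgn_adj_swap[of c x y as bs] assms(2)[of x y] show ?case by auto
  qed simp
  then show ?thesis by simp
qed

lemma isgn_map: "isgn c (map f xs) = isgn (\<lambda>x y. c (f x) (f y)) xs"
  by (induction xs) (simp_all add: comp_def)

lemma isgn_add: "isgn (\<lambda>x y. c x y + d x y) xs = isgn c xs * isgn d xs"
  by (induction xs) (simp_all add: sum_list_addf power_add algebra_simps)

lemma isgn_cong:
  "(\<And>x y. x \<in> set xs \<Longrightarrow> y \<in> set xs \<Longrightarrow> c x y = d x y) \<Longrightarrow> isgn c xs = isgn d xs"
proof (induction xs)
  case (Cons x xs)
  then have "map (c x) xs = map (d x) xs" by simp
  moreover have "isgn c xs = isgn d xs" using Cons by simp
  ultimately show ?case by (simp only: isgn.simps)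
qed simp

text \<open>Pairs inside a block give the product; pairs in different blocks make up the weight
  \<open>cross c\<close> between blocks. This turns the sign of a word read off a tree into a
  recursion over siblings.\<close>

lemma isgn_concat: "isgn c (concat xss) = isgn (cross c) xss * prod_list (map (isgn c) xss)"
proof (induction xss)
  case (Cons xs xss)
  have "cross c xs (concat xss) = sum_list (map (cross c xs) xss)"
    by (induction xss) simp_all
  then show ?case using Cons by (simp add: isgn_append algebra_simps)
qed simp

lemma isgn_eq_one: "(\<And>x y. x \<in> set xs \<Longrightarrow> y \<in> set xs \<Longrightarrow> c x y = 0) \<Longrightarrow> isgn c xs = 1"
proof (induction xs)
  case (Cons x xs)
  then have "map (c x) xs = map (\<lambda>_. 0) xs" by simp
  then show ?case using Cons by (simp add: map_replicate_const sum_list_replicate)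
qed simp

text \<open>The entry at position \<open>j\<close> is counted once for each later entry, hence the
  factor \<open>length xs - j\<close>. The sum in \<open>alpha'\<close> has this form.\<close>

lemma isgn_left_weight:
  "isgn (\<lambda>x y. w x) xs = (-1) ^ (\<Sum>j=1..length xs. (length xs - j) * w (xs ! (j - 1)))"
proof -
  have "isgn (\<lambda>x y. w x) xs = (-1) ^ (\<Sum>j<length xs. (length xs - Suc j) * w (xs ! j))"
  proof (induction xs)
    case (Cons x xs)
    then show ?case
      by (simp add: sum.lessThan_Suc_shift power_add map_replicate_const sum_list_replicate
          del: sum.lessThan_Suc)
  qed simp
  also have "(\<Sum>j<length xs. (length xs - Suc j) * w (xs ! j)) =
      (\<Sum>j=1..length xs. (length xs - j) * w (xs ! (j - 1)))"
    by (rule sum.reindex_bij_witness[of _ "\<lambda>j. j - 1" Suc]) auto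
  finally show ?thesis .
qed

section \<open>Koszul signs and signatures as signs of words\<close>

definition kweight :: "nat \<times> nat \<Rightarrow> nat \<times> nat \<Rightarrow> nat" where
  "kweight p q = (if fst q < fst p then snd p * snd q else 0)"

lemma koszul_sign_isgn: "koszul_sign xs = of_int (isgn kweight xs)"
proof (induction xs)
  case (Cons p xs)
  obtain a d where p: "p = (a, d)" by (cases p)
  have "d * sum_list (map snd (filter (\<lambda>(b, e). b < a) xs)) = sum_list (map (kweight p) xs)"
    by (induction xs) (auto simp: p kweight_def algebra_simps)
  then show ?case using Cons by (simp add: p)
qed simp

definition lweight :: "nat \<Rightarrow> nat \<Rightarrow> nat" where
  "lweight a b = (if b < a then 1 else 0)"

lemma isgn_lweight_swap:
  assumes "x \<noteq> y"
  shows "isgn lweight (as @ x # y # bs) = - isgn lweight (as @ y # x # bs)"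
proof -
  have "(-1 :: int) ^ lweight x y = - ((-1) ^ lweight y x)" using assms by (auto simp: lweight_def)
  then show ?thesis by (simp add: isgn_append power_add algebra_simps)
qed

lemma isgn_lweight_move:
  assumes "x \<notin> set ms"
  shows "isgn lweight (as @ x # ms @ bs) = (-1) ^ length ms * isgn lweight (as @ ms @ x # bs)"
  using assms
proof (induction ms arbitrary: as)
  case (Cons m ms)
  have "isgn lweight (as @ x # m # ms @ bs) = - isgn lweight ((as @ [m]) @ x # ms @ bs)"
    using Cons.prems isgn_lweight_swap[of x m as "ms @ bs"] by simp
  then show ?case using Cons.IH[of "as @ [m]"] Cons.prems by simp
qed simp

text \<open>\<open>x\<close> passes \<open>ms\<close> to the right, \<open>x\<close> and
  \<open>y\<close> change places, and \<open>y\<close> passes \<open>ms\<close> to the left. The two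
  powers of -1 coming from \<open>ms\<close> cancel, and one sign remains.\<close>

lemma isgn_lweight_transpose:
  assumes "distinct (x # y # ms)"
  shows "isgn lweight (as @ x # ms @ y # bs) = - isgn lweight (as @ y # ms @ x # bs)"
proof -
  have "isgn lweight (as @ x # ms @ y # bs) = (-1) ^ length ms * isgn lweight ((as @ ms) @ x # y # bs)"
    using isgn_lweight_move[of x ms as "y # bs"] assms by simp
  also have "\<dots> = - ((-1) ^ length ms * isgn lweight (as @ ms @ y # x # bs))"
    using isgn_lweight_swap[of x y "as @ ms" bs] assms by simp
  also have "\<dots> = - isgn lweight (as @ y # ms @ x # bs)"
    using isgn_lweight_move[of y ms as "x # bs"] assms by simp
  finally show ?thesis .
qed

lemma isgn_lweight_upt: "isgn lweight [a..<b] = 1"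
proof (induction "b - a" arbitrary: a)
  case (Suc k)
  then have "[a..<b] = a # [Suc a..<b]" by (simp add: upt_conv_Cons)
  moreover have "sum_list (map (lweight a) [Suc a..<b]) = 0"
    by (auto simp: lweight_def sum_list_eq_0_iff)
  ultimately show ?case using Suc by (simp del: sum_list_eq_0_iff upt_Suc)
qed simp

text \<open>Both sides are 1 at the identity and change sign under composition on the right with a
  transposition, which exchanges two entries of the word of values.\<close>

lemma isgn_permutation:
  assumes "\<sigma> permutes {1..n}"
  shows "isgn lweight (map \<sigma> [1..<n+1]) = sign \<sigma>"
proof -
  have main: "isgn lweight (map (p \<circ> transpose a b) [1..<n+1]) = - isgn lweight (map p [1..<n+1])"
    if ab: "a < b" "a \<in> {1..n}" "b \<in> {1..n}" and p: "inj p" for p a b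
  proof -
    have split: "[1..<n+1] = [1..<a] @ a # [a+1..<b] @ b # [b+1..<n+1]"
    proof -
      have "[1..<n+1] = [1..<a] @ [a..<n+1]" "[a..<n+1] = [a..<b] @ [b..<n+1]"
        using upt_add_eq_append[of 1 a "n + 1 - a"] upt_add_eq_append[of a b "n + 1 - b"] ab
        by (simp_all del: upt_Suc)
      moreover have "[a..<b] = a # [a+1..<b]" "[b..<n+1] = b # [b+1..<n+1]"
        using ab by (simp_all add: upt_conv_Cons del: upt_Suc)
      ultimately show ?thesis by (simp del: upt_Suc)
    qed
    have *: "map (p \<circ> transpose a b) xs = map p xs" if "a \<notin> set xs" "b \<notin> set xs" for xs
      using that by (auto simp: transpose_def)
    have d: "distinct (p b # p a # map p [a+1..<b])"
      using ab p by (auto simp: distinct_map inj_eq dest: inj_on_subset[OF _ subset_UNIV])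
    have "map (p \<circ> transpose a b) [1..<a] = map p [1..<a]"
      "map (p \<circ> transpose a b) [a+1..<b] = map p [a+1..<b]"
      "map (p \<circ> transpose a b) [b+1..<n+1] = map p [b+1..<n+1]"
      using ab by (auto intro!: *)
    then show ?thesis
      unfolding split map_append list.map by (simp only: isgn_lweight_transpose[OF d] comp_apply
          transpose_apply_first transpose_apply_second)
  qed
  have swap: "isgn lweight (map (p \<circ> transpose a b) [1..<n+1]) = sign (p \<circ> transpose a b)"
    if ab: "a \<in> {1..n}" "b \<in> {1..n}" "a \<noteq> b" and p: "p permutes {1..n}"
      and IH: "isgn lweight (map p [1..<n+1]) = sign p" for a b p
  proof -
    have "permutation p" using p permutation_permutes by blast
    then have sg: "sign (p \<circ> transpose a b) = - sign p"
      using ab by (simp add: sign_compose permutation_swap_id sign_swap_id)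
    have inj: "inj p" using p by (rule permutes_inj)
    from ab consider "a < b" | "b < a" by linarith
    then show ?thesis
    proof cases
      case 1
      show ?thesis unfolding main[OF 1 ab(1,2) inj] sg IH ..
    next
      case 2
      show ?thesis
        unfolding transpose_commute[of a b] main[OF 2 ab(2,1) inj] sg[unfolded transpose_commute[of a b]] IH ..
    qed
  qed
  show ?thesis
    by (rule permutes_rev_induct[OF finite_atLeastAtMost assms,
          where P = "\<lambda>\<sigma>. isgn lweight (map \<sigma> [1..<n+1]) = sign \<sigma>"])
       (use swap isgn_lweight_upt[of 1 "n + 1"] in \<open>simp_all add: sign_id del: upt_Suc\<close>)
qed

section \<open>Rearrangements of planar trees\<close>

text \<open>\<open>RB 1\<close> has arity 1, so a tree with a single leaf may still have vertices.
  The number of vertices is the invariant that tells such a tree from a leaf when a composite is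
  taken apart.\<close>

fun nodes :: "tree \<Rightarrow> nat" where
  "nodes (Leaf i) = 0"
| "nodes (Node g ts) = Suc (sum_list (map nodes ts))"

lemma leaves_nonempty: "well_formed t \<Longrightarrow> leaves t \<noteq> []"
proof (induction t)
  case (Node g ts)
  then have "ts \<noteq> []" by (cases g) auto
  then obtain t where "t \<in> set ts" by (meson last_in_set)
  with Node show ?case by auto
qed simp

lemma concat_map_concat: "concat (map f (concat xss)) = concat (map (\<lambda>xs. concat (map f xs)) xss)"
  by (induction xss) simp_all

lemma leaves_tsubst: "leaves (tsubst s t) = concat (map (\<lambda>i. leaves (s i)) (leaves t))"
proof (induction t)
  case (Node g ts)
  then have "map (\<lambda>t. leaves (tsubst s t)) ts = map (\<lambda>t. concat (map (\<lambda>i. leaves (s i)) (leaves t))) ts"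
    by simp
  then show ?case by (simp add: concat_map_concat comp_def cong: map_cong)
qed simp

lemma sum_list_concat: "sum_list (concat xss) = sum_list (map sum_list xss)"
  by (induction xss) simp_all

lemma prod_list_concat: "prod_list (concat xss) = prod_list (map prod_list xss)"
  by (induction xss) simp_all

lemma tdeg_tsubst: "tdeg (tsubst s t) = tdeg t + (\<Sum>i\<leftarrow>leaves t. tdeg (s i))"
proof (induction t)
  case (Node g ts)
  have "(\<Sum>t\<leftarrow>ts. tdeg (tsubst s t)) = (\<Sum>t\<leftarrow>ts. tdeg t + (\<Sum>i\<leftarrow>leaves t. tdeg (s i)))"
    using Node by (metis (no_types, lifting) map_eq_conv)
  then show ?case by (simp add: sum_list_addf map_concat sum_list_concat comp_def)
qed simp

lemma nodes_tsubst: "nodes (tsubst s t) = nodes t + (\<Sum>i\<leftarrow>leaves t. nodes (s i))"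
proof (induction t)
  case (Node g ts)
  have "(\<Sum>t\<leftarrow>ts. nodes (tsubst s t)) = (\<Sum>t\<leftarrow>ts. nodes t + (\<Sum>i\<leftarrow>leaves t. nodes (s i)))"
    using Node by (metis (no_types, lifting) map_eq_conv)
  then show ?case by (simp add: sum_list_addf map_concat sum_list_concat comp_def)
qed simp

lemma well_formed_tsubst:
  "well_formed t \<Longrightarrow> (\<And>i. i \<in> set (leaves t) \<Longrightarrow> well_formed (s i)) \<Longrightarrow> well_formed (tsubst s t)"
  by (induction t) auto

lemma tsubst_cong: "(\<And>i. i \<in> set (leaves t) \<Longrightarrow> s i = s' i) \<Longrightarrow> tsubst s t = tsubst s' t"
  by (induction t) auto

lemma tsubst_tsubst: "tsubst s (tsubst s' t) = tsubst (\<lambda>i. tsubst s (s' i)) t"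
  by (induction t) auto

lemma tsubst_Leaf [simp]: "tsubst Leaf t = t"
  by (induction t) (auto intro: map_idI)

lemma leaves_relabel [simp]: "leaves (relabel f t) = map f (leaves t)"
  by (simp add: relabel_def leaves_tsubst concat_map_singleton)

lemma tdeg_relabel [simp]: "tdeg (relabel f t) = tdeg t"
  by (simp add: relabel_def tdeg_tsubst)

lemma well_formed_relabel [simp]: "well_formed (relabel f t) = well_formed t"
  by (induction t) (auto simp: relabel_def)

lemma relabel_simps [simp]:
  "relabel f (Leaf i) = Leaf (f i)"
  "relabel f (Node g ts) = Node g (map (relabel f) ts)"
  by (simp_all add: relabel_def)

lemma relabel_relabel [simp]: "relabel f (relabel h t) = relabel (\<lambda>i. f (h i)) t"
  by (simp add: relabel_def tsubst_tsubst)

lemma tsubst_relabel: "tsubst s (relabel f t) = tsubst (\<lambda>i. s (f i)) t"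
  by (simp add: relabel_def tsubst_tsubst)

lemma relabel_id: "(\<And>i. i \<in> set (leaves t) \<Longrightarrow> f i = i) \<Longrightarrow> relabel f t = t"
  unfolding relabel_def by (metis tsubst_Leaf tsubst_cong)

text \<open>Only adjacent inputs of one vertex are exchanged, so that invariance has to be checked
  for a single pair of siblings. The relation is symmetric, so its reflexive transitive closure is
  already an equivalence.\<close>

inductive swap1 :: "tree \<Rightarrow> tree \<Rightarrow> bool" where
  swap: "swap1 (Node g (as @ x # y # bs)) (Node g (as @ y # x # bs))"
| cong: "swap1 t t' \<Longrightarrow> swap1 (Node g (as @ t # bs)) (Node g (as @ t' # bs))"

abbreviation rearr :: "tree \<Rightarrow> tree \<Rightarrow> bool" where
  "rearr \<equiv> swap1\<^sup>*\<^sup>*"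

lemma swap1_sym: "swap1 t t' \<Longrightarrow> swap1 t' t"
  by (induction rule: swap1.induct) (auto intro: swap1.intros)

lemma rearr_sym: "rearr t t' \<Longrightarrow> rearr t' t"
  by (induction rule: rtranclp_induct) (auto intro: converse_rtranclp_into_rtranclp dest: swap1_sym)

lemma swap1_invariants:
  assumes "swap1 t t'"
  shows "mset (leaves t') = mset (leaves t)" "tdeg t' = tdeg t" "well_formed t' = well_formed t"
    "nodes t' = nodes t" "mset (symbols \<delta> t') = mset (symbols \<delta> t)"
  using assms by (induction rule: swap1.induct) auto

lemma rearr_invariants:
  assumes "rearr t t'"
  shows "mset (leaves t') = mset (leaves t)" "tdeg t' = tdeg t" "well_formed t' = well_formed t"
    "nodes t' = nodes t" "mset (symbols \<delta> t') = mset (symbols \<delta> t)"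
  using assms by (induction rule: rtranclp_induct) (auto simp: swap1_invariants)

lemma rearr_leaves:
  assumes "rearr t t'"
  shows "set (leaves t') = set (leaves t)" "distinct (leaves t') = distinct (leaves t)"
  using rearr_invariants(1)[OF assms] mset_eq_setD mset_eq_imp_distinct_iff by blast+

lemma rearr_cong: "rearr t t' \<Longrightarrow> rearr (Node g (as @ t # bs)) (Node g (as @ t' # bs))"
  by (induction rule: rtranclp_induct) (auto intro: rtranclp.rtrancl_into_rtrancl swap1.cong)

lemma rearr_list_cong:
  "list_all2 rearr ts us \<Longrightarrow> rearr (Node g (as @ ts)) (Node g (as @ us))"
proof (induction ts us arbitrary: as rule: list_all2_induct)
  case (Cons t ts u us)
  have "rearr (Node g (as @ t # ts)) (Node g (as @ u # ts))"
    using Cons by (intro rearr_cong)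
  also have "rearr (Node g (as @ u # ts)) (Node g (as @ u # us))"
    using Cons(3)[of "as @ [u]"] by simp
  finally show ?case .
qed simp

lemma rearr_perm:
  assumes "mset ts = mset us"
  shows "rearr (Node g ts) (Node g us)"
  using mset_eq_adj_swaps[OF assms]
  by (induction rule: rtranclp_induct)
     (auto simp: adj_swap_def intro: rtranclp.rtrancl_into_rtrancl swap1.swap)

lemma swap1_LeafD: "\<not> swap1 (Leaf i) t"
  by (auto elim: swap1.cases)

lemma rearr_LeafD: "rearr (Leaf i) t \<Longrightarrow> t = Leaf i"
  by (induction rule: rtranclp_induct) (auto simp: swap1_LeafD)

lemma swap1_NodeD:
  assumes "swap1 (Node g ts) t'"
  obtains as x y bs where "ts = as @ x # y # bs" "t' = Node g (as @ y # x # bs)"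
  | as t bs u where "ts = as @ t # bs" "swap1 t u" "t' = Node g (as @ u # bs)"
  using assms by (cases rule: swap1.cases) auto

text \<open>Exchanges at the root and rearrangements inside the children commute, so the latter can
  be done first: \<open>vs\<close> are the rearranged children in their old order, and
  \<open>us\<close> is a permutation of them.\<close>

lemma rearr_NodeD:
  assumes "rearr (Node g ts) u"
  shows "\<exists>us vs. u = Node g us \<and> list_all2 rearr ts vs \<and> mset us = mset vs"
  using assms
proof (induction rule: rtranclp_induct)
  case base
  then show ?case by (intro exI[of _ ts]) (auto simp: list_all2_same)
next
  case (step u u')
  then obtain us vs where u: "u = Node g us" "list_all2 rearr ts vs" "mset us = mset vs" by auto
  from step(2)[unfolded u(1)] show ?case
  proof (cases rule: swap1_NodeD)
    case (1 as x y bs)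
    then have "mset (as @ y # x # bs) = mset vs" using u by (auto simp: add_mset_commute)
    then show ?thesis using u 1 by blast
  next
    case (2 as t bs t')
    \<comment> \<open>The move affects one child in the order \<open>us\<close>. The same child is
      located in \<open>vs\<close>, and the rearrangement leading to it from \<open>ts\<close> is
      prolonged by the move.\<close>
    then have "t \<in> set vs" using u(3) by (metis in_set_conv_decomp mset_eq_setD)
    then obtain cs ds where vs: "vs = cs @ t # ds" by (meson split_list)
    have "list_all2 rearr ts (cs @ t' # ds)"
    proof -
      from u(2) obtain us' z zs where "ts = us' @ z # zs" "list_all2 rearr us' cs" "rearr z t"
        "list_all2 rearr zs ds"
        unfolding vs list_all2_append2 list_all2_Cons2 by blast
      moreover have "rearr z t'" using \<open>rearr z t\<close> 2(2) by simp
      ultimately show ?thesis by (simp add: list_all2_appendI)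
    qed
    moreover have "mset (as @ t' # bs) = mset (cs @ t' # ds)" using u(3) 2 vs by simp
    ultimately show ?thesis using 2 by blast
  qed
qed

lemma swap1_tsubst: "swap1 t t' \<Longrightarrow> swap1 (tsubst s t) (tsubst s t')"
  by (induction rule: swap1.induct) (auto intro: swap1.intros)

lemma rearr_tsubst_arg:
  "(\<And>i. i \<in> set (leaves t) \<Longrightarrow> rearr (s i) (s' i)) \<Longrightarrow> rearr (tsubst s t) (tsubst s' t)"
proof (induction t)
  case (Node g ts)
  then have "list_all2 rearr (map (tsubst s) ts) (map (tsubst s') ts)"
    by (auto simp: list_all2_map1 list_all2_map2 intro!: list.rel_refl_strong)
  then show ?case using rearr_list_cong[of _ _ g "[]"] by simp
qed simp

lemma rearr_tsubst:
  assumes "rearr t t'" "\<And>i. i \<in> set (leaves t) \<Longrightarrow> rearr (s i) (s' i)"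
  shows "rearr (tsubst s t) (tsubst s' t')"
proof -
  have "rearr (tsubst s t) (tsubst s' t)" using assms(2) by (rule rearr_tsubst_arg)
  also have "rearr (tsubst s' t) (tsubst s' t')"
    using assms(1) by (induction rule: rtranclp_induct) (auto intro: rtranclp.rtrancl_into_rtrancl swap1_tsubst)
  finally show ?thesis .
qed

text \<open>A move in a composite takes place at a vertex of \<open>t\<close> or inside one grafted
  tree. As the leaves of \<open>t\<close> are distinct, a change of \<open>s\<close> at one leaf
  affects only one place. The last conjunct makes the induction work: the other children of a node
  have no leaf at which \<open>s'\<close> differs from \<open>s\<close>.\<close>

lemma swap1_tsubstD:
  assumes "swap1 (tsubst s t) u" "distinct (leaves t)"
  shows "\<exists>t' s'. u = tsubst s' t' \<and> rearr t t' \<and> (\<forall>i\<in>set (leaves t). rearr (s i) (s' i)) \<and>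
    (\<forall>i. i \<notin> set (leaves t) \<longrightarrow> s' i = s i)"
  using assms
proof (induction t arbitrary: u)
  case (Leaf i)
  then show ?case by (intro exI[of _ "Leaf i"] exI[of _ "s(i := u)"]) auto
next
  case (Node g ts)
  from Node.prems(1) have "swap1 (Node g (map (tsubst s) ts)) u" by simp
  then show ?case
  proof (cases rule: swap1_NodeD)
    case (1 as x y bs)
    then obtain as' x' y' bs' where ts: "ts = as' @ x' # y' # bs'"
      and "as = map (tsubst s) as'" "x = tsubst s x'" "y = tsubst s y'" "bs = map (tsubst s) bs'"
      by (auto simp: map_eq_append_conv map_eq_Cons_conv)
    then have "u = tsubst s (Node g (as' @ y' # x' # bs'))" using 1 by simp
    moreover have "rearr (Node g ts) (Node g (as' @ y' # x' # bs'))"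
      unfolding ts by (intro r_into_rtranclp swap1.swap)
    ultimately show ?thesis by blast
  next
    case (2 as x bs v)
    then obtain as' x' bs' where ts: "ts = as' @ x' # bs'"
      and eq: "as = map (tsubst s) as'" "x = tsubst s x'" "bs = map (tsubst s) bs'"
      by (auto simp: map_eq_append_conv map_eq_Cons_conv)
    have "distinct (leaves x')" using Node.prems(2) ts by simp
    then obtain t' s' where *: "v = tsubst s' t'" "rearr x' t'"
       "\<forall>i\<in>set (leaves x'). rearr (s i) (s' i)" "\<forall>i. i \<notin> set (leaves x') \<longrightarrow> s' i = s i"
      using Node.IH[of x' v] 2(2) eq ts by auto
    have "map (tsubst s') as' = as" "map (tsubst s') bs' = bs"
      using Node.prems(2) *(4) unfolding eq ts by (fastforce intro!: tsubst_cong)+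
    then have "u = tsubst s' (Node g (as' @ t' # bs'))" using 2 *(1) by simp
    moreover have "rearr (Node g ts) (Node g (as' @ t' # bs'))"
      unfolding ts by (intro rearr_cong *)
    moreover have "rearr (s i) (s' i)" for i using *(3,4) by (cases "i \<in> set (leaves x')") auto
    moreover have "\<forall>i. i \<notin> set (leaves (Node g ts)) \<longrightarrow> s' i = s i" using *(4) ts by simp
    ultimately show ?thesis by blast
  qed
qed

lemma rearr_tsubstD:
  assumes "rearr (tsubst s t) u" "distinct (leaves t)"
  shows "\<exists>t' s'. u = tsubst s' t' \<and> rearr t t' \<and> (\<forall>i\<in>set (leaves t). rearr (s i) (s' i))"
  using assms
proof (induction rule: rtranclp_induct)
  case base
  then show ?case by blast
next
  case (step u v)
  then obtain t' s' where *: "u = tsubst s' t'" "rearr t t'" "\<forall>i\<in>set (leaves t). rearr (s i) (s' i)"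
    by blast
  obtain t'' s'' where **: "v = tsubst s'' t''" "rearr t' t''" "\<forall>i\<in>set (leaves t'). rearr (s' i) (s'' i)"
    using swap1_tsubstD[OF step(2)[unfolded *(1)]] rearr_leaves[OF *(2)] step.prems by auto
  have "rearr t t''" using *(2) **(2) by simp
  moreover have "\<forall>i\<in>set (leaves t). rearr (s i) (s'' i)"
    using *(3) **(3) rearr_leaves(1)[OF *(2)] by (metis rtranclp_trans)
  ultimately show ?case using **(1) by blast
qed

definition rclass :: "tree \<Rightarrow> tree set" where
  "rclass t = {t'. rearr t t'}"

lemma rclass_Leaf [simp]: "rclass (Leaf i) = {Leaf i}"
  by (auto simp: rclass_def dest: rearr_LeafD)


lemma rclass_eq: "rearr t t' \<Longrightarrow> rclass t = rclass t'"
  unfolding rclass_def by (auto dest: rearr_sym)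

lemma finite_rclass: "finite (rclass t)"
proof (induction t)
  case (Node g ts)
  let ?X = "\<Union>t\<in>set ts. rclass t"
  have "rclass (Node g ts) \<subseteq> Node g ` {us. set us \<subseteq> ?X \<and> length us = length ts}"
  proof
    fix u assume "u \<in> rclass (Node g ts)"
    then obtain us vs where *: "u = Node g us" "list_all2 rearr ts vs" "mset us = mset vs"
      using rearr_NodeD unfolding rclass_def by blast
    have "set vs \<subseteq> ?X"
      using *(2) by (induction rule: list_all2_induct) (auto simp: rclass_def)
    moreover have "set us = set vs" "length us = length vs" using *(3) by (metis mset_eq_setD, metis mset_eq_length)
    ultimately show "u \<in> Node g ` {us. set us \<subseteq> ?X \<and> length us = length ts}"
      using *(1) list_all2_lengthD[OF *(2)] by auto
  qed
  moreover have "finite {us. set us \<subseteq> ?X \<and> length us = length ts}"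
    using Node by (intro finite_lists_length_eq) auto
  ultimately show ?case using finite_surj by blast
qed simp

lemma distinct_leaves_tsubst:
  assumes "distinct (leaves t)"
  shows "distinct (leaves (tsubst s t)) \<longleftrightarrow>
    (\<forall>i\<in>set (leaves t). distinct (leaves (s i))) \<and>
    (\<forall>i\<in>set (leaves t). \<forall>j\<in>set (leaves t). i \<noteq> j \<longrightarrow> set (leaves (s i)) \<inter> set (leaves (s j)) = {})"
proof -
  have *: "distinct (concat (map f xs)) \<longleftrightarrow> (\<forall>i\<in>set xs. distinct (f i)) \<and>
     (\<forall>i\<in>set xs. \<forall>j\<in>set xs. i \<noteq> j \<longrightarrow> set (f i) \<inter> set (f j) = {})"
    if "distinct xs" for f :: "nat \<Rightarrow> nat list" and xs
    using that
  proof (induction xs)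
    case (Cons x xs)
    define D where "D i j \<longleftrightarrow> set (f i) \<inter> set (f j) = {}" for i j
    have sym: "D i j \<Longrightarrow> D j i" for i j by (auto simp: D_def)
    have x: "x \<notin> set xs" using Cons.prems by simp
    have "distinct (concat (map f (x # xs))) \<longleftrightarrow>
        distinct (f x) \<and> (\<forall>j\<in>set xs. D x j) \<and> distinct (concat (map f xs))"
      by (auto simp: D_def)
    also have "distinct (concat (map f xs)) \<longleftrightarrow> (\<forall>i\<in>set xs. distinct (f i)) \<and>
        (\<forall>i\<in>set xs. \<forall>j\<in>set xs. i \<noteq> j \<longrightarrow> D i j)"
      unfolding D_def by (rule Cons.IH) (use Cons.prems in simp)
    also have "(\<forall>j\<in>set xs. D x j) \<and> (\<forall>i\<in>set xs. distinct (f i)) \<and>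
        (\<forall>i\<in>set xs. \<forall>j\<in>set xs. i \<noteq> j \<longrightarrow> D i j) \<longleftrightarrow> (\<forall>i\<in>set xs. distinct (f i)) \<and>
        (\<forall>i\<in>insert x (set xs). \<forall>j\<in>insert x (set xs). i \<noteq> j \<longrightarrow> D i j)"
      (is "?L \<longleftrightarrow> ?R")
    proof
      assume L: ?L
      have "D i j" if "i \<in> insert x (set xs)" "j \<in> insert x (set xs)" "i \<noteq> j" for i j
      proof (cases "i = x")
        case True then show ?thesis using that L by simp
      next
        case False then show ?thesis using that L sym[of x i] by (cases "j = x") simp_all
      qed
      then show ?R using L by blast
    next
      assume R: ?R
      have "D x j" if "j \<in> set xs" for j
        using R that x by (metis insert_iff)
      then show ?L using R by blast
    qed
    finally show ?case by (simp only: D_def list.set ball_simps conj_assoc)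
  qed simp
  show ?thesis unfolding leaves_tsubst by (rule *[OF assms])
qed

lemma distinct_leaves_child: "distinct (leaves (Node g ts)) \<Longrightarrow> t \<in> set ts \<Longrightarrow> distinct (leaves t)"
  by (induction ts) auto

lemma leaves_child: "t \<in> set ts \<Longrightarrow> set (leaves t) \<subseteq> set (leaves (Node g ts))"
  by auto

text \<open>A leaf \<open>j\<close> of \<open>t\<close> other than \<open>i\<close> would bring the
  labels of \<open>s2 j\<close> into \<open>s1 i\<close>, although these label sets are disjoint and
  nonempty.\<close>

lemma tsubst_eq_leaf:
  assumes eq: "s1 i = tsubst s2 t" and wf: "well_formed t" and dist: "distinct (leaves t)"
    and disj: "\<And>j. j \<in> set (leaves t) \<Longrightarrow> j \<noteq> i \<Longrightarrow> set (leaves (s1 i)) \<inter> set (leaves (s2 j)) = {}"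
    and wfs: "\<And>j. j \<in> set (leaves t) \<Longrightarrow> well_formed (s2 j)"
    and nodes: "i \<in> set (leaves t) \<Longrightarrow> nodes (s1 i) = nodes (s2 i)"
  shows "t = Leaf i"
proof -
  have "j = i" if j: "j \<in> set (leaves t)" for j
  proof (rule ccontr)
    assume "j \<noteq> i"
    then have "set (leaves (s1 i)) \<inter> set (leaves (s2 j)) = {}" using disj j by blast
    moreover have "set (leaves (s2 j)) \<subseteq> set (leaves (s1 i))" using j unfolding eq leaves_tsubst by auto
    ultimately show False using leaves_nonempty[OF wfs[OF j]] by (simp add: Int_absorb1)
  qed
  then have "set (leaves t) \<subseteq> {i}" by blast
  moreover have "set (leaves t) \<noteq> {}" using leaves_nonempty[OF wf] by simp
  ultimately have "set (leaves t) = {i}" by (metis subset_singletonD)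
  then have "length (leaves t) = 1" using distinct_card[OF dist] by simp
  then have "leaves t = [i]" using \<open>set (leaves t) = {i}\<close> by (cases "leaves t") auto
  \<comment> \<open>A single leaf does not yet make \<open>t\<close> a leaf, because of vertices of
    arity 1; the equal numbers of vertices of \<open>s1 i\<close> and \<open>s2 i\<close> exclude
    them.\<close>
  then have "nodes t = 0" using nodes nodes_tsubst[of s2 t] eq by simp
  then have "\<exists>k. t = Leaf k" by (cases t) auto
  then show ?thesis using \<open>leaves t = [i]\<close> by auto
qed

text \<open>The label sets show where \<open>t1\<close> ends and the grafted trees begin. The index
  set \<open>I\<close> stays fixed when the induction passes to children, whose leaves are only a
  part of it.\<close>

lemma tsubst_inj:
  assumes "tsubst s1 t1 = tsubst s2 t2" "well_formed t1" "well_formed t2"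
    "distinct (leaves t1)" "distinct (leaves t2)"
    "\<And>i. i \<in> I \<Longrightarrow> well_formed (s1 i) \<and> well_formed (s2 i) \<and> nodes (s1 i) = nodes (s2 i)"
    "\<And>i j. i \<in> I \<Longrightarrow> j \<in> I \<Longrightarrow> i \<noteq> j \<Longrightarrow> set (leaves (s1 i)) \<inter> set (leaves (s2 j)) = {}"
    "set (leaves t1) \<subseteq> I" "set (leaves t2) \<subseteq> I"
  shows "t1 = t2 \<and> (\<forall>i\<in>set (leaves t1). s1 i = s2 i)"
  using assms
proof (induction t1 arbitrary: t2)
  case (Leaf i)
  have "t2 = Leaf i"
  proof (rule tsubst_eq_leaf[of s1 i s2])
    show "s1 i = tsubst s2 t2" using Leaf.prems(1) by simp
    show "set (leaves (s1 i)) \<inter> set (leaves (s2 j)) = {}" if "j \<in> set (leaves t2)" "j \<noteq> i" for j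
      using that Leaf.prems(7)[of i j] Leaf.prems(8,9) by auto
    show "well_formed (s2 j)" if "j \<in> set (leaves t2)" for j using that Leaf.prems(6,9) by blast
    show "nodes (s1 i) = nodes (s2 i)" using Leaf.prems(6)[of i] Leaf.prems(8) by simp
  qed (fact Leaf.prems)+
  then show ?case using Leaf.prems by simp
next
  case (Node g ts)
  show ?case
  proof (cases t2)
    case (Leaf i)
    have "Node g ts = Leaf i"
    proof (rule tsubst_eq_leaf[of s2 i s1])
      show "s2 i = tsubst s1 (Node g ts)" using Node.prems(1) Leaf by simp
      show "set (leaves (s2 i)) \<inter> set (leaves (s1 j)) = {}"
        if "j \<in> set (leaves (Node g ts))" "j \<noteq> i" for j
        using that Node.prems(7)[of j i] Node.prems(8,9) Leaf by auto
      show "well_formed (s1 j)" if "j \<in> set (leaves (Node g ts))" for j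
        using that Node.prems(6,8) by blast
      show "nodes (s2 i) = nodes (s1 i)" using Node.prems(6)[of i] Node.prems(9) Leaf by simp
    qed (fact Node.prems)+
    then show ?thesis by simp
  next
    case 2: (Node g' us)
    have map: "map (tsubst s1) ts = map (tsubst s2) us" and g: "g = g'" using Node.prems(1) 2 by simp_all
    then have len: "length ts = length us" by (metis length_map)
    have *: "ts ! n = us ! n \<and> (\<forall>i\<in>set (leaves (ts ! n)). s1 i = s2 i)" if n: "n < length ts" for n
    proof (rule Node.IH)
      show "ts ! n \<in> set ts" using n by simp
      show "tsubst s1 (ts ! n) = tsubst s2 (us ! n)" using map n len by (metis nth_map)
      show "well_formed (ts ! n)" "well_formed (us ! n)" using Node.prems(2,3) 2 n len by simp_all
      show "distinct (leaves (ts ! n))" "distinct (leaves (us ! n))"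
        using distinct_leaves_child Node.prems(4,5) 2 n len by (metis nth_mem)+
      show "set (leaves (ts ! n)) \<subseteq> I" "set (leaves (us ! n)) \<subseteq> I"
        using order_trans[OF leaves_child] Node.prems(8,9) 2 n len by (metis nth_mem)+
      show "well_formed (s1 i) \<and> well_formed (s2 i) \<and> nodes (s1 i) = nodes (s2 i)" if "i \<in> I" for i
        using that by (rule Node.prems(6))
      show "set (leaves (s1 i)) \<inter> set (leaves (s2 j)) = {}" if "i \<in> I" "j \<in> I" "i \<noteq> j" for i j
        using that by (rule Node.prems(7))
    qed
    then have "ts = us" using len by (simp add: list_eq_iff_nth_eq)
    moreover have "s1 i = s2 i" if i: "i \<in> set (leaves (Node g ts))" for i
    proof -
      from i obtain t where t: "t \<in> set ts" "i \<in> set (leaves t)" by auto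
      then obtain n where "n < length ts" "t = ts ! n" by (metis in_set_conv_nth)
      with * t show ?thesis by blast
    qed
    ultimately show ?thesis using 2 g by simp
  qed
qed

section \<open>Signs of rearrangements\<close>

fun tsign :: "(tree \<Rightarrow> tree \<Rightarrow> nat) \<Rightarrow> tree \<Rightarrow> int" where
  "tsign c (Leaf i) = 1"
| "tsign c (Node g ts) = isgn c ts * prod_list (map (tsign c) ts)"

lemma tsign_square [simp]: "tsign c t * tsign c t = 1"
proof (induction t)
  case (Node g ts)
  have "prod_list (map (tsign c) ts) * prod_list (map (tsign c) ts) = 1"
    using Node
  proof (induction ts)
    case (Cons t ts)
    then have "tsign c t * tsign c t = 1" "prod_list (map (tsign c) ts) * prod_list (map (tsign c) ts) = 1"
      by simp_all
    then show ?case by (simp add: mult.assoc mult.left_commute[of _ "tsign c t"])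
  qed simp
  then show ?case by (simp add: mult.assoc mult.left_commute[of _ "isgn c ts"])
qed simp

lemma tsign_add: "tsign (\<lambda>x y. c x y + d x y) t = tsign c t * tsign d t"
proof (induction t)
  case (Node g ts)
  then have "prod_list (map (tsign (\<lambda>x y. c x y + d x y)) ts) =
      prod_list (map (tsign c) ts) * prod_list (map (tsign d) ts)"
    by (induction ts) simp_all
  then show ?case by (simp add: isgn_add)
qed simp

lemma tsign_cong:
  assumes "\<And>x y. set (leaves x) \<subseteq> set (leaves t) \<Longrightarrow> set (leaves y) \<subseteq> set (leaves t) \<Longrightarrow> c x y = d x y"
  shows "tsign c t = tsign d t"
  using assms
proof (induction t)
  case (Node g ts)
  have "tsign c x = tsign d x" if "x \<in> set ts" for x
    using Node.IH[OF that] Node.prems leaves_child[OF that, of g] by (meson order_trans)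
  then have "map (tsign c) ts = map (tsign d) ts" by simp
  moreover have "isgn c ts = isgn d ts"
    by (rule isgn_cong) (intro Node.prems leaves_child)
  ultimately show ?case by (simp only: tsign.simps)
qed simp

text \<open>The vertices of the composite are those of \<open>t\<close> and those of the grafted
  trees. At a vertex of \<open>t\<close> the weight sees the children together with everything
  grafted onto them.\<close>

lemma tsign_tsubst:
  "tsign c (tsubst s t) =
    prod_list (map (\<lambda>i. tsign c (s i)) (leaves t)) * tsign (\<lambda>x y. c (tsubst s x) (tsubst s y)) t"
proof (induction t)
  case (Node g ts)
  let ?p = "\<lambda>t. prod_list (map (\<lambda>i. tsign c (s i)) (leaves t))"
  let ?d = "\<lambda>x y. c (tsubst s x) (tsubst s y)"
  have "prod_list (map (\<lambda>t. tsign c (tsubst s t)) ts) =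
     prod_list (map ?p ts) * prod_list (map (tsign ?d) ts)"
    using Node by (induction ts) simp_all
  moreover have "prod_list (map (\<lambda>i. tsign c (s i)) (leaves (Node g ts))) = prod_list (map ?p ts)"
    by (simp add: map_concat prod_list_concat comp_def)
  ultimately show ?case by (simp add: isgn_map comp_def)
qed simp

text \<open>The principle behind the sign comparisons on trees. A move replaces \<open>c x y\<close>
  by \<open>c y x\<close> at its own vertex, which \<open>even\<close> controls; at the vertex
  below, the weight could only change if it saw the inner order of a subtree, which
  \<open>inv\<close> excludes. \<open>P\<close> carries the side conditions to subtrees and along
  moves.\<close>

lemma tsign_rearr:
  assumes "rearr t t'" "P t"
    and child: "\<And>g ts x. P (Node g ts) \<Longrightarrow> x \<in> set ts \<Longrightarrow> P x"
    and closed: "\<And>u u'. swap1 u u' \<Longrightarrow> P u \<Longrightarrow> P u'"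
    and even: "\<And>g as x y bs. P (Node g (as @ x # y # bs)) \<Longrightarrow> even (c x y + c y x)"
    and inv: "\<And>u u' z. swap1 u u' \<Longrightarrow> c u z = c u' z \<and> c z u = c z u'"
  shows "tsign c t = tsign c t'"
proof -
  have *: "tsign c u = tsign c u'" if "swap1 u u'" "P u" for u u'
    using that
  proof (induction rule: swap1.induct)
    case (swap g as x y bs)
    have "isgn c (as @ x # y # bs) = isgn c (as @ y # x # bs)"
      using even[OF swap] by (rule isgn_adj_swap)
    then show ?case by simp
  next
    case (cong u u' g as bs)
    have "P u" using cong.prems child by (metis in_set_conv_decomp)
    then have "tsign c u = tsign c u'" using cong.IH by blast
    moreover have "isgn c (as @ u # bs) = isgn c (as @ u' # bs)"
    proof -
      have "c u = c u'" "(\<lambda>x. c x u) = (\<lambda>x. c x u')" using inv[OF cong.hyps] by auto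
      then show ?thesis by (simp add: isgn_append)
    qed
    ultimately show ?case by simp
  qed
  have "tsign c t = tsign c t' \<and> P t'" using assms(1)
  proof (induction rule: rtranclp_induct)
    case (step u v)
    then show ?case using *[OF step(2)] closed[OF step(2)] by simp
  qed (use assms(2) in simp)
  then show ?thesis by simp
qed

text \<open>
  With this weight, \<open>tsign\<close> is the sign of the rearrangement that brings the children of every
  vertex into shuffle order; the \<open>1\<close> accounts for the sign representation.
\<close>

definition mweight :: "tree \<Rightarrow> tree \<Rightarrow> nat" where
  "mweight x y = (if Min (set (leaves y)) < Min (set (leaves x)) then 1 + tdeg x * tdeg y else 0)"

definition orient :: "tree \<Rightarrow> int" where
  "orient = tsign mweight"

lemma orient_square [simp]: "orient t * orient t = 1"
  by (simp add: orient_def)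

lemma orient_Leaf [simp]: "orient (Leaf i) = 1"
  by (simp add: orient_def)

section \<open>Koszul signs of symbol words as signs of trees\<close>

definition kcross :: "(nat \<Rightarrow> nat) \<Rightarrow> tree \<Rightarrow> tree \<Rightarrow> nat" where
  "kcross \<delta> x y = cross kweight (symbols \<delta> x) (symbols \<delta> y)"

text \<open>The symbol of the root has rank 0 and stands first, so it is never moved; the rest is
  the concatenation of the words of the children.\<close>

lemma isgn_symbols: "isgn kweight (symbols \<delta> t) = tsign (kcross \<delta>) t"
proof (induction t)
  case (Node g ts)
  have "sum_list (map (kweight (0, d)) xs) = 0" for d xs
    by (induction xs) (simp_all add: kweight_def)
  then have "isgn kweight (symbols \<delta> (Node g ts)) = isgn kweight (concat (map (symbols \<delta>) ts))"
    by (simp only: symbols.simps isgn.simps power_0 mult_1)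
  also have "\<dots> = isgn (kcross \<delta>) ts * prod_list (map (\<lambda>t. isgn kweight (symbols \<delta> t)) ts)"
    unfolding isgn_concat isgn_map by (simp add: comp_def kcross_def[abs_def])
  also have "map (\<lambda>t. isgn kweight (symbols \<delta> t)) ts = map (tsign (kcross \<delta>)) ts"
    using Node by simp
  finally show ?case by simp
qed simp

text \<open>The pairs of equal rank, which \<open>kweight\<close> counts in neither order. Adding
  them completes the two Koszul exponents to the product of the total degrees.\<close>

definition eqweight :: "nat \<times> nat \<Rightarrow> nat \<times> nat \<Rightarrow> nat" where
  "eqweight p q = (if fst p = fst q then snd p * snd q else 0)"

lemma cross_kweight_total:
  "cross kweight xs ys + cross kweight ys xs + cross eqweight xs ys =
    sum_list (map snd xs) * sum_list (map snd ys)"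
proof (induction xs)
  case (Cons p xs)
  have "sum_list (map (kweight p) ys) + sum_list (map (\<lambda>q. kweight q p) ys) +
      sum_list (map (eqweight p) ys) = snd p * sum_list (map snd ys)"
    by (induction ys) (auto simp: kweight_def eqweight_def algebra_simps)
  with Cons show ?case by (simp add: algebra_simps)
qed simp

lemma cross_concat_left: "cross c (concat xss) ys = (\<Sum>xs\<leftarrow>xss. cross c xs ys)"
  by (induction xss) simp_all

text \<open>No leaf rank of \<open>x\<close> occurs in \<open>ys\<close>, so only the vertex symbols
  of \<open>x\<close>, all of rank 0, can meet a symbol of equal rank.\<close>

lemma cross_eqweight_symbols:
  assumes "\<And>q. q \<in> set ys \<Longrightarrow> fst q \<notin> set (leaves x)"
  shows "cross eqweight (symbols \<delta> x) ys = tdeg x * sum_list (map snd (filter (\<lambda>q. fst q = 0) ys))"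
  using assms
proof (induction x)
  case (Leaf i)
  then have "map (eqweight (i, \<delta> i)) ys = map (\<lambda>_. 0) ys"
    by (intro map_cong refl) (simp add: eqweight_def, metis)
  then have "sum_list (map (eqweight (i, \<delta> i)) ys) = 0" by (simp only: sum_list_0)
  then show ?case by simp
next
  case (Node g ts)
  let ?z = "sum_list (map snd (filter (\<lambda>q. fst q = 0) ys))"
  have "sum_list (map (eqweight (0, d)) ys) = d * ?z" for d
    by (induction ys) (simp_all add: eqweight_def algebra_simps)
  moreover have "(\<Sum>t\<leftarrow>ts. cross eqweight (symbols \<delta> t) ys) = (\<Sum>t\<leftarrow>ts. tdeg t * ?z)"
    using Node by (intro arg_cong[where f = sum_list] map_cong refl Node.IH) auto
  ultimately show ?case by (simp add: cross_concat_left comp_def algebra_simps sum_list_mult_const)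
qed

lemma fst_symbols: "fst ` set (symbols \<delta> t) \<subseteq> insert 0 (set (leaves t))"
  by (induction t) auto

lemma sum_zero_symbols:
  "0 \<notin> set (leaves t) \<Longrightarrow> sum_list (map snd (filter (\<lambda>q. fst q = 0) (symbols \<delta> t))) = tdeg t"
proof (induction t)
  case (Node g ts)
  have "map (\<lambda>t. sum_list (map snd (filter (\<lambda>q. fst q = 0) (symbols \<delta> t)))) ts = map tdeg ts"
    using Node by (intro map_cong refl Node.IH) auto
  then show ?case by (simp add: filter_concat map_concat sum_list_concat comp_def cong: map_cong)
qed simp

lemma sum_symbols: "sum_list (map snd (symbols \<delta> t)) = tdeg t + sum_list (map \<delta> (leaves t))"
proof (induction t)
  case (Node g ts)
  have "map (\<lambda>t. sum_list (map snd (symbols \<delta> t))) ts = map (\<lambda>t. tdeg t + sum_list (map \<delta> (leaves t))) ts"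
    using Node by (intro map_cong refl Node.IH) auto
  then show ?case by (simp add: map_concat sum_list_concat comp_def sum_list_addf cong: map_cong)
qed simp

text \<open>Between subtrees with disjoint leaves, equal ranks occur only among vertices and
  contribute \<open>tdeg x * tdeg y\<close>. With \<delta> the degrees of the trees to be grafted,
  the two factors on the right are the degrees of the composites.\<close>

lemma kcross_total:
  assumes "0 \<notin> set (leaves x)" "0 \<notin> set (leaves y)" "set (leaves x) \<inter> set (leaves y) = {}"
  shows "kcross \<delta> x y + kcross \<delta> y x + tdeg x * tdeg y =
    (tdeg x + sum_list (map \<delta> (leaves x))) * (tdeg y + sum_list (map \<delta> (leaves y)))"
proof -
  have "fst q \<notin> set (leaves x)" if "q \<in> set (symbols \<delta> y)" for q
    using fst_symbols[of \<delta> y] that assms by fastforce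
  then have "cross eqweight (symbols \<delta> x) (symbols \<delta> y) = tdeg x * tdeg y"
    using cross_eqweight_symbols sum_zero_symbols[OF assms(2)] by metis
  with cross_kweight_total[of "symbols \<delta> x" "symbols \<delta> y"] show ?thesis
    by (simp add: kcross_def sum_symbols)
qed

text \<open>
  Disjointness of the leaf sets of the grafted trees is part of \<open>distinct (leaves (tsubst s t))\<close>.
\<close>

definition composable :: "tree \<Rightarrow> (nat \<Rightarrow> tree) \<Rightarrow> bool" where
  "composable t s \<longleftrightarrow> well_formed t \<and> distinct (leaves t) \<and> 0 \<notin> set (leaves t) \<and>
    distinct (leaves (tsubst s t)) \<and> (\<forall>i\<in>set (leaves t). well_formed (s i))"

lemma composable_child:
  assumes "composable (Node g ts) s" "x \<in> set ts"
  shows "composable x s"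
proof -
  have "tsubst s x \<in> set (map (tsubst s) ts)" using assms(2) by simp
  then show ?thesis
    using assms distinct_leaves_child[of g "map (tsubst s) ts" "tsubst s x"]
      distinct_leaves_child[of g ts x] leaves_child[OF assms(2), of g]
    unfolding composable_def by auto
qed

lemma composable_swap1: "swap1 t t' \<Longrightarrow> composable t s \<Longrightarrow> composable t' s"
  unfolding composable_def
  using rearr_leaves[OF r_into_rtranclp, of t t'] swap1_invariants(3)[of t t']
    rearr_leaves(2)[OF r_into_rtranclp, OF swap1_tsubst, of t t' s]
  by simp

lemma swap1_mweight:
  assumes "swap1 u u'"
  shows "mweight u z = mweight u' z \<and> mweight z u = mweight z u'"
  using rearr_leaves(1)[OF r_into_rtranclp, OF assms] swap1_invariants(2)[OF assms]
  by (simp add: mweight_def)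

text \<open>Disjoint nonempty leaf sets have different minima, so exactly one of the two weights is
  nonzero.\<close>

lemma even_mweight:
  assumes "well_formed x" "well_formed y" "set (leaves x) \<inter> set (leaves y) = {}"
  shows "mweight x y + mweight y x = 1 + tdeg x * tdeg y"
proof -
  have "Min (set (leaves x)) \<in> set (leaves x)" "Min (set (leaves y)) \<in> set (leaves y)"
    using assms leaves_nonempty by (simp_all add: Min_in)
  then have "Min (set (leaves x)) \<noteq> Min (set (leaves y))" using assms(3) by (metis disjoint_iff)
  then show ?thesis by (auto simp: mweight_def)
qed

lemma composable_siblings:
  assumes "composable (Node g (as @ x # y # bs)) s"
  shows "composable x s" "composable y s" "set (leaves x) \<inter> set (leaves y) = {}"
    "set (leaves (tsubst s x)) \<inter> set (leaves (tsubst s y)) = {}"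
  using composable_child[OF assms, of x] composable_child[OF assms, of y] assms
  by (auto simp: composable_def)

text \<open>The core of the compatibility with composition. Let X and Y be siblings
  \<open>x\<close>, \<open>y\<close> of \<open>t\<close> with the trees of \<open>s\<close> grafted
  onto them. Exchanging \<open>x\<close> and \<open>y\<close> changes the three signs by the
  exponents 1 + |X| |Y|, |X| |Y| - |x| |y| and 1 + |x| |y|, whose sum is even.\<close>

lemma orient_tsubst_class:
  assumes "composable t s" "rearr t t'"
  shows "tsign (\<lambda>x y. mweight (tsubst s x) (tsubst s y)) t * tsign (kcross (\<lambda>i. tdeg (s i))) t * orient t =
    tsign (\<lambda>x y. mweight (tsubst s x) (tsubst s y)) t' * tsign (kcross (\<lambda>i. tdeg (s i))) t' * orient t'"
proof -
  let ?\<delta> = "\<lambda>i. tdeg (s i)"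
  let ?c = "\<lambda>x y. (mweight (tsubst s x) (tsubst s y) + kcross ?\<delta> x y) + mweight x y"
  have "tsign ?c t = tsign ?c t'"
  proof (rule tsign_rearr[where P = "\<lambda>t. composable t s", OF assms(2,1)])
    fix g as x y bs assume *: "composable (Node g (as @ x # y # bs)) s"
    note sib = composable_siblings[OF *]
    have wf: "well_formed x" "well_formed y" "well_formed (tsubst s x)" "well_formed (tsubst s y)"
      and zero: "0 \<notin> set (leaves x)" "0 \<notin> set (leaves y)"
      using sib(1,2) by (auto simp: composable_def intro!: well_formed_tsubst)
    \<comment> \<open>\<open>tdeg x * tdeg y\<close> is carried along on both sides because
      \<open>kcross_total\<close> yields the Koszul part only together with it; this avoids a
      subtraction of natural numbers.\<close>
    have "mweight (tsubst s x) (tsubst s y) + mweight (tsubst s y) (tsubst s x) +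
       (kcross ?\<delta> x y + kcross ?\<delta> y x + tdeg x * tdeg y) + (mweight x y + mweight y x) =
       2 * (1 + tdeg (tsubst s x) * tdeg (tsubst s y)) + tdeg x * tdeg y"
      unfolding even_mweight[OF wf(1,2) sib(3)] even_mweight[OF wf(3,4) sib(4)]
        kcross_total[OF zero sib(3)]
      by (simp add: tdeg_tsubst)
    then have "mweight (tsubst s x) (tsubst s y) + kcross ?\<delta> x y + mweight x y +
       (mweight (tsubst s y) (tsubst s x) + kcross ?\<delta> y x + mweight y x) =
       2 * (1 + tdeg (tsubst s x) * tdeg (tsubst s y))"
      by linarith
    then show "even (mweight (tsubst s x) (tsubst s y) + kcross ?\<delta> x y + mweight x y +
       (mweight (tsubst s y) (tsubst s x) + kcross ?\<delta> y x + mweight y x))"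
      by simp
  next
    fix u u' z assume *: "swap1 u u'"
    have "kcross ?\<delta> u z = kcross ?\<delta> u' z" "kcross ?\<delta> z u = kcross ?\<delta> z u'"
      unfolding kcross_def by (intro cross_mset_cong refl; simp add: swap1_invariants(5)[OF *])+
    then show "?c u z = ?c u' z \<and> ?c z u = ?c z u'"
      using swap1_mweight[OF *] swap1_mweight[OF swap1_tsubst[OF *]] by simp
  qed (auto intro: composable_child composable_swap1)
  then show ?thesis by (simp only: tsign_add orient_def)
qed

lemma symbols_cong: "(\<And>i. i \<in> set (leaves t) \<Longrightarrow> d i = e i) \<Longrightarrow> symbols d t = symbols e t"
proof (induction t)
  case (Node g ts)
  have "map (symbols d) ts = map (symbols e) ts"
    using Node.prems by (intro map_cong refl Node.IH) auto
  then show ?case by (simp only: symbols.simps)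
qed simp

text \<open>The orientation of a composite splits into those of the grafted trees and a sign
  \<open>A\<close> from the vertices of the outer tree. The former occur on both sides; the rest is
  \<open>orient_tsubst_class\<close>, where factors change sides because every sign is its own
  inverse.\<close>

lemma orient_compose:
  assumes comp: "composable t s" and t': "rearr t t'"
    and s': "\<And>i. i \<in> set (leaves t) \<Longrightarrow> rearr (s i) (s' i)"
  shows "orient (tsubst s t) * orient (tsubst s' t') * isgn kweight (symbols (\<lambda>i. tdeg (s i)) t) =
    orient t * orient t' * (\<Prod>i\<in>set (leaves t). orient (s i) * orient (s' i)) *
    isgn kweight (symbols (\<lambda>i. tdeg (s' i)) t')"
proof -
  let ?L = "set (leaves t)"
  note t'_leaves = rearr_leaves[OF t']
  define A where "A = tsign (\<lambda>x y. mweight (tsubst s x) (tsubst s y))"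
  define K where "K = tsign (kcross (\<lambda>i. tdeg (s i)))"
  have dist: "distinct (leaves t)" using comp by (simp add: composable_def)
  have prod: "prod_list (map f (leaves u)) = (\<Prod>i\<in>?L. f i)"
    if "distinct (leaves u)" "set (leaves u) = ?L" for f :: "nat \<Rightarrow> int" and u
    using prod.distinct_set_conv_list[OF that(1), of f] that(2) by simp
  have 1: "orient (tsubst s t) = (\<Prod>i\<in>?L. orient (s i)) * A t"
    unfolding orient_def A_def tsign_tsubst prod[OF dist refl] ..
  \<comment> \<open>\<open>mweight\<close> depends only on leaf sets and degrees, which do not
    change when the grafted trees are rearranged.\<close>
  have "tsign (\<lambda>x y. mweight (tsubst s' x) (tsubst s' y)) t' = A t'"
    unfolding A_def
  proof (rule tsign_cong)
    have *: "rearr (tsubst s x) (tsubst s' x)" if "set (leaves x) \<subseteq> set (leaves t')" for x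
      using that t'_leaves s' by (intro rearr_tsubst_arg) auto
    show "mweight (tsubst s' x) (tsubst s' y) = mweight (tsubst s x) (tsubst s y)"
      if "set (leaves x) \<subseteq> set (leaves t')" "set (leaves y) \<subseteq> set (leaves t')" for x y
      using rearr_leaves(1)[OF *] rearr_invariants(2)[OF *] that by (simp add: mweight_def)
  qed
  then have 2: "orient (tsubst s' t') = (\<Prod>i\<in>?L. orient (s' i)) * A t'"
    unfolding orient_def tsign_tsubst using prod[of t'] t'_leaves dist by simp
  have 3: "symbols (\<lambda>i. tdeg (s' i)) t' = symbols (\<lambda>i. tdeg (s i)) t'"
    using s' t'_leaves by (intro symbols_cong) (simp add: rearr_invariants(2))
  have sq: "A u * A u = 1" "K u * K u = 1" for u by (simp_all add: A_def K_def)
  have "A t * K t * orient t = A t' * K t' * orient t'"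
    unfolding A_def K_def using comp t' by (rule orient_tsubst_class)
  then have "A t' * orient t * (A t * K t * orient t) = A t' * orient t * (A t' * K t' * orient t')"
    by simp
  then have "A t * A t' * K t * (orient t * orient t) = (A t' * A t') * K t' * orient t' * orient t"
    by (simp only: ac_simps)
  then have AK: "A t * A t' * K t = orient t * orient t' * K t'" using sq by (simp add: ac_simps)
  have "p * a * (q * b) * k = p * q * (a * b * k)" "e * (p * q) * k = p * q * (e * k)"
    for p q a b e k :: int by (simp_all only: ac_simps)
  with AK show ?thesis
    unfolding 1 2 3 isgn_symbols K_def[symmetric] prod.distrib
    by metis
qed

section \<open>Antisymmetrization and its compatibility with composition\<close>

definition alternate :: "tree \<Rightarrow> (tree \<Rightarrow>\<^sub>0 'k::comm_ring_1)" where
  "alternate t = (\<Sum>t'\<in>rclass t. smul (of_int (orient t * orient t')) (monomial t'))"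

lemma alternate_Leaf [simp]: "alternate (Leaf i) = monomial (Leaf i)"
  by (simp add: alternate_def)

text \<open>Changing the base point of a class multiplies all coefficients by the same sign. Applied
  to corollas, this is why the sign relations are killed.\<close>

lemma alternate_rearr:
  assumes "rearr t t'"
  shows "alternate t' = smul (of_int (orient t * orient t')) (alternate t)"
proof -
  have "orient t' * orient u = (orient t * orient t') * (orient t * orient u)" for u
    using orient_square[of t] by (metis mult.assoc mult.commute mult_1_right)
  then show ?thesis
    unfolding alternate_def rclass_eq[OF assms, symmetric] smul_sum smul_smul of_int_mult[symmetric] by metis
qed

text \<open>Surjectivity takes a rearranged composite apart; injectivity comes from the disjoint
  label sets. The functions are extensional because values of \<open>s'\<close> off the leaves of
  \<open>t\<close> do not enter the composite and would be counted repeatedly.\<close>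

lemma bij_betw_tsubst:
  assumes "composable t s"
  shows "bij_betw (\<lambda>(t', s'). tsubst s' t') (rclass t \<times> (\<Pi>\<^sub>E i\<in>set (leaves t). rclass (s i)))
    (rclass (tsubst s t))"
  unfolding bij_betw_def
proof
  have dist: "distinct (leaves t)" and wf: "well_formed t"
    and wfs: "\<And>i. i \<in> set (leaves t) \<Longrightarrow> well_formed (s i)"
    and disj: "\<And>i j. i \<in> set (leaves t) \<Longrightarrow> j \<in> set (leaves t) \<Longrightarrow> i \<noteq> j \<Longrightarrow>
      set (leaves (s i)) \<inter> set (leaves (s j)) = {}"
    using assms distinct_leaves_tsubst unfolding composable_def by blast+
  let ?I = "set (leaves t)"
  let ?P = "\<Pi>\<^sub>E i\<in>?I. rclass (s i)"
  show "inj_on (\<lambda>(t', s'). tsubst s' t') (rclass t \<times> ?P)"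
  proof (rule inj_onI, clarify)
    fix t1 s1 t2 s2
    assume t: "t1 \<in> rclass t" "t2 \<in> rclass t" and s1: "s1 \<in> ?P" and s2: "s2 \<in> ?P"
      and eq: "tsubst s1 t1 = tsubst s2 t2"
    have r: "rearr t t1" "rearr t t2" using t by (auto simp: rclass_def)
    have rs: "rearr (s i) (s1 i)" "rearr (s i) (s2 i)" if "i \<in> ?I" for i
      using PiE_mem[OF s1 that] PiE_mem[OF s2 that] by (auto simp: rclass_def)
    have "t1 = t2 \<and> (\<forall>i\<in>set (leaves t1). s1 i = s2 i)"
    proof (rule tsubst_inj[OF eq, where I = ?I])
      show "well_formed t1" "well_formed t2" using r wf by (simp_all add: rearr_invariants(3))
      show "distinct (leaves t1)" "distinct (leaves t2)" using r dist by (simp_all add: rearr_leaves(2))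
      show "set (leaves t1) \<subseteq> ?I" "set (leaves t2) \<subseteq> ?I" using r by (simp_all add: rearr_leaves(1))
      show "well_formed (s1 i) \<and> well_formed (s2 i) \<and> nodes (s1 i) = nodes (s2 i)" if "i \<in> ?I" for i
        using rs[OF that] wfs[OF that] by (simp add: rearr_invariants(3,4))
      show "set (leaves (s1 i)) \<inter> set (leaves (s2 j)) = {}" if "i \<in> ?I" "j \<in> ?I" "i \<noteq> j" for i j
        using rearr_leaves(1)[OF rs(1)[OF that(1)]] rearr_leaves(1)[OF rs(2)[OF that(2)]] disj[OF that]
        by simp
    qed
    moreover have "set (leaves t1) = ?I" using rearr_leaves(1)[OF r(1)] .
    ultimately have "t1 = t2" "\<And>i. i \<in> ?I \<Longrightarrow> s1 i = s2 i" by simp_all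
    then show "t1 = t2 \<and> s1 = s2" using PiE_ext[OF s1 s2] by simp
  qed
  show "(\<lambda>(t', s'). tsubst s' t') ` (rclass t \<times> ?P) = rclass (tsubst s t)"
  proof (intro equalityI subsetI)
    fix u assume "u \<in> (\<lambda>(t', s'). tsubst s' t') ` (rclass t \<times> ?P)"
    then obtain t' s' where u: "u = tsubst s' t'" "t' \<in> rclass t" and s': "s' \<in> ?P" by auto
    have "rearr (tsubst s t) u" unfolding u(1)
    proof (rule rearr_tsubst)
      show "rearr t t'" using u(2) by (simp add: rclass_def)
      show "rearr (s i) (s' i)" if "i \<in> ?I" for i
        using PiE_mem[OF s' that] by (simp add: rclass_def)
    qed
    then show "u \<in> rclass (tsubst s t)" by (simp add: rclass_def)
  next
    fix u assume "u \<in> rclass (tsubst s t)"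
    then have "rearr (tsubst s t) u" by (simp add: rclass_def)
    then obtain t' s' where u: "u = tsubst s' t'" "rearr t t'" "\<forall>i\<in>?I. rearr (s i) (s' i)"
      using rearr_tsubstD dist by blast
    have "u = tsubst (restrict s' ?I) t'"
      unfolding u(1) using rearr_leaves(1)[OF u(2)] by (intro tsubst_cong) simp
    moreover have "restrict s' ?I \<in> ?P" using u(3) by (auto simp: rclass_def)
    moreover have "t' \<in> rclass t" using u(2) by (simp add: rclass_def)
    ultimately show "u \<in> (\<lambda>(t', s'). tsubst s' t') ` (rclass t \<times> ?P)"
      by (intro image_eqI[of _ _ "(t', restrict s' ?I)"]) simp_all
  qed
qed

lemma compose_all_eq:
  "compose_all t s = smul (of_int (isgn kweight (symbols (\<lambda>i. tdeg (s i)) t))) (monomial (tsubst s t))"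
  by (simp add: compose_all_def koszul_sign_isgn)

text \<open>The right-hand side is the expanded simultaneous composite of the antisymmetrizations of
  \<open>t\<close> and of the \<open>s i\<close>, so \<open>alternate\<close> is
  multiplicative.\<close>

theorem lin_alternate_compose_all:
  assumes "composable t s"
  shows "lin alternate (compose_all t s) = (\<Sum>t'\<in>rclass t. \<Sum>s'\<in>(\<Pi>\<^sub>E i\<in>set (leaves t). rclass (s i)).
    smul (of_int (orient t * orient t' * (\<Prod>i\<in>set (leaves t). orient (s i) * orient (s' i))))
      (compose_all t' s'))"
proof -
  let ?I = "set (leaves t)"
  let ?k = "isgn kweight (symbols (\<lambda>i. tdeg (s i)) t)"
  let ?f = "\<lambda>u. smul (of_int (orient (tsubst s t) * orient u * ?k)) (monomial u)"
  have "lin alternate (compose_all t s) = (\<Sum>u\<in>rclass (tsubst s t). ?f u)"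
    unfolding compose_all_eq lin_smul lin_monomial alternate_def smul_sum smul_smul of_int_mult[symmetric]
    by (simp only: mult.commute)
  also have "\<dots> = (\<Sum>(t', s')\<in>rclass t \<times> (\<Pi>\<^sub>E i\<in>?I. rclass (s i)). ?f (tsubst s' t'))"
    by (simp add: sum.reindex_bij_betw[OF bij_betw_tsubst[OF assms], symmetric] case_prod_unfold)
  also have "\<dots> = (\<Sum>t'\<in>rclass t. \<Sum>s'\<in>(\<Pi>\<^sub>E i\<in>?I. rclass (s i)). ?f (tsubst s' t'))"
    by (rule sum.cartesian_product[symmetric])
  also have "\<dots> = (\<Sum>t'\<in>rclass t. \<Sum>s'\<in>(\<Pi>\<^sub>E i\<in>?I. rclass (s i)).
    smul (of_int (orient t * orient t' * (\<Prod>i\<in>?I. orient (s i) * orient (s' i)))) (compose_all t' s'))"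
  proof (intro sum.cong refl)
    fix t' s' assume t': "t' \<in> rclass t" and s': "s' \<in> (\<Pi>\<^sub>E i\<in>?I. rclass (s i))"
    have "orient (tsubst s t) * orient (tsubst s' t') * ?k =
      orient t * orient t' * (\<Prod>i\<in>?I. orient (s i) * orient (s' i)) *
      isgn kweight (symbols (\<lambda>i. tdeg (s' i)) t')"
    proof (rule orient_compose[OF assms])
      show "rearr t t'" using t' by (simp add: rclass_def)
      show "rearr (s i) (s' i)" if "i \<in> ?I" for i using PiE_mem[OF s' that] by (simp add: rclass_def)
    qed
    then show "?f (tsubst s' t') = smul (of_int (orient t * orient t' *
        (\<Prod>i\<in>?I. orient (s i) * orient (s' i)))) (compose_all t' s')"
      unfolding compose_all_eq smul_smul of_int_mult[symmetric] by (simp only:)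
  qed
  finally show ?thesis .
qed

section \<open>Koszul signs of permuted inputs\<close>

lemma number_list_Leaf: "number_list c (replicate n (Leaf k)) = map Leaf [c..<c + n]"
proof (induction n arbitrary: c)
  case (Suc n)
  then show ?case by (simp add: upt_conv_Cons del: upt_Suc)
qed simp

lemma corolla_eq: "corolla g = Node g (map Leaf [1..<arity g + 1])"
  by (simp add: corolla_def graft_def map_replicate_const number_list_Leaf del: upt_Suc)

lemma isgn_sorted: "sorted_wrt (\<lambda>x y. c x y = 0) xs \<Longrightarrow> isgn c xs = 1"
proof (induction xs)
  case (Cons x xs)
  then have "map (c x) xs = map (\<lambda>_. 0) xs" by simp
  then have "sum_list (map (c x) xs) = 0" by (simp only: sum_list_0)
  moreover have "isgn c xs = 1" using Cons by simp
  ultimately show ?case by (simp only: isgn.simps power_0 mult_1)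
qed simp

fun vdegs :: "tree \<Rightarrow> nat list" where
  "vdegs (Leaf i) = []"
| "vdegs (Node g ts) = gdeg g # concat (map vdegs ts)"

lemma mset_concat_map_union:
  "(\<And>x. x \<in> set xs \<Longrightarrow> mset (f x) = mset (g x) + mset (h x)) \<Longrightarrow>
    mset (concat (map f xs)) = mset (concat (map g xs)) + mset (concat (map h xs))"
  by (induction xs) simp_all

lemma mset_concat_map_cong:
  assumes "mset xs = mset ys"
  shows "mset (concat (map f xs)) = mset (concat (map f ys))"
proof -
  have "mset (concat (map f xs)) = (\<Sum>x\<in>#mset xs. mset (f x))" for xs
    by (induction xs) simp_all
  then show ?thesis using assms by metis
qed

lemma sum_list_map_mset_cong:
  "mset xs = mset ys \<Longrightarrow> sum_list (map f xs) = (sum_list (map f ys) :: nat)"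
  by (metis mset_map sum_mset_sum_list)

lemma mset_symbols:
  "mset (symbols \<delta> t) = mset (map (Pair 0) (vdegs t) @ map (\<lambda>i. (i, \<delta> i)) (leaves t))"
proof (induction t)
  case (Node g ts)
  have "mset (concat (map (symbols \<delta>) ts)) = mset (concat (map (\<lambda>t. map (Pair 0) (vdegs t)) ts)) +
      mset (concat (map (\<lambda>t. map (\<lambda>i. (i, \<delta> i)) (leaves t)) ts))"
    using Node by (intro mset_concat_map_union) simp
  then show ?case by (simp add: map_concat comp_def)
qed simp

lemma symbols_relabel:
  "0 \<notin> set (leaves t) \<Longrightarrow> symbols \<delta> (relabel f t) =
    map (\<lambda>(a, d). (if a = 0 then 0 else f a, d)) (symbols (\<lambda>i. \<delta> (f i)) t)"
proof (induction t)
  case (Node g ts)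
  have "map (\<lambda>t. symbols \<delta> (relabel f t)) ts =
     map (\<lambda>t. map (\<lambda>(a, d). (if a = 0 then 0 else f a, d)) (symbols (\<lambda>i. \<delta> (f i)) t)) ts"
    using Node.prems by (intro map_cong refl Node.IH) auto
  then show ?case by (simp add: map_concat comp_def cong: map_cong)
qed simp

lemma kweight_pair: "kweight p q + kweight q p = (if fst p = fst q then 0 else snd p * snd q)"
  by (auto simp: kweight_def)

lemma isgn_kweight_zero:
  "isgn kweight (map (Pair 0) ds @ xs) = isgn kweight xs"
proof -
  have "isgn kweight (map (Pair 0) ds) = 1"
    by (intro isgn_eq_one) (auto simp: kweight_def)
  moreover have "cross kweight (map (Pair 0) ds) xs = cross (\<lambda>_ _. 0) (map (Pair (0 :: nat)) ds) xs"
    by (intro cross_cong) (auto simp: kweight_def)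
  then have "cross kweight (map (Pair 0) ds) xs = 0" by (simp add: cross_def)
  ultimately show ?thesis by (simp add: isgn_append)
qed

lemma isgn_kweight_upt: "isgn kweight (map (\<lambda>i. (i, d i)) [a..<b]) = 1"
proof (rule isgn_sorted)
  have "sorted_wrt (\<lambda>i j. kweight (i, d i) (j, d j) = 0) [a..<b]"
    by (rule sorted_wrt_mono_rel[OF _ sorted_wrt_upt]) (simp add: kweight_def)
  then show "sorted_wrt (\<lambda>x y. kweight x y = 0) (map (\<lambda>i. (i, d i)) [a..<b])"
    by (simp only: sorted_wrt_map)
qed

text \<open>
  Multiplicativity of the Koszul sign: first permuting the inputs by \<open>f\<close> and then distributing them
  over the leaves of \<open>m\<close> is the same as distributing them over the relabelled tree.
\<close>

lemma isgn_symbols_relabel: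
  assumes m: "mset (leaves m) = mset [1..<n+1]" and f: "inj_on f {1..n}" "0 \<notin> f ` {1..n}"
  shows "isgn kweight (map (\<lambda>i. (f i, \<delta> (f i))) [1..<n+1]) * isgn kweight (symbols (\<lambda>i. \<delta> (f i)) m) =
    isgn kweight (symbols \<delta> (relabel f m))"
proof -
  define F where "F = (\<lambda>(a :: nat, d :: nat). (if a = 0 then 0 else f a, d))"
  define W where "W = symbols (\<lambda>i. \<delta> (f i)) m"
  define V where "V = map (Pair (0 :: nat)) (vdegs m)"
  define L where "L = map (\<lambda>i. (i, \<delta> (f i))) [1..<n+1]"
  have leaves: "set (leaves m) = {1..n}" using mset_eq_setD[OF m] by auto
  then have zero: "0 \<notin> set (leaves m)" by simp
  have W: "mset W = mset (V @ L)"
    unfolding W_def V_def L_def mset_symbols mset_append mset_map m ..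
  have ranks: "fst p \<in> insert 0 {1..n}" if "p \<in> set W" for p
    using that fst_symbols[of "\<lambda>i. \<delta> (f i)" m] leaves by (auto simp: W_def)
  have F_inj: "fst (F p) = fst (F q) \<longleftrightarrow> fst p = fst q" if "p \<in> set W" "q \<in> set W" for p q
  proof -
    have *: "f a = f b \<longleftrightarrow> a = b" if "a \<in> {1..n}" "b \<in> {1..n}" for a b
      using that f(1) by (auto dest: inj_onD)
    have **: "f a \<noteq> 0" if "a \<in> {1..n}" for a using that f(2) by (metis image_eqI)
    show ?thesis using ranks[OF that(1)] ranks[OF that(2)] * **
      by (cases p; cases q) (fastforce simp: F_def)
  qed
  have snd_F: "snd (F p) = snd p" for p by (cases p) (simp add: F_def)
  \<comment> \<open>For a pair of symbols taken in both orders, \<open>kweight\<close> and its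
    pullback along \<open>F\<close> have the same sum, since \<open>F\<close> neither creates nor
    removes equal ranks; so the combined weight is even. Hence \<open>W\<close> may be replaced by
    \<open>V @ L\<close>, vertices first and leaves in natural order, where both signs are
    known.\<close>
  have "isgn (\<lambda>p q. kweight p q + kweight (F p) (F q)) W =
      isgn (\<lambda>p q. kweight p q + kweight (F p) (F q)) (V @ L)"
  proof (rule isgn_mset_cong[OF W])
    fix p q assume pq: "p \<in> set W" "q \<in> set W"
    have "(kweight p q + kweight q p) + (kweight (F p) (F q) + kweight (F q) (F p)) =
       2 * (if fst p = fst q then 0 else snd p * snd q)"
      unfolding kweight_pair F_inj[OF pq] snd_F by simp
    then have "kweight p q + kweight (F p) (F q) + (kweight q p + kweight (F q) (F p)) =
       2 * (if fst p = fst q then 0 else snd p * snd q)" by linarith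
    then show "even (kweight p q + kweight (F p) (F q) + (kweight q p + kweight (F q) (F p)))"
      by simp
  qed
  then have *: "isgn kweight W * isgn kweight (map F W) = isgn kweight (V @ L) * isgn kweight (map F (V @ L))"
    by (simp only: isgn_add isgn_map)
  have "map F V = V" by (simp add: V_def F_def)
  moreover have "map F L = map (\<lambda>i. (f i, \<delta> (f i))) [1..<n+1]"
    unfolding L_def F_def by simp
  ultimately have "isgn kweight W * isgn kweight (map F W) = isgn kweight (map (\<lambda>i. (f i, \<delta> (f i))) [1..<n+1])"
    using * isgn_kweight_upt[of "\<lambda>i. \<delta> (f i)" 1 "n+1"]
    by (simp only: map_append V_def isgn_kweight_zero L_def mult_1)
  moreover have "symbols \<delta> (relabel f m) = map F W"
    unfolding W_def F_def by (rule symbols_relabel[OF zero])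
  ultimately have "isgn kweight (map (\<lambda>i. (f i, \<delta> (f i))) [1..<n+1]) * isgn kweight W =
      (isgn kweight W * isgn kweight W) * isgn kweight (symbols \<delta> (relabel f m))"
    by (simp only: ac_simps)
  then show ?thesis by (simp only: W_def isgn_square mult_1)
qed

text \<open>A word of inputs is given by labels alone here, so that the degree of one input can be
  changed by updating \<delta>.\<close>

definition sweight :: "(nat \<Rightarrow> nat) \<Rightarrow> nat \<Rightarrow> nat \<Rightarrow> nat" where
  "sweight \<delta> a b = (if b < a then \<delta> a * \<delta> b else 0)"

lemma isgn_kweight_map: "isgn kweight (map (\<lambda>i. (i, \<delta> i)) p) = isgn (sweight \<delta>) p"
  unfolding isgn_map by (rule isgn_cong) (simp add: kweight_def sweight_def)

text \<open>Lowering the degree of one input by one, as the differential does.\<close>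

lemma isgn_sweight_lower:
  assumes p: "mset (as @ i # bs) = mset [1..<n+1]" and e: "\<delta> i = e + 1"
  shows "isgn (sweight \<delta>) (as @ i # bs) * (-1) ^ sum_list (map \<delta> as) =
    (-1) ^ (\<Sum>j\<in>{1..<i}. \<delta> j) * isgn (sweight (\<delta>(i := e))) (as @ i # bs)"
proof -
  let ?\<epsilon> = "\<delta>(i := e)"
  have dist: "distinct (as @ i # bs)" using mset_eq_imp_distinct_iff[OF p] by simp
  have "set [1..<n+1] = {1..n}" by auto
  then have set: "set (as @ i # bs) = {1..n}" using mset_eq_setD[OF p] by (rule trans[rotated])
  define hi where "hi xs = sum_list (map \<delta> (filter (\<lambda>a. i < a) xs))" for xs
  define lo where "lo xs = sum_list (map \<delta> (filter (\<lambda>a. a < i) xs))" for xs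
  have rest: "isgn (sweight \<delta>) xs = isgn (sweight ?\<epsilon>) xs" if "i \<notin> set xs" for xs
    using that by (intro isgn_cong) (auto simp: sweight_def)
  have restc: "cross (sweight \<delta>) as bs = cross (sweight ?\<epsilon>) as bs"
    using dist by (intro cross_cong) (auto simp: sweight_def)
  have lo': "sum_list (map (sweight \<eta> i) bs) = \<eta> i * lo bs" if "\<eta> = \<delta> \<or> \<eta> = ?\<epsilon>" for \<eta>
  proof -
    have "i \<notin> set bs" using dist by simp
    then show ?thesis using that by (induction bs) (auto simp: sweight_def lo_def algebra_simps)
  qed
  have lo: "sum_list (map (sweight \<delta> i) bs) = (e + 1) * lo bs"
      "sum_list (map (sweight ?\<epsilon> i) bs) = e * lo bs" using lo'[of \<delta>] lo'[of ?\<epsilon>] e by simp_all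
  have hi': "sum_list (map (\<lambda>a. sweight \<eta> a i) as) = \<eta> i * hi as" if "\<eta> = \<delta> \<or> \<eta> = ?\<epsilon>" for \<eta>
  proof -
    have "i \<notin> set as" using dist by simp
    then show ?thesis using that by (induction as) (auto simp: sweight_def hi_def algebra_simps)
  qed
  have hi: "sum_list (map (\<lambda>a. sweight \<delta> a i) as) = (e + 1) * hi as"
      "sum_list (map (\<lambda>a. sweight ?\<epsilon> a i) as) = e * hi as" using hi'[of \<delta>] hi'[of ?\<epsilon>] e by simp_all
  \<comment> \<open>Lowering the degree of \<open>i\<close> removes one copy of the partner's degree
    from each inversion involving \<open>i\<close>: with larger labels before it
    (\<open>hi as\<close>) and with smaller ones after it (\<open>lo bs\<close>).\<close>
  have "isgn (sweight \<delta>) (as @ i # bs) = isgn (sweight ?\<epsilon>) (as @ i # bs) * (-1) ^ (hi as + lo bs)"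
  proof -
    have ni: "i \<notin> set as" "i \<notin> set bs" using dist by simp_all
    show ?thesis
      unfolding isgn_append isgn.simps cross_Cons_right rest[OF ni(1)] rest[OF ni(2)] restc hi lo
      by (simp add: power_add algebra_simps)
  qed
  moreover have "sum_list (map \<delta> as) = lo as + hi as"
  proof -
    have "i \<notin> set as" using dist by simp
    then show ?thesis by (induction as) (auto simp: lo_def hi_def)
  qed
  moreover have "(\<Sum>j\<in>{1..<i}. \<delta> j) = lo as + lo bs"
  proof -
    have "{1..<i} = set (filter (\<lambda>a. a < i) (as @ i # bs))"
    proof -
      have "i \<in> {1..n}" unfolding set[symmetric] by simp
      then show ?thesis unfolding set_filter set by auto
    qed
    moreover have "distinct (filter (\<lambda>a. a < i) (as @ i # bs))" using dist by (intro distinct_filter)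
    ultimately have "(\<Sum>j\<in>{1..<i}. \<delta> j) = sum_list (map \<delta> (filter (\<lambda>a. a < i) (as @ i # bs)))"
      by (simp only: sum.distinct_set_conv_list)
    then show ?thesis by (simp add: lo_def)
  qed
  ultimately have "isgn (sweight \<delta>) (as @ i # bs) * (-1) ^ sum_list (map \<delta> as) =
      isgn (sweight ?\<epsilon>) (as @ i # bs) * ((-1) ^ (hi as + lo bs) * (-1) ^ (lo as + hi as))"
    and "(\<Sum>j\<in>{1..<i}. \<delta> j) = lo as + lo bs"
    by simp_all
  \<comment> \<open>\<open>hi as\<close> occurs twice and drops out; what remains is the total
    degree of the inputs with labels below \<open>i\<close>.\<close>
  moreover have "(-1 :: int) ^ (hi as + lo bs) * (-1) ^ (lo as + hi as) = (-1) ^ (lo as + lo bs)"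
    unfolding power_add[symmetric] by (rule neg_one_power_eq) presburger
  ultimately show ?thesis by simp
qed

section \<open>Derivations of composites\<close>

text \<open>The condition that a derivation with these values has degree -1 and preserves arities.
  The form \<open>tdeg m + 1 = gdeg g\<close> avoids truncated subtraction and forces the value on a
  generator of degree 0 to vanish.\<close>

definition admissible :: "(rb_gen \<Rightarrow> (tree \<Rightarrow>\<^sub>0 'k::comm_ring_1)) \<Rightarrow> bool" where
  "admissible D \<longleftrightarrow> (\<forall>g. is_gen g \<longrightarrow> (\<forall>m\<in>Poly_Mapping.keys (D g).
     well_formed m \<and> mset (leaves m) = mset [1..<arity g + 1] \<and> tdeg m + 1 = gdeg g))"

lemma admissibleD:
  assumes "admissible D" "is_gen g" "m \<in> Poly_Mapping.keys (D g)"
  shows "well_formed m" "mset (leaves m) = mset [1..<arity g + 1]" "tdeg m + 1 = gdeg g"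
    "distinct (leaves m)" "set (leaves m) = {1..arity g}"
proof -
  show *: "well_formed m" "mset (leaves m) = mset [1..<arity g + 1]" "tdeg m + 1 = gdeg g"
    using assms unfolding admissible_def by blast+
  show "distinct (leaves m)" using mset_eq_imp_distinct_iff[OF *(2)] by simp
  have "set [1..<arity g + 1] = {1..arity g}" by auto
  then show "set (leaves m) = {1..arity g}" using mset_eq_setD[OF *(2)] by simp
qed

lemma map_nth_upt: "map (\<lambda>i. xs ! (i - 1)) [1..<length xs + 1] = xs"
  by (rule nth_equalityI) (simp_all del: upt_Suc)

lemma keys_compose_all: "Poly_Mapping.keys (compose_all t s) \<subseteq> {tsubst s t}"
  unfolding compose_all_def using keys_smul keys_monomial by (rule order_trans)

lemma keys_derivation:
  assumes D: "admissible D" and "well_formed t" "u \<in> Poly_Mapping.keys (derivation D t)"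
  shows "well_formed u \<and> mset (leaves u) = mset (leaves t) \<and> tdeg u + 1 = tdeg t"
  using assms(2,3)
proof (induction t arbitrary: u)
  case (Node g ts)
  let ?s = "\<lambda>i. ts ! (i - 1)"
  let ?S = "{u. well_formed u \<and> mset (leaves u) = mset (leaves (Node g ts)) \<and> tdeg u + 1 = tdeg (Node g ts)}"
  from Node.prems(1) have g: "is_gen g" and len: "length ts = arity g" and wf: "\<And>t. t \<in> set ts \<Longrightarrow> well_formed t"
    by simp_all
  have "Poly_Mapping.keys (lin (\<lambda>m. compose_all m ?s) (D g)) \<subseteq> ?S"
  proof (rule keys_lin)
    fix m assume "m \<in> Poly_Mapping.keys (D g)"
    note m = admissibleD[OF D g this]
    have "well_formed (tsubst ?s m)"
    proof (rule well_formed_tsubst[OF m(1)])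
      fix i assume "i \<in> set (leaves m)"
      then have "i - 1 < length ts" using m(5) len by auto
      then show "well_formed (?s i)" using wf nth_mem by blast
    qed
    moreover have "mset (leaves (tsubst ?s m)) = mset (leaves (Node g ts))"
    proof -
      have "mset (leaves (tsubst ?s m)) = mset (concat (map (\<lambda>i. leaves (?s i)) [1..<length ts + 1]))"
        unfolding leaves_tsubst len by (rule mset_concat_map_cong[OF m(2)])
      also have "map (\<lambda>i. leaves (?s i)) [1..<length ts + 1] = map leaves ts"
        using arg_cong[OF map_nth_upt[of ts], of "map leaves"] by (simp only: map_map comp_def)
      finally show ?thesis by simp
    qed
    moreover have "tdeg (tsubst ?s m) + 1 = tdeg (Node g ts)"
    proof -
      have "(\<Sum>i\<leftarrow>leaves m. tdeg (?s i)) = (\<Sum>i\<leftarrow>[1..<length ts + 1]. tdeg (?s i))"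
        unfolding len by (rule sum_list_map_mset_cong[OF m(2)])
      also have "map (\<lambda>i. tdeg (?s i)) [1..<length ts + 1] = map tdeg ts"
        using arg_cong[OF map_nth_upt[of ts], of "map tdeg"] by (simp only: map_map comp_def)
      finally show ?thesis using m(3) by (simp add: tdeg_tsubst)
    qed
    ultimately show "Poly_Mapping.keys (compose_all m ?s) \<subseteq> ?S" using keys_compose_all[of m ?s] by blast
  qed
  moreover have "Poly_Mapping.keys (\<Sum>j<length ts. smul ((-1) ^ (gdeg g + sum_list (map tdeg (take j ts))))
       (lin (\<lambda>u. monomial (Node g (ts[j := u]))) (map (derivation D) ts ! j))) \<subseteq> ?S"
  proof (intro keys_sum_subset order_trans[OF keys_smul] keys_lin order_trans[OF keys_monomial])
    fix j v assume j: "j \<in> {..<length ts}" and v: "v \<in> Poly_Mapping.keys (map (derivation D) ts ! j)"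
    from j have v': "v \<in> Poly_Mapping.keys (derivation D (ts ! j))" using v by simp
    have mem: "ts ! j \<in> set ts" using j by simp
    have IH: "well_formed v \<and> mset (leaves v) = mset (leaves (ts ! j)) \<and> tdeg v + 1 = tdeg (ts ! j)"
      using Node.IH[OF mem wf[OF mem] v'] .
    have ts: "ts = take j ts @ ts ! j # drop (Suc j) ts" using j by (intro id_take_nth_drop) simp
    have upd: "ts[j := v] = take j ts @ v # drop (Suc j) ts" using j by (intro upd_conv_take_nth_drop) simp
    define as bs x where "as = take j ts" "bs = drop (Suc j) ts" "x = ts ! j"
    note ts' = ts[folded as_bs_x_def] and upd' = upd[folded as_bs_x_def] and IH' = IH[folded as_bs_x_def]
    have "well_formed (Node g (as @ v # bs))" using Node.prems(1) IH' unfolding ts' by simp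
    moreover have "mset (leaves (Node g (as @ v # bs))) = mset (leaves (Node g (as @ x # bs)))"
      using IH' by simp
    moreover have "tdeg (Node g (as @ v # bs)) + 1 = tdeg (Node g (as @ x # bs))"
      using IH' by simp
    ultimately show "{Node g (ts[j := v])} \<subseteq> ?S" unfolding upd' ts'[symmetric] by simp
  qed
  ultimately have "Poly_Mapping.keys (derivation D (Node g ts)) \<subseteq> ?S"
    unfolding derivation.simps by (intro order_trans[OF Poly_Mapping.keys_add] Un_least)
  then show ?case using Node.prems(2) by blast
qed simp

text \<open>The sign on the left brings the inputs into the order \<open>p\<close>; composing with
  \<open>m\<close> then distributes them over its leaves. Multiplicativity of the Koszul sign merges
  both into the sign of the composition with the relabelled tree.\<close>

lemma lin_compose_all_relabel:
  assumes D: "admissible D" "is_gen g" and p: "mset p = mset [1..<arity g + 1]"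
    and m: "m \<in> Poly_Mapping.keys (D g)"
  shows "smul (of_int (isgn kweight (symbols (\<lambda>i. tdeg (s i)) (Node g (map Leaf p)))))
      (compose_all m (\<lambda>i. map s p ! (i - 1))) = compose_all (relabel (\<lambda>i. p ! (i - 1)) m) s"
proof -
  let ?n = "arity g"
  let ?f = "\<lambda>i. p ! (i - 1)"
  let ?\<delta> = "\<lambda>i. tdeg (s i)"
  note m = admissibleD[OF D m]
  have len: "length p = ?n" using mset_eq_length[OF p] by simp
  have p_set: "set p = {1..?n}" using mset_eq_setD[OF p] by auto
  have dist: "distinct p" using mset_eq_imp_distinct_iff[OF p] by simp
  have inj: "inj_on ?f {1..?n}"
    using dist len by (auto simp: inj_on_def nth_eq_iff_index_eq)
  have img: "?f ` {1..?n} \<subseteq> {1..?n}"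
    unfolding p_set[symmetric] using len nth_mem[of "_ - 1" p] p_set by auto
  then have zero: "0 \<notin> ?f ` {1..?n}" by auto
  have "tsubst (\<lambda>i. map s p ! (i - 1)) m = tsubst s (relabel ?f m)"
    unfolding tsubst_relabel using m(5) len by (intro tsubst_cong) auto
  moreover have "symbols (\<lambda>i. tdeg (map s p ! (i - 1))) m = symbols (\<lambda>i. ?\<delta> (?f i)) m"
    using m(5) len by (intro symbols_cong) auto
  moreover have "isgn kweight (symbols ?\<delta> (Node g (map Leaf p))) = isgn kweight (map (\<lambda>i. (i, ?\<delta> i)) p)"
    using isgn_kweight_zero[of "[gdeg g]" "map (\<lambda>i. (i, ?\<delta> i)) p"] by (simp add: comp_def)
  moreover have "map (\<lambda>i. (?f i, ?\<delta> (?f i))) [1..<?n+1] = map (\<lambda>i. (i, ?\<delta> i)) p"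
    using arg_cong[OF map_nth_upt[of p], of "map (\<lambda>i. (i, ?\<delta> i))"] unfolding len by (simp only: map_map comp_def)
  ultimately show ?thesis
    using isgn_symbols_relabel[OF m(2) inj zero, of ?\<delta>]
    unfolding compose_all_eq smul_smul of_int_mult[symmetric] by (simp only:)
qed

text \<open>\<open>derivation\<close> passes along the children in planar order, whereas the inputs
  of a composite are ordered by their labels. The Koszul sign of the composite makes up for the
  difference, so the exponent on the right runs over the labels below \<open>i\<close>.\<close>

lemma derivation_compose_corolla:
  fixes D :: "rb_gen \<Rightarrow> (tree \<Rightarrow>\<^sub>0 'k::comm_ring_1)"
  assumes D: "admissible D" and g: "is_gen g" and p: "mset p = mset [1..<arity g + 1]"
    and s: "\<And>i. i \<in> {1..arity g} \<Longrightarrow> well_formed (s i)"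
  shows "lin (derivation D) (compose_all (Node g (map Leaf p)) s) =
    lin (\<lambda>m. compose_all (relabel (\<lambda>i. p ! (i - 1)) m) s) (D g) +
    (\<Sum>i\<in>{1..arity g}. smul ((-1) ^ (gdeg g + (\<Sum>j\<in>{1..<i}. tdeg (s j))))
      (lin (\<lambda>u. compose_all (Node g (map Leaf p)) (s(i := u))) (derivation D (s i))))"
proof -
  let ?n = "arity g"
  let ?c = "Node g (map Leaf p)"
  let ?\<delta> = "\<lambda>i. tdeg (s i)"
  let ?k = "\<lambda>\<delta>. isgn kweight (symbols \<delta> ?c)"
  have len: "length p = ?n" using mset_eq_length[OF p] by simp
  have p_set: "set p = {1..?n}" using mset_eq_setD[OF p] by auto
  have dist: "distinct p" using mset_eq_imp_distinct_iff[OF p] by simp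
  have k: "?k \<delta> = isgn (sweight \<delta>) p" for \<delta>
  proof -
    have "symbols \<delta> ?c = map (Pair 0) [gdeg g] @ map (\<lambda>i. (i, \<delta> i)) p" by (simp add: comp_def)
    then show ?thesis by (simp only: isgn_kweight_zero isgn_kweight_map)
  qed
  have slot: "smul (of_int (?k ?\<delta>) * (-1) ^ (gdeg g + sum_list (map tdeg (take j (map s p)))))
       (lin (\<lambda>u. monomial (Node g ((map s p)[j := u]))) (derivation D (s (p ! j)))) =
    smul ((-1) ^ (gdeg g + (\<Sum>i\<in>{1..<p ! j}. tdeg (s i))))
      (lin (\<lambda>u. compose_all ?c (s(p ! j := u))) (derivation D (s (p ! j))))"
    if j: "j < ?n" for j
    unfolding lin_fun_smul[symmetric]
  proof (rule lin_cong)
    fix u assume u: "u \<in> Poly_Mapping.keys (derivation D (s (p ! j)))"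
    define i as bs where "i = p ! j" "as = take j p" "bs = drop (Suc j) p"
    have pp: "p = as @ i # bs" unfolding i_as_bs_def using j len by (intro id_take_nth_drop) simp
    have las: "length as = j" using j len by (simp add: i_as_bs_def)
    have i: "i \<in> {1..?n}" using j len nth_mem[of j p] p_set i_as_bs_def(1) by simp
    have wf: "well_formed (s i)" using s[OF i] .
    have deg: "tdeg (s i) = tdeg u + 1" using keys_derivation[OF D wf, of u] u i_as_bs_def(1) by simp
    have "(map s p)[j := u] = map (s(i := u)) p"
      using dist las unfolding pp by (simp add: list_update_append)
    then have tree: "Node g ((map s p)[j := u]) = tsubst (s(i := u)) ?c" by (simp add: comp_def)
    have \<epsilon>: "(\<lambda>l. tdeg ((s(i := u)) l)) = ?\<delta>(i := tdeg u)" by auto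
    have "map tdeg (take j (map s p)) = map ?\<delta> as"
      using las unfolding pp by (simp add: comp_def)
    then have "?k ?\<delta> * (-1) ^ (gdeg g + sum_list (map tdeg (take j (map s p)))) =
      (-1) ^ gdeg g * (isgn (sweight ?\<delta>) (as @ i # bs) * (-1) ^ sum_list (map ?\<delta> as))"
      unfolding k pp[symmetric] by (simp only: power_add ac_simps)
    also have "\<dots> = (-1) ^ (gdeg g + (\<Sum>l\<in>{1..<i}. ?\<delta> l)) * ?k (\<lambda>l. tdeg ((s(i := u)) l))"
      unfolding isgn_sweight_lower[of as i bs ?n ?\<delta>, OF p[unfolded pp] deg] k \<epsilon>
      by (simp only: power_add ac_simps pp)
    finally have "of_int (?k ?\<delta> * (-1) ^ (gdeg g + sum_list (map tdeg (take j (map s p))))) =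
      (of_int ((-1) ^ (gdeg g + (\<Sum>l\<in>{1..<i}. ?\<delta> l)) * ?k (\<lambda>l. tdeg ((s(i := u)) l))) :: 'k)"
      by (rule arg_cong)
    then show "smul (of_int (?k ?\<delta>) * (-1 :: 'k) ^ (gdeg g + sum_list (map tdeg (take j (map s p)))))
       (monomial (Node g ((map s p)[j := u]))) = smul ((-1) ^ (gdeg g + (\<Sum>i\<in>{1..<p ! j}. tdeg (s i))))
      (compose_all ?c (s(p ! j := u)))"
      unfolding i_as_bs_def(1)[symmetric] tree compose_all_eq smul_smul
      by (simp only: of_int_mult of_int_power of_int_minus of_int_1)
  qed
  have "lin (derivation D) (compose_all ?c s) = smul (of_int (?k ?\<delta>)) (derivation D (Node g (map s p)))"
    by (simp only: compose_all_eq lin_smul lin_monomial tsubst.simps map_map comp_def)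
  also have "\<dots> = lin (\<lambda>m. smul (of_int (?k ?\<delta>)) (compose_all m (\<lambda>i. map s p ! (i - 1)))) (D g) +
     (\<Sum>j<?n. smul (of_int (?k ?\<delta>) * (-1) ^ (gdeg g + sum_list (map tdeg (take j (map s p)))))
       (lin (\<lambda>u. monomial (Node g ((map s p)[j := u]))) (derivation D (s (p ! j)))))"
    by (simp only: derivation.simps smul_add lin_fun_smul smul_sum smul_smul length_map len)
       (intro arg_cong2[where f = "(+)"] refl sum.cong, simp add: len)
  also have "lin (\<lambda>m. smul (of_int (?k ?\<delta>)) (compose_all m (\<lambda>i. map s p ! (i - 1)))) (D g) =
      lin (\<lambda>m. compose_all (relabel (\<lambda>i. p ! (i - 1)) m) s) (D g)"
    by (rule lin_cong, rule lin_compose_all_relabel[OF D g p])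
  also have "(\<Sum>j<?n. smul (of_int (?k ?\<delta>) * (-1) ^ (gdeg g + sum_list (map tdeg (take j (map s p)))))
       (lin (\<lambda>u. monomial (Node g ((map s p)[j := u]))) (derivation D (s (p ! j))))) =
    (\<Sum>j<?n. smul ((-1) ^ (gdeg g + (\<Sum>i\<in>{1..<p ! j}. tdeg (s i))))
      (lin (\<lambda>u. compose_all ?c (s(p ! j := u))) (derivation D (s (p ! j)))))"
    using slot by (intro sum.cong refl) simp
  also have "\<dots> = (\<Sum>i\<in>{1..?n}. smul ((-1) ^ (gdeg g + (\<Sum>j\<in>{1..<i}. tdeg (s j))))
      (lin (\<lambda>u. compose_all ?c (s(i := u))) (derivation D (s i))))"
  proof (rule sum.reindex_bij_betw)
    show "bij_betw ((!) p) {..<?n} {1..?n}" using bij_betw_nth[OF dist] len p_set by simp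
  qed
  finally show ?thesis .
qed

section \<open>Antisymmetrization and derivations\<close>

lemma mset_map_permutes:
  assumes "\<sigma> permutes {1..n}"
  shows "mset (map \<sigma> [1..<n+1]) = mset [1..<n+1]"
proof -
  have set: "set [1..<n+1] = {1..n}" by auto
  have "distinct (map \<sigma> [1..<n+1])"
    by (simp add: distinct_map permutes_inj_on[OF assms] del: upt_Suc)
  moreover have "set (map \<sigma> [1..<n+1]) = set [1..<n+1]"
    unfolding set_map set by (rule permutes_image[OF assms])
  ultimately show ?thesis using set_eq_iff_mset_eq_distinct distinct_upt by blast
qed

lemma obtain_permutation:
  assumes "mset p = mset [1..<n+1]"
  obtains \<tau> where "\<tau> permutes {1..n}" "p = map \<tau> [1..<n+1]"
proof
  let ?\<tau> = "\<lambda>i. if i \<in> {1..n} then p ! (i - 1) else i"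
  have len: "length p = n" using mset_eq_length[OF assms] by simp
  have p_set: "set p = {1..n}" using mset_eq_setD[OF assms] by auto
  have dist: "distinct p" using mset_eq_imp_distinct_iff[OF assms] by simp
  have "bij_betw (\<lambda>i. i - 1) {1..n} {..<n}"
    by (rule bij_betw_byWitness[of _ Suc]) auto
  moreover have "bij_betw ((!) p) {..<n} {1..n}" using bij_betw_nth[OF dist] len p_set by simp
  ultimately have "bij_betw ((!) p \<circ> (\<lambda>i. i - 1)) {1..n} {1..n}" by (rule bij_betw_trans)
  moreover have "bij_betw ?\<tau> {1..n} {1..n} \<longleftrightarrow> bij_betw ((!) p \<circ> (\<lambda>i. i - 1)) {1..n} {1..n}"
    by (rule bij_betw_cong) simp
  ultimately have "bij_betw ?\<tau> {1..n} {1..n}" by simp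
  then show "?\<tau> permutes {1..n}" by (rule bij_imp_permutes) auto
  have "map ?\<tau> [1..<n+1] = map (\<lambda>i. p ! (i - 1)) [1..<length p + 1]"
    unfolding len by (intro map_cong refl) auto
  then show "p = map ?\<tau> [1..<n+1]" using map_nth_upt[of p] by simp
qed

lemma tact_corolla: "tact \<sigma> (corolla g) = Node g (map Leaf (map (inv \<sigma>) [1..<arity g + 1]))"
  by (simp add: tact_def corolla_eq del: upt_Suc)

lemma permutes_eqI:
  assumes "\<sigma> permutes S" "\<tau> permutes S" "\<And>i. i \<in> S \<Longrightarrow> \<sigma> i = \<tau> i"
  shows "\<sigma> = \<tau>"
proof
  show "\<sigma> i = \<tau> i" for i
    using assms(3)[of i] permutes_not_in[OF assms(1), of i] permutes_not_in[OF assms(2), of i]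
    by (cases "i \<in> S") simp_all
qed

lemma inv_permutes_eqD:
  assumes "\<sigma> permutes {1..n}" "\<tau> permutes {1..n}"
    and "map (inv \<sigma>) [1..<n+1] = map (inv \<tau>) [1..<n+1]"
  shows "\<sigma> = \<tau>"
proof -
  have "inv \<sigma> i = inv \<tau> i" if "i \<in> {1..n}" for i
  proof -
    have "i \<in> set [1..<n+1]" using that by auto
    then show ?thesis using map_eq_conv[THEN iffD1, OF assms(3)] by blast
  qed
  then have "inv \<sigma> = inv \<tau>" by (rule permutes_eqI[OF permutes_inv[OF assms(1)] permutes_inv[OF assms(2)]])
  then have "inv (inv \<sigma>) = inv (inv \<tau>)" by (rule arg_cong)
  then show ?thesis unfolding permutes_inv_inv[OF assms(1)] permutes_inv_inv[OF assms(2)] .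
qed

lemma rearr_map_Leaf:
  assumes "rearr (Node g (map Leaf p)) u"
  obtains p' where "u = Node g (map Leaf p')" "mset p' = mset p"
proof -
  obtain us vs where u: "u = Node g us" "list_all2 rearr (map Leaf p) vs" "mset us = mset vs"
    using rearr_NodeD[OF assms] by blast
  have "vs = map Leaf p"
    using u(2) by (auto simp: list_all2_conv_all_nth intro!: nth_equalityI rearr_LeafD)
  with u(3) have us: "mset us = mset (map Leaf p)" by simp
  have "mset us = image_mset Leaf (mset p)" using us by simp
  then have "set us = Leaf ` set p" by (metis set_image_mset set_mset_mset)
  then have "map Leaf (map (\<lambda>t. hd (leaves t)) us) = us" unfolding map_map by (intro map_idI) auto
  moreover have "mset (map (\<lambda>t. hd (leaves t)) us) = mset p"
    unfolding mset_map us by (simp add: multiset.map_comp comp_def)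
  ultimately show thesis using that u(1) by metis
qed

text \<open>The symmetric group acts freely and transitively on the class of a corolla, whose only
  vertex has nothing but leaves above it. Sums over the class thus become the sums over \<sigma> in
  the formulas for the generators.\<close>

lemma bij_betw_corolla:
  "bij_betw (\<lambda>\<sigma>. tact \<sigma> (corolla g)) {\<sigma>. \<sigma> permutes {1..arity g}} (rclass (corolla g))"
  unfolding bij_betw_def
proof
  let ?n = "arity g"
  show "inj_on (\<lambda>\<sigma>. tact \<sigma> (corolla g)) {\<sigma>. \<sigma> permutes {1..?n}}"
  proof (rule inj_onI, clarify)
    fix \<sigma> \<tau> assume *: "\<sigma> permutes {1..?n}" "\<tau> permutes {1..?n}" "tact \<sigma> (corolla g) = tact \<tau> (corolla g)"
    have "map Leaf (map (inv \<sigma>) [1..<?n+1]) = map Leaf (map (inv \<tau>) [1..<?n+1])"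
      using *(3) unfolding tact_corolla by (simp only: tree.inject)
    then have "map (inv \<sigma>) [1..<?n+1] = map (inv \<tau>) [1..<?n+1]"
      by (rule map_injective) (simp add: inj_on_def)
    then show "\<sigma> = \<tau>" by (rule inv_permutes_eqD[OF *(1,2)])
  qed
  show "(\<lambda>\<sigma>. tact \<sigma> (corolla g)) ` {\<sigma>. \<sigma> permutes {1..?n}} = rclass (corolla g)"
  proof (intro equalityI subsetI)
    fix u assume "u \<in> (\<lambda>\<sigma>. tact \<sigma> (corolla g)) ` {\<sigma>. \<sigma> permutes {1..?n}}"
    then obtain \<sigma> where \<sigma>: "\<sigma> permutes {1..?n}" and u: "u = tact \<sigma> (corolla g)" by auto
    have "mset (map Leaf [1..<?n+1]) = mset (map Leaf (map (inv \<sigma>) [1..<?n+1]))"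
      unfolding mset_map[of Leaf] mset_map_permutes[OF permutes_inv[OF \<sigma>]] ..
    then have "rearr (corolla g) u" unfolding u unfolding tact_corolla unfolding corolla_eq by (rule rearr_perm)
    then show "u \<in> rclass (corolla g)" by (simp add: rclass_def)
  next
    fix u assume "u \<in> rclass (corolla g)"
    then have "rearr (Node g (map Leaf [1..<?n+1])) u" by (simp only: rclass_def corolla_eq mem_Collect_eq)
    then obtain p where u: "u = Node g (map Leaf p)" and p: "mset p = mset [1..<?n+1]"
      by (rule rearr_map_Leaf)
    obtain \<tau> where \<tau>: "\<tau> permutes {1..?n}" "p = map \<tau> [1..<?n+1]" using obtain_permutation[OF p] .
    have "u = tact (inv \<tau>) (corolla g)"
      unfolding u \<tau>(2) tact_corolla permutes_inv_inv[OF \<tau>(1)] ..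
    then show "u \<in> (\<lambda>\<sigma>. tact \<sigma> (corolla g)) ` {\<sigma>. \<sigma> permutes {1..?n}}"
      using permutes_inv[OF \<tau>(1)] by blast
  qed
qed

text \<open>Leaves have degree 0, so \<open>mweight\<close> only counts inversions of the leaf word.
  This word lists the values of \<open>inv \<sigma>\<close>, which has the same sign as
  \<sigma>.\<close>

lemma orient_tact_corolla:
  assumes "\<sigma> permutes {1..arity g}"
  shows "orient (tact \<sigma> (corolla g)) = sign \<sigma>"
proof -
  have "orient (Node g (map Leaf xs)) = isgn lweight xs" for xs
  proof -
    have "prod_list (map (tsign mweight) (map Leaf xs)) = 1" by (induction xs) simp_all
    moreover have "isgn mweight (map Leaf xs) = isgn lweight xs"
      unfolding isgn_map by (rule isgn_cong) (simp add: mweight_def lweight_def)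
    ultimately show ?thesis by (simp add: orient_def)
  qed
  then have "orient (tact \<sigma> (corolla g)) = sign (inv \<sigma>)"
    unfolding tact_corolla isgn_permutation[OF permutes_inv[OF assms], symmetric] .
  also have "\<dots> = sign \<sigma>"
    using assms permutation_permutes by (intro sign_inverse) blast
  finally show ?thesis .
qed

lemma orient_corolla: "orient (corolla g) = 1"
proof -
  have "tact id (corolla g) = corolla g" unfolding tact_def by (intro relabel_id) simp
  then show ?thesis using orient_tact_corolla[OF permutes_id, of g] by simp
qed

text \<open>\<open>F\<close> is arbitrary because such sums arise both from \<open>alternate\<close>
  itself and from composites with a corolla at the root.\<close>

lemma sum_rclass_corolla:
  "(\<Sum>c\<in>rclass (corolla g). F (orient (corolla g) * orient c) c) =
    (\<Sum>\<sigma> | \<sigma> permutes {1..arity g}. F (sign \<sigma>) (tact \<sigma> (corolla g)))"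
  unfolding sum.reindex_bij_betw[OF bij_betw_corolla, symmetric]
  by (intro sum.cong refl) (simp add: orient_tact_corolla orient_corolla)

lemma alternate_corolla:
  "alternate (corolla g) = (\<Sum>\<sigma> | \<sigma> permutes {1..arity g}. smul (of_int (sign \<sigma>)) (gen_tensor g \<sigma>))"
  unfolding alternate_def gen_tensor_def
  by (rule sum_rclass_corolla[where F = "\<lambda>e c. smul (of_int e) (monomial c)"])

lemma sum_PiE_split:
  assumes "i \<in> I"
  shows "(\<Sum>s\<in>Pi\<^sub>E I B. G s) = (\<Sum>x\<in>B i. \<Sum>r\<in>Pi\<^sub>E (I - {i}) B. G (r(i := x)))"
proof -
  have "(\<Sum>s\<in>Pi\<^sub>E I B. G s) = (\<Sum>s\<in>Pi\<^sub>E (insert i (I - {i})) B. G s)"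
    using assms by (simp add: insert_absorb)
  also have "\<dots> = (\<Sum>(x, r)\<in>B i \<times> Pi\<^sub>E (I - {i}) B. G (r(i := x)))"
    unfolding PiE_insert_eq     by (subst sum.reindex) (simp_all only: case_prod_unfold inj_combinator[of i "I - {i}" B, simplified case_prod_unfold]
        comp_def Diff_iff singleton_iff simp_thms)
  finally show ?thesis by (simp add: sum.cartesian_product)
qed

text \<open>Both sides are derivations along \<open>alternate\<close>, so agreement on generators,
  which is \<open>gen\<close>, propagates to all trees. A node is a corolla composed with the
  children: \<open>gen\<close> settles the term at the root, the induction hypothesis those at the
  children, and \<open>derivation_compose_corolla\<close> reassembles them.\<close>

theorem alternate_derivation:
  fixes DL DA :: "rb_gen \<Rightarrow> (tree \<Rightarrow>\<^sub>0 'k::comm_ring_1)"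
  assumes DL: "admissible DL" and DA: "admissible DA"
    and gen: "\<And>g. is_gen g \<Longrightarrow> lin alternate (DL g) =
      (\<Sum>\<sigma> | \<sigma> permutes {1..arity g}. smul (of_int (sign \<sigma>)) (lin (\<lambda>m. monomial (tact \<sigma> m)) (DA g)))"
    and "well_formed t" "distinct (leaves t)"
  shows "lin alternate (derivation DL t) = lin (derivation DA) (alternate t)"
  using assms(4,5)
proof (induction t)
  case (Node g ts)
  define s where "s = (\<lambda>i. ts ! (i - 1))"
  let ?n = "arity g"
  let ?I = "{1..arity g}"
  let ?S = "{\<sigma>. \<sigma> permutes ?I}"
  let ?B = "\<lambda>i. rclass (s i)"
  let ?cor = "corolla g"
  let ?c = "\<lambda>\<sigma>. tact \<sigma> ?cor"
  let ?sg = "\<lambda>\<sigma>. of_int (sign \<sigma>) :: 'k"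
  let ?e = "\<lambda>i. gdeg g + (\<Sum>j\<in>{1..<i}. tdeg (s j))"
  define a where "a = (\<lambda>J s'. \<Prod>i\<in>J. orient (s i) * orient (s' i))"
  have g: "is_gen g" and len: "length ts = ?n" and wf: "\<And>t. t \<in> set ts \<Longrightarrow> well_formed t"
    using Node.prems by simp_all
  have s_mem: "s i \<in> set ts" if "i \<in> ?I" for i
    unfolding s_def using that len by (intro nth_mem) auto
  have wf_s: "well_formed (s i)" if "i \<in> ?I" for i using wf s_mem that by blast
  have map_s: "map s [1..<?n+1] = ts" unfolding s_def len[symmetric] by (rule map_nth_upt)
  have c0: "?cor = Node g (map Leaf [1..<?n+1])" by (rule corolla_eq)
  have leaves_c0: "leaves ?cor = [1..<?n+1]" unfolding c0 by (simp add: comp_def)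
  then have set_c0: "set (leaves ?cor) = ?I" by auto
  have wf_c0: "well_formed ?cor" unfolding c0 using g by simp
  have compose_c0: "compose_all ?cor r = monomial (tsubst r ?cor)" for r :: "nat \<Rightarrow> tree"
  proof -
    have "symbols (\<lambda>i. tdeg (r i)) ?cor = map (Pair 0) [gdeg g] @ map (\<lambda>i. (i, tdeg (r i))) [1..<?n+1]"
      unfolding c0 by (simp add: comp_def)
    then show ?thesis unfolding compose_all_eq by (simp only: isgn_kweight_zero isgn_kweight_upt of_int_1 smul_1)
  qed
  have subst_c0: "tsubst r ?cor = Node g (map r [1..<?n+1])" for r
    unfolding c0 by (simp add: comp_def)
  have node: "tsubst s ?cor = Node g ts" unfolding subst_c0 map_s ..
  have composable: "composable m r"
    if "well_formed m" "mset (leaves m) = mset [1..<?n+1]" "\<And>i. i \<in> ?I \<Longrightarrow> well_formed (r i)"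
      "\<And>i. i \<in> ?I \<Longrightarrow> mset (leaves (r i)) = mset (leaves (s i))" for m r
  proof -
    have set: "set (leaves m) = ?I" using mset_eq_setD[OF that(2)] by auto
    have "mset (leaves (tsubst r m)) = mset (concat (map (\<lambda>i. leaves (r i)) [1..<?n+1]))"
      unfolding leaves_tsubst by (rule mset_concat_map_cong[OF that(2)])
    also have "\<dots> = (\<Sum>i\<leftarrow>[1..<?n+1]. mset (leaves (r i)))" by (simp only: mset_concat map_map comp_def)
    also have "\<dots> = (\<Sum>i\<leftarrow>[1..<?n+1]. mset (leaves (s i)))"
      using that(4) by (intro arg_cong[where f = sum_list] map_cong refl) (simp del: upt_Suc)
    also have "\<dots> = mset (leaves (Node g (map s [1..<?n+1])))" by (simp only: mset_concat map_map comp_def leaves.simps)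
    finally have "mset (leaves (tsubst r m)) = mset (leaves (Node g ts))" unfolding map_s .
    then have "distinct (leaves (tsubst r m))"
      using Node.prems(2) mset_eq_imp_distinct_iff by blast
    moreover have "distinct (leaves m)" using mset_eq_imp_distinct_iff[OF that(2)] by simp
    ultimately show ?thesis unfolding composable_def set using that(1,3) by simp
  qed
  have mset_c0: "mset (leaves ?cor) = mset [1..<?n+1]" unfolding leaves_c0 ..
  have fin: "finite ?I" by simp
  \<comment> \<open>Stated for arbitrary \<open>r\<close>: it is applied to the children themselves
    and also after one child has been replaced by a term of its differential.\<close>
  have expand: "alternate (tsubst r ?cor) = (\<Sum>\<sigma>\<in>?S. \<Sum>s'\<in>Pi\<^sub>E ?I (\<lambda>i. rclass (r i)).
      smul (?sg \<sigma> * of_int (\<Prod>i\<in>?I. orient (r i) * orient (s' i))) (compose_all (?c \<sigma>) s'))"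
    if "composable ?cor r" for r
    using lin_alternate_compose_all[OF that, where ?'a = 'k] unfolding compose_c0 lin_monomial set_c0
      sum_rclass_corolla[where F = "\<lambda>e c. \<Sum>s'\<in>Pi\<^sub>E ?I (\<lambda>i. rclass (r i)).
        smul (of_int (e * (\<Prod>i\<in>?I. orient (r i) * orient (s' i)))) (compose_all c s')"]
    by (simp only: of_int_mult)
  have comp_s: "composable ?cor s" using wf_c0 mset_c0 wf_s by (intro composable) simp_all
  have a_split: "a ?I (r(i := x)) = (orient (s i) * orient x) * a (?I - {i}) r" if "i \<in> ?I" for i r x
  proof -
    have "a ?I (r(i := x)) = (orient (s i) * orient x) * a (?I - {i}) (r(i := x))"
      unfolding a_def using that by (subst prod.remove[OF fin that]) simp
    also have "a (?I - {i}) (r(i := x)) = a (?I - {i}) r"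
      unfolding a_def by (intro prod.cong refl) simp
    finally show ?thesis .
  qed

  \<comment> \<open>The differential hits the root: \<open>gen\<close> turns the antisymmetrized
    value of \<open>DL g\<close> into the signed sum of all relabellings of
    \<open>DA g\<close>.\<close>
  have root: "lin alternate (lin (\<lambda>m. compose_all m s) (DL g)) =
      (\<Sum>\<sigma>\<in>?S. \<Sum>s'\<in>Pi\<^sub>E ?I ?B. smul (?sg \<sigma> * of_int (a ?I s'))
         (lin (\<lambda>m. compose_all (tact \<sigma> m) s') (DA g)))"
  proof -
    have "lin alternate (lin (\<lambda>m. compose_all m s) (DL g)) =
      lin (\<lambda>m. \<Sum>s'\<in>Pi\<^sub>E ?I ?B. smul (of_int (a ?I s')) (lin (\<lambda>m. compose_all m s') (alternate m))) (DL g)"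
      unfolding lin_lin
    proof (rule lin_cong)
      fix m assume "m \<in> Poly_Mapping.keys (DL g)"
      note m = admissibleD[OF DL g this]
      have "composable m s" using m(1,2) wf_s by (intro composable) simp_all
      then show "lin alternate (compose_all m s) =
        (\<Sum>s'\<in>Pi\<^sub>E ?I ?B. smul (of_int (a ?I s')) (lin (\<lambda>m. compose_all m s') (alternate m)))"
        unfolding lin_alternate_compose_all[OF \<open>composable m s\<close>] m(5) alternate_def lin_sum lin_smul lin_monomial
          smul_sum smul_smul a_def
        by (subst sum.swap) (simp only: of_int_mult ac_simps)
    qed
    also have "\<dots> = (\<Sum>s'\<in>Pi\<^sub>E ?I ?B. smul (of_int (a ?I s')) (lin (\<lambda>m. compose_all m s') (lin alternate (DL g))))"
      unfolding lin_fun_sum lin_fun_smul lin_lin ..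
    also have "\<dots> = (\<Sum>s'\<in>Pi\<^sub>E ?I ?B. \<Sum>\<sigma>\<in>?S. smul (?sg \<sigma> * of_int (a ?I s'))
         (lin (\<lambda>m. compose_all (tact \<sigma> m) s') (DA g)))"
      unfolding gen[OF g] lin_sum lin_smul lin_lin lin_monomial smul_sum smul_smul
      by (simp only: mult.commute)
    also have "\<dots> = (\<Sum>\<sigma>\<in>?S. \<Sum>s'\<in>Pi\<^sub>E ?I ?B. smul (?sg \<sigma> * of_int (a ?I s'))
         (lin (\<lambda>m. compose_all (tact \<sigma> m) s') (DA g)))"
      by (rule sum.swap)
    finally show ?thesis .
  qed

  \<comment> \<open>The differential hits child \<open>i\<close>. Its terms lie outside the class of
    \<open>s i\<close>, so the factor at \<open>i\<close> is split off the product of classes and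
    put back once the induction hypothesis has produced a sum over that class.\<close>
  have slot: "lin alternate (lin (\<lambda>u. monomial (Node g (ts[i - 1 := u]))) (derivation DL (s i))) =
     (\<Sum>\<sigma>\<in>?S. \<Sum>s'\<in>Pi\<^sub>E ?I ?B. smul (?sg \<sigma> * of_int (a ?I s'))
       (lin (\<lambda>u. compose_all (?c \<sigma>) (s'(i := u))) (derivation DA (s' i))))"
    if i: "i \<in> ?I" for i
  proof -
    let ?R = "Pi\<^sub>E (?I - {i}) ?B"
    let ?G = "\<lambda>\<sigma> r. smul (?sg \<sigma> * of_int (a (?I - {i}) r))"
    let ?h = "\<lambda>\<sigma> r x. compose_all (?c \<sigma>) (r(i := x))"
    have "lin alternate (lin (\<lambda>u. monomial (Node g (ts[i - 1 := u]))) (derivation DL (s i))) =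
       lin (\<lambda>u. \<Sum>\<sigma>\<in>?S. \<Sum>r\<in>?R. ?G \<sigma> r (lin (?h \<sigma> r) (alternate u))) (derivation DL (s i))"
      unfolding lin_lin lin_monomial
    proof (rule lin_cong)
      fix u assume "u \<in> Poly_Mapping.keys (derivation DL (s i))"
      with keys_derivation[OF DL wf_s[OF i]]
      have u: "well_formed u" "mset (leaves u) = mset (leaves (s i))" by blast+
      have "composable ?cor (s(i := u))" using wf_c0 mset_c0 wf_s u by (intro composable) simp_all
      note ex = expand[OF this]
      have "map (s(i := u)) [1..<?n+1] = (map s [1..<?n+1])[i - 1 := u]"
        by (rule nth_equalityI) (use i in \<open>auto simp: nth_list_update simp del: upt_Suc\<close>)
      then have tree: "Node g (ts[i - 1 := u]) = tsubst (s(i := u)) ?cor"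
        unfolding subst_c0 map_s by simp
      have "Pi\<^sub>E (?I - {i}) (\<lambda>l. rclass ((s(i := u)) l)) = ?R" by (intro PiE_cong) simp
      then have "alternate (Node g (ts[i - 1 := u])) = (\<Sum>\<sigma>\<in>?S. \<Sum>x\<in>rclass u. \<Sum>r\<in>?R.
        smul (?sg \<sigma> * of_int (\<Prod>l\<in>?I. orient ((s(i := u)) l) * orient ((r(i := x)) l))) (?h \<sigma> r x))"
        unfolding tree ex sum_PiE_split[OF i] by simp
      also have "\<dots> = (\<Sum>\<sigma>\<in>?S. \<Sum>x\<in>rclass u. \<Sum>r\<in>?R.
        smul (?sg \<sigma> * of_int (a (?I - {i}) r) * of_int (orient u * orient x)) (?h \<sigma> r x))"
      proof (intro sum.cong refl)
        fix \<sigma> x r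
        have "(\<Prod>l\<in>?I. orient ((s(i := u)) l) * orient ((r(i := x)) l)) =
          (orient u * orient x) * (\<Prod>l\<in>?I - {i}. orient ((s(i := u)) l) * orient ((r(i := x)) l))"
          by (subst prod.remove[OF fin i]) simp
        also have "(\<Prod>l\<in>?I - {i}. orient ((s(i := u)) l) * orient ((r(i := x)) l)) = a (?I - {i}) r"
          unfolding a_def by (intro prod.cong refl) simp
        finally show "smul (?sg \<sigma> * of_int (\<Prod>l\<in>?I. orient ((s(i := u)) l) * orient ((r(i := x)) l))) (?h \<sigma> r x) =
          smul (?sg \<sigma> * of_int (a (?I - {i}) r) * of_int (orient u * orient x)) (?h \<sigma> r x)"
          by (simp only: of_int_mult ac_simps)
      qed
      also have "\<dots> = (\<Sum>\<sigma>\<in>?S. \<Sum>r\<in>?R. ?G \<sigma> r (lin (?h \<sigma> r) (alternate u)))"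
        unfolding alternate_def lin_sum lin_smul lin_monomial smul_sum smul_smul
        by (intro sum.cong refl sum.swap)
      finally show "alternate (Node g (ts[i - 1 := u])) =
        (\<Sum>\<sigma>\<in>?S. \<Sum>r\<in>?R. ?G \<sigma> r (lin (?h \<sigma> r) (alternate u)))" .
    qed
    also have "\<dots> = (\<Sum>\<sigma>\<in>?S. \<Sum>r\<in>?R. ?G \<sigma> r (lin (?h \<sigma> r) (lin alternate (derivation DL (s i)))))"
      unfolding lin_fun_sum lin_fun_smul lin_lin ..
    also have "lin alternate (derivation DL (s i)) = lin (derivation DA) (alternate (s i))"
      using Node.IH[OF s_mem[OF i] wf_s[OF i]] distinct_leaves_child[OF Node.prems(2) s_mem[OF i]] by blast
    also have "(\<Sum>\<sigma>\<in>?S. \<Sum>r\<in>?R. ?G \<sigma> r (lin (?h \<sigma> r) (lin (derivation DA) (alternate (s i))))) =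
       (\<Sum>\<sigma>\<in>?S. \<Sum>r\<in>?R. \<Sum>x\<in>rclass (s i).
         smul (?sg \<sigma> * of_int (a ?I (r(i := x)))) (lin (?h \<sigma> r) (derivation DA x)))"
      unfolding alternate_def lin_sum lin_smul lin_monomial smul_sum smul_smul a_split[OF i]
      by (simp only: of_int_mult ac_simps)
    also have "\<dots> = (\<Sum>\<sigma>\<in>?S. \<Sum>s'\<in>Pi\<^sub>E ?I ?B. smul (?sg \<sigma> * of_int (a ?I s'))
       (lin (\<lambda>u. compose_all (?c \<sigma>) (s'(i := u))) (derivation DA (s' i))))"
      unfolding sum_PiE_split[OF i] by (intro sum.cong refl, subst sum.swap) simp
    finally show ?thesis .
  qed

  have "lin alternate (derivation DL (Node g ts)) = lin alternate (lin (\<lambda>m. compose_all m s) (DL g)) +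
     (\<Sum>j<?n. smul ((-1) ^ ?e (Suc j))
       (lin alternate (lin (\<lambda>u. monomial (Node g (ts[j := u]))) (derivation DL (s (Suc j))))))"
  proof -
    have deg: "sum_list (map tdeg (take j ts)) = (\<Sum>l\<in>{1..<Suc j}. tdeg (s l))" if "j < ?n" for j
    proof -
      have "take j ts = map s [1..<Suc j]"
        using that unfolding map_s[symmetric] take_map by (simp add: take_upt del: upt_Suc)
      then show ?thesis using sum.distinct_set_conv_list[of "[1..<Suc j]" "\<lambda>l. tdeg (s l)"]
        by (simp add: comp_def del: upt_Suc)
    qed
    have nth: "map (derivation DL) ts ! j = derivation DL (s (Suc j))" if "j < ?n" for j
      using that len by (simp add: s_def)
    show ?thesis
      unfolding derivation.simps lin_add lin_sum lin_smul len s_def[symmetric]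
      by (intro arg_cong2[where f = "(+)"] sum.cong refl) (simp only: lessThan_iff deg nth)
  qed
  also have "(\<Sum>j<?n. smul ((-1) ^ ?e (Suc j))
       (lin alternate (lin (\<lambda>u. monomial (Node g (ts[j := u]))) (derivation DL (s (Suc j)))))) =
     (\<Sum>i\<in>?I. smul ((-1) ^ ?e i)
       (lin alternate (lin (\<lambda>u. monomial (Node g (ts[i - 1 := u]))) (derivation DL (s i)))))"
    by (rule sum.reindex_bij_witness[of _ "\<lambda>i. i - 1" Suc]) auto
  also have "\<dots> = (\<Sum>i\<in>?I. smul ((-1) ^ ?e i) (\<Sum>\<sigma>\<in>?S. \<Sum>s'\<in>Pi\<^sub>E ?I ?B. smul (?sg \<sigma> * of_int (a ?I s'))
       (lin (\<lambda>u. compose_all (?c \<sigma>) (s'(i := u))) (derivation DA (s' i)))))"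
    by (intro sum.cong refl) (simp only: slot)
  also have "\<dots> = (\<Sum>\<sigma>\<in>?S. \<Sum>s'\<in>Pi\<^sub>E ?I ?B. smul (?sg \<sigma> * of_int (a ?I s')) (\<Sum>i\<in>?I. smul ((-1) ^ ?e i)
       (lin (\<lambda>u. compose_all (?c \<sigma>) (s'(i := u))) (derivation DA (s' i)))))"
  proof -
    have "(\<Sum>i\<in>?I. \<Sum>\<sigma>\<in>?S. \<Sum>s'\<in>Pi\<^sub>E ?I ?B. F i \<sigma> s') = (\<Sum>\<sigma>\<in>?S. \<Sum>s'\<in>Pi\<^sub>E ?I ?B. \<Sum>i\<in>?I. F i \<sigma> s')"
      for F :: "nat \<Rightarrow> (nat \<Rightarrow> nat) \<Rightarrow> (nat \<Rightarrow> tree) \<Rightarrow> tree \<Rightarrow>\<^sub>0 'k"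
      by (subst sum.swap, intro sum.cong refl, rule sum.swap)
    then show ?thesis unfolding smul_sum smul_smul by (simp only: mult.commute)
  qed
  \<comment> \<open>For fixed \<sigma> and \<open>s'\<close>, the root term and the child terms are
    the two parts of \<open>derivation_compose_corolla\<close>.\<close>
  also have "lin alternate (lin (\<lambda>m. compose_all m s) (DL g)) + \<dots> =
     (\<Sum>\<sigma>\<in>?S. \<Sum>s'\<in>Pi\<^sub>E ?I ?B. smul (?sg \<sigma> * of_int (a ?I s'))
       (lin (derivation DA) (compose_all (?c \<sigma>) s')))"
    unfolding root sum.distrib[symmetric] smul_add[symmetric]
  proof (intro sum.cong refl arg_cong[where f = "smul _"])
    fix \<sigma> s' assume "\<sigma> \<in> ?S" and s': "s' \<in> Pi\<^sub>E ?I ?B"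
    then have \<sigma>: "\<sigma> permutes ?I" by simp
    let ?p = "map (inv \<sigma>) [1..<?n+1]"
    have rs: "rearr (s i) (s' i)" if "i \<in> ?I" for i using PiE_mem[OF s' that] by (simp add: rclass_def)
    have p: "mset ?p = mset [1..<?n+1]" by (rule mset_map_permutes[OF permutes_inv[OF \<sigma>]])
    have wf': "well_formed (s' i)" if "i \<in> ?I" for i
      using rearr_invariants(3)[OF rs[OF that]] wf_s[OF that] by simp
    \<comment> \<open>Rearranged children keep their degrees, so the signs in front of the child
      terms do not depend on \<open>s'\<close>.\<close>
    have e: "gdeg g + (\<Sum>j\<in>{1..<i}. tdeg (s' j)) = ?e i" if "i \<in> ?I" for i
      using that rearr_invariants(2)[OF rs] by simp
    have rel: "relabel (\<lambda>i. ?p ! (i - 1)) m = tact \<sigma> m" if "m \<in> Poly_Mapping.keys (DA g)" for m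
      unfolding tact_def relabel_def using admissibleD(5)[OF DA g that]
      by (intro tsubst_cong) (auto simp del: upt_Suc)
    have "lin (derivation DA) (compose_all (?c \<sigma>) s') =
      lin (\<lambda>m. compose_all (relabel (\<lambda>i. ?p ! (i - 1)) m) s') (DA g) +
      (\<Sum>i\<in>?I. smul ((-1) ^ (gdeg g + (\<Sum>j\<in>{1..<i}. tdeg (s' j))))
        (lin (\<lambda>u. compose_all (?c \<sigma>) (s'(i := u))) (derivation DA (s' i))))"
      unfolding tact_corolla by (rule derivation_compose_corolla[OF DA g p wf'])
    moreover have "lin (\<lambda>m. compose_all (relabel (\<lambda>i. ?p ! (i - 1)) m) s') (DA g) =
      lin (\<lambda>m. compose_all (tact \<sigma> m) s') (DA g)"
      by (rule lin_cong) (simp only: rel)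
    moreover have "(\<Sum>i\<in>?I. smul ((-1) ^ (gdeg g + (\<Sum>j\<in>{1..<i}. tdeg (s' j))))
        (lin (\<lambda>u. compose_all (?c \<sigma>) (s'(i := u))) (derivation DA (s' i)))) =
      (\<Sum>i\<in>?I. smul ((-1) ^ ?e i)
        (lin (\<lambda>u. compose_all (?c \<sigma>) (s'(i := u))) (derivation DA (s' i))))"
      by (intro sum.cong refl) (simp only: e)
    ultimately show "lin (\<lambda>m. compose_all (tact \<sigma> m) s') (DA g) + (\<Sum>i\<in>?I. smul ((-1) ^ ?e i)
        (lin (\<lambda>u. compose_all (?c \<sigma>) (s'(i := u))) (derivation DA (s' i)))) =
      lin (derivation DA) (compose_all (?c \<sigma>) s')" by simp
  qed
  also have "\<dots> = lin (derivation DA) (alternate (Node g ts))"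
    unfolding node[symmetric] expand[OF comp_s] lin_sum lin_smul a_def ..
  finally show ?case .
qed simp

section \<open>Shuffle representatives\<close>

text \<open>The planar shape of a tree, encoded as the tree with all labels 1; this is the label
  that \<open>graft\<close> puts on free inputs before numbering.\<close>

definition erase :: "tree \<Rightarrow> tree" where
  "erase = relabel (\<lambda>_. 1)"

lemma erase_simps [simp]:
  "erase (Leaf i) = Leaf 1"
  "erase (Node g ts) = Node g (map erase ts)"
  by (simp_all add: erase_def)

lemma erase_relabel [simp]: "erase (relabel f t) = erase t"
  by (simp add: erase_def)


lemma length_leaves_erase [simp]: "length (leaves (erase t)) = length (leaves t)"
  by (simp add: erase_def)

lemma well_formed_erase [simp]: "well_formed (erase t) = well_formed t"
  by (simp add: erase_def)

lemma leaves_number: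
  "leaves (number c t) = [c..<c + length (leaves t)]"
  "concat (map leaves (number_list c ts)) = [c..<c + length (concat (map leaves ts))]"
proof (induction c t and c ts rule: number_number_list.induct)
  case (4 c t ts)
  then show ?case
    using upt_add_eq_append[of c "c + length (leaves t)" "length (concat (map leaves ts))"]
    by (simp add: add.assoc)
qed simp_all

lemma erase_number:
  "erase (number c t) = erase t"
  "map erase (number_list c ts) = map erase ts"
  by (induction c t and c ts rule: number_number_list.induct) simp_all

lemma number_erase:
  "number c (erase t) = number c t"
  "number_list c (map erase ts) = number_list c ts"
  by (induction c t and c ts rule: number_number_list.induct) simp_all

lemma well_formed_number [simp]: "well_formed (number c t) = well_formed t"
  using erase_number(1)[of c t] well_formed_erase by metis

text \<open>The shape fixes how the leaf word is cut into the words of the children, so nothing else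
  is left to choose.\<close>

lemma tree_eqI:
  assumes "erase t = erase t'" "leaves t = leaves t'"
  shows "t = t'"
  using assms
proof (induction t arbitrary: t')
  case (Leaf i)
  then show ?case by (cases t') simp_all
next
  case (Node g ts)
  from Node.prems(1) obtain us where t': "t' = Node g us" and map: "map erase ts = map erase us"
    by (cases t') auto
  have "ts = us"
    using Node.IH map Node.prems(2)[unfolded t' leaves.simps]
  proof (induction ts arbitrary: us)
    case (Cons x xs)
    from Cons.prems(2) obtain y ys where us: "us = y # ys" "erase x = erase y" "map erase xs = map erase ys"
      by (cases us) auto
    have "length (leaves x) = length (leaves y)" using us(2) length_leaves_erase by metis
    then have "leaves x = leaves y" "concat (map leaves xs) = concat (map leaves ys)"
      using Cons.prems(3) us(1) by simp_all
    moreover have "xs = ys"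
    proof (rule Cons.IH)
      show "t = t'" if "t \<in> set xs" "erase t = erase t'" "leaves t = leaves t'" for t t'
        using Cons.prems(1)[of t t'] that by simp
    qed fact+
    moreover have "x = y" using Cons.prems(1)[of x y] us(2) \<open>leaves x = leaves y\<close> by simp
    ultimately show ?case using us(1) by simp
  qed simp
  then show ?case using t' by simp
qed

text \<open>The children are made shuffle trees and then sorted by their minimal labels. These are
  distinct, so the sorted list is strictly increasing.\<close>

lemma shuffle_exists:
  assumes "well_formed t" "distinct (leaves t)"
  shows "\<exists>t'. rearr t t' \<and> shuffle_tree t'"
  using assms
proof (induction t)
  case (Leaf i)
  then show ?case by (intro exI[of _ "Leaf i"]) simp
next
  case (Node g ts)
  let ?m = "\<lambda>t. Min (set (leaves t))"
  have "\<exists>t'. rearr t t' \<and> shuffle_tree t'" if "t \<in> set ts" for t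
    using Node.IH[OF that] Node.prems distinct_leaves_child[OF _ that] that by simp
  then obtain f where f: "\<And>t. t \<in> set ts \<Longrightarrow> rearr t (f t) \<and> shuffle_tree (f t)" by metis
  let ?us = "map f ts"
  let ?vs = "sort_key ?m ?us"
  have "list_all2 rearr ts ?us" using f by (simp add: list_all2_conv_all_nth)
  then have "rearr (Node g ts) (Node g ?us)" using rearr_list_cong[of ts ?us g "[]"] by simp
  also have "rearr (Node g ?us) (Node g ?vs)" by (rule rearr_perm) simp
  finally have r: "rearr (Node g ts) (Node g ?vs)" .
  then have dist: "distinct (leaves (Node g ?vs))" and wf: "well_formed (Node g ?vs)"
    using Node.prems rearr_leaves(2)[OF r] rearr_invariants(3)[OF r] by simp_all
  have "distinct (map ?m vs)" if "distinct (concat (map leaves vs))" "\<forall>t\<in>set vs. well_formed t" for vs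
    using that
  proof (induction vs)
    case (Cons v vs)
    have "?m v \<noteq> ?m w" if w: "w \<in> set vs" for w
    proof -
      have "set (leaves v) \<inter> set (leaves w) = {}" using Cons.prems(1) w by auto
      moreover have "?m v \<in> set (leaves v)" "?m w \<in> set (leaves w)"
        using Cons.prems(2) w leaves_nonempty by (simp_all add: Min_in)
      ultimately show ?thesis by (metis disjoint_iff)
    qed
    then show ?case using Cons by auto
  qed simp
  then have "distinct (map ?m ?vs)" using dist wf by simp
  then have "sorted_wrt (<) (map ?m ?vs)" by (simp add: strict_sorted_iff)
  moreover have "shuffle_tree v" if "v \<in> set ?vs" for v using that f by auto
  ultimately have "shuffle_tree (Node g ?vs)" by simp
  with r show ?case by blast
qed

text \<open>A rearrangement preserves the minimal label of each child. The increasing order of the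
  minima thus fixes the order of the children, and the induction applies to each of them.\<close>

lemma shuffle_unique:
  assumes "rearr t t'" "shuffle_tree t" "shuffle_tree t'"
  shows "t = t'"
  using assms
proof (induction t arbitrary: t')
  case (Leaf i)
  then show ?case using rearr_LeafD by metis
next
  case (Node g ts)
  let ?m = "\<lambda>t. Min (set (leaves t))"
  obtain us vs where t': "t' = Node g us" and vs: "list_all2 rearr ts vs" and mset: "mset us = mset vs"
    using rearr_NodeD[OF Node.prems(1)] by blast
  have ts_sorted: "sorted_wrt (<) (map ?m ts)" and us_sorted: "sorted_wrt (<) (map ?m us)"
    using Node.prems t' by simp_all
  have maps: "map ?m vs = map ?m ts"
    using vs by (induction rule: list_all2_induct) (simp_all add: rearr_leaves(1))
  have "set (map ?m us) = set (map ?m ts)"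
    using mset_eq_setD[OF mset] maps by (metis set_map)
  then have eq: "map ?m us = map ?m ts" using us_sorted ts_sorted by (simp add: strict_sorted_equal)
  have "inj_on ?m (set us)" using us_sorted by (simp add: strict_sorted_iff distinct_map)
  then have "inj_on ?m (set us \<union> set vs)" using mset_eq_setD[OF mset] by simp
  then have "us = vs" using eq maps by (intro map_inj_on[of ?m]) simp_all
  have "ts = vs"
  proof (rule nth_equalityI)
    show len: "length ts = length vs" using vs by (rule list_all2_lengthD)
    fix i assume i: "i < length ts"
    have "rearr (ts ! i) (vs ! i)" using vs i by (rule list_all2_nthD)
    moreover have "shuffle_tree (ts ! i)" using Node.prems(2) i by simp
    moreover have "shuffle_tree (vs ! i)" using Node.prems(3) i len \<open>us = vs\<close> t' by simp
    ultimately show "ts ! i = vs ! i" using Node.IH[of "ts ! i" "vs ! i"] i by simp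
  qed
  then show ?case using t' \<open>us = vs\<close> by simp
qed

section \<open>Signs of labelled trees under rearrangement\<close>

lemma isgn_leaves: "isgn lweight (leaves t) = tsign (\<lambda>x y. cross lweight (leaves x) (leaves y)) t"
proof (induction t)
  case (Node g ts)
  have "isgn lweight (leaves (Node g ts)) = isgn (\<lambda>x y. cross lweight (leaves x) (leaves y)) ts *
      prod_list (map (\<lambda>t. isgn lweight (leaves t)) ts)"
    unfolding leaves.simps isgn_concat isgn_map by (simp add: comp_def)
  also have "map (\<lambda>t. isgn lweight (leaves t)) ts = map (tsign (\<lambda>x y. cross lweight (leaves x) (leaves y))) ts"
    using Node by simp
  finally show ?case by simp
qed simp

text \<open>
  With this weight, \<open>tsign\<close> has exponent \<open>\<Sum> (k - j) (l\<^sub>j - 1)\<close> over all vertices, \<open>k\<close> being the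
  number of inputs and \<open>l\<^sub>j\<close> the number of leaves above the \<open>j\<close>-th input.
\<close>

definition cweight :: "tree \<Rightarrow> tree \<Rightarrow> nat" where
  "cweight x y = length (leaves x) - 1"

text \<open>
  The condition on siblings under which the signs of the differential transform like the
  generators do.
\<close>

definition pair_ok :: "tree \<Rightarrow> tree \<Rightarrow> bool" where
  "pair_ok x y \<longleftrightarrow> even (length (leaves x) * length (leaves y) +
     (length (leaves x) - 1) + (length (leaves y) - 1) + 1 + tdeg x * tdeg y)"

fun good :: "tree \<Rightarrow> bool" where
  "good (Leaf i) = True"
| "good (Node g ts) = (sorted_wrt pair_ok ts \<and> (\<forall>t\<in>set ts. good t))"

lemma pair_ok_sym: "pair_ok x y \<Longrightarrow> pair_ok y x"
  unfolding pair_ok_def by (simp only: ac_simps)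

lemma pair_ok_swap1:
  assumes "swap1 x x'"
  shows "pair_ok x' y = pair_ok x y" "pair_ok y x' = pair_ok y x"
proof -
  have "length (leaves x') = length (leaves x)" using swap1_invariants(1)[OF assms] by (rule mset_eq_length)
  then show "pair_ok x' y = pair_ok x y" "pair_ok y x' = pair_ok y x"
    using swap1_invariants(2)[OF assms] by (simp_all add: pair_ok_def)
qed

lemma good_swap1: "swap1 t t' \<Longrightarrow> good t \<Longrightarrow> good t'"
proof (induction rule: swap1.induct)
  case (swap g as x y bs)
  then show ?case using pair_ok_sym by (simp add: sorted_wrt_append)
next
  case (cong t t' g as bs)
  then show ?case using pair_ok_swap1[OF cong.hyps] by (simp add: sorted_wrt_append)
qed

lemma pair_ok_relabel: "pair_ok (relabel f x) (relabel f y) = pair_ok x y"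
  by (simp add: pair_ok_def)

lemma good_relabel: "good (relabel f t) = good t"
proof (induction t)
  case (Node g ts)
  then show ?case by (simp add: sorted_wrt_map pair_ok_relabel)
qed simp

lemma cross_lweight_total:
  "set xs \<inter> set ys = {} \<Longrightarrow> cross lweight xs ys + cross lweight ys xs = length xs * length ys"
proof (induction xs)
  case (Cons x xs)
  then have "x \<notin> set ys" by simp
  then have "sum_list (map (lweight x) ys) + sum_list (map (\<lambda>y. lweight y x) ys) = length ys"
    by (induction ys) (auto simp: lweight_def)
  then show ?case using Cons by simp
qed simp

text \<open>For siblings with \<open>a\<close> and \<open>b\<close> leaves, the three weights,
  summed over both orders, give \<open>(a - 1) + (b - 1)\<close>, \<open>a * b\<close> and
  \<open>1 + tdeg x * tdeg y\<close>; together they form the exponent in \<open>pair_ok\<close>. So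
  \<open>tsign cweight\<close> times the signature of the leaf word varies over a class exactly as
  \<open>orient\<close> does.\<close>

theorem tsign_good_rearr:
  assumes "rearr t t'" "well_formed t" "distinct (leaves t)" "good t"
  shows "tsign cweight t * isgn lweight (leaves t) * orient t =
    tsign cweight t' * isgn lweight (leaves t') * orient t'"
proof -
  let ?l = "\<lambda>x y. cross lweight (leaves x) (leaves y)"
  let ?c = "\<lambda>x y. cweight x y + ?l x y + mweight x y"
  have "tsign ?c t = tsign ?c t'"
  proof (rule tsign_rearr[where P = "\<lambda>t. well_formed t \<and> distinct (leaves t) \<and> good t", OF assms(1)])
    fix g as x y bs
    let ?t = "Node g (as @ x # y # bs)"
    assume *: "well_formed ?t \<and> distinct (leaves ?t) \<and> good ?t"
    then have wf: "well_formed x" "well_formed y" by simp_all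
    from * have disj: "set (leaves x) \<inter> set (leaves y) = {}" by auto
    from * have "pair_ok x y" by (simp add: sorted_wrt_append)
    moreover have "?c x y + ?c y x = length (leaves x) * length (leaves y) +
     (length (leaves x) - 1) + (length (leaves y) - 1) + 1 + tdeg x * tdeg y"
      using even_mweight[OF wf disj] cross_lweight_total[OF disj] unfolding cweight_def by linarith
    ultimately show "even (?c x y + ?c y x)" by (simp only: pair_ok_def)
  next
    fix u u' z assume *: "swap1 u u'"
    have "length (leaves u) = length (leaves u')"
      using swap1_invariants(1)[OF *] by (metis mset_eq_length)
    moreover have "?l u z = ?l u' z" "?l z u = ?l z u'"
      by (intro cross_mset_cong refl; simp add: swap1_invariants(1)[OF *])+
    ultimately show "?c u z = ?c u' z \<and> ?c z u = ?c z u'"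
      using swap1_mweight[OF *] by (simp add: cweight_def)
  next
    fix u u' assume "swap1 u u'" "well_formed u \<and> distinct (leaves u) \<and> good u"
    then show "well_formed u' \<and> distinct (leaves u') \<and> good u'"
      using good_swap1[of u u'] swap1_invariants(3)[of u u'] rearr_leaves(2)[OF r_into_rtranclp, of u u'] by simp
  next
    fix g ts x assume "well_formed (Node g ts) \<and> distinct (leaves (Node g ts)) \<and> good (Node g ts)" "x \<in> set ts"
    then show "well_formed x \<and> distinct (leaves x) \<and> good x"
      using distinct_leaves_child[of g ts x] by simp
  qed (use assms in simp)
  then show ?thesis by (simp only: tsign_add orient_def isgn_leaves)
qed

lemma tsign_cweight_erase: "tsign cweight (erase t) = tsign cweight t"
proof (induction t)
  case (Node g ts)
  then have "map (tsign cweight) (map erase ts) = map (tsign cweight) ts" by simp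
  moreover have "isgn cweight (map erase ts) = isgn cweight ts"
    unfolding isgn_map by (rule isgn_cong) (simp add: cweight_def)
  ultimately show ?case by (simp only: erase_simps tsign.simps)
qed simp

section \<open>All labellings of a set of shapes\<close>

definition is_shape :: "nat \<Rightarrow> tree \<Rightarrow> bool" where
  "is_shape n T \<longleftrightarrow> well_formed T \<and> length (leaves T) = n \<and> erase T = T"

definition labellings :: "nat \<Rightarrow> tree set \<Rightarrow> tree set" where
  "labellings n S = {T \<in> tree_monomials n. erase T \<in> S}"

lemma leaves_tree_monomial:
  assumes "T \<in> tree_monomials n"
  shows "mset (leaves T) = mset [1..<n+1]"
proof -
  have "set [1..<n+1] = {1..n}" by auto
  then show ?thesis using assms set_eq_iff_mset_eq_distinct[of "leaves T" "[1..<n+1]"]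
    by (simp add: tree_monomials_def del: upt_Suc)
qed

lemma leaves_tact_number:
  assumes "length (leaves T) = n"
  shows "leaves (tact \<sigma> (number 1 T)) = map (inv \<sigma>) [1..<n+1]"
  by (simp add: tact_def leaves_number(1) assms del: upt_Suc)

lemma tact_number_mem:
  assumes "is_shape n T" "\<sigma> permutes {1..n}"
  shows "tact \<sigma> (number 1 T) \<in> tree_monomials n" "erase (tact \<sigma> (number 1 T)) = T"
proof -
  have len: "length (leaves T) = n" using assms by (simp add: is_shape_def)
  have "mset (leaves (tact \<sigma> (number 1 T))) = mset [1..<n+1]"
    unfolding leaves_tact_number[OF len] by (rule mset_map_permutes[OF permutes_inv[OF assms(2)]])
  moreover have "set [1..<n+1] = {1..n}" by auto
  ultimately have "distinct (leaves (tact \<sigma> (number 1 T)))" "set (leaves (tact \<sigma> (number 1 T))) = {1..n}"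
    using mset_eq_imp_distinct_iff distinct_upt mset_eq_setD by metis+
  moreover have "well_formed (tact \<sigma> (number 1 T))" using assms by (simp add: tact_def is_shape_def)
  ultimately show "tact \<sigma> (number 1 T) \<in> tree_monomials n" by (simp add: tree_monomials_def)
  show "erase (tact \<sigma> (number 1 T)) = T"
    using assms by (simp add: tact_def erase_number is_shape_def)
qed

text \<open>A labelled tree arises from its shape, numbered from left to right, by the inverse of
  the permutation that its leaf word spells; the inverse is due to the convention for the
  action.\<close>

lemma bij_betw_labellings:
  assumes S: "\<And>T. T \<in> S \<Longrightarrow> is_shape n T"
  shows "bij_betw (\<lambda>(T, \<sigma>). tact \<sigma> (number 1 T)) (S \<times> {\<sigma>. \<sigma> permutes {1..n}}) (labellings n S)"
  unfolding bij_betw_def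
proof
  show "inj_on (\<lambda>(T, \<sigma>). tact \<sigma> (number 1 T)) (S \<times> {\<sigma>. \<sigma> permutes {1..n}})"
  proof (rule inj_onI, clarify)
    fix T \<sigma> T' \<sigma>' assume *: "T \<in> S" "T' \<in> S" "\<sigma> permutes {1..n}" "\<sigma>' permutes {1..n}"
      "tact \<sigma> (number 1 T) = tact \<sigma>' (number 1 T')"
    have "T = T'" using tact_number_mem(2)[OF S] * by metis
    moreover have len: "length (leaves T) = n" using S[OF *(1)] by (simp add: is_shape_def)
    ultimately have "map (inv \<sigma>) [1..<n+1] = map (inv \<sigma>') [1..<n+1]"
      using *(5) leaves_tact_number[OF len] by metis
    then show "T = T' \<and> \<sigma> = \<sigma>'" using inv_permutes_eqD[OF *(3,4)] \<open>T = T'\<close> by blast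
  qed
  show "(\<lambda>(T, \<sigma>). tact \<sigma> (number 1 T)) ` (S \<times> {\<sigma>. \<sigma> permutes {1..n}}) = labellings n S"
  proof (intro equalityI subsetI)
    fix u assume "u \<in> (\<lambda>(T, \<sigma>). tact \<sigma> (number 1 T)) ` (S \<times> {\<sigma>. \<sigma> permutes {1..n}})"
    then show "u \<in> labellings n S" using tact_number_mem[OF S] by (auto simp: labellings_def)
  next
    fix u assume u: "u \<in> labellings n S"
    then have mem: "u \<in> tree_monomials n" "erase u \<in> S" by (simp_all add: labellings_def)
    obtain \<tau> where \<tau>: "\<tau> permutes {1..n}" "leaves u = map \<tau> [1..<n+1]"
      using obtain_permutation[OF leaves_tree_monomial[OF mem(1)]] .
    have len: "length (leaves (erase u)) = n" using S[OF mem(2)] by (simp add: is_shape_def)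
    have inv: "inv \<tau> permutes {1..n}" by (rule permutes_inv[OF \<tau>(1)])
    have "u = tact (inv \<tau>) (number 1 (erase u))"
    proof (rule tree_eqI)
      show "erase u = erase (tact (inv \<tau>) (number 1 (erase u)))"
        using tact_number_mem(2)[OF S[OF mem(2)] inv] by simp
      show "leaves u = leaves (tact (inv \<tau>) (number 1 (erase u)))"
        unfolding leaves_tact_number[OF len] permutes_inv_inv[OF \<tau>(1)] by (rule \<tau>(2))
    qed
    then show "u \<in> (\<lambda>(T, \<sigma>). tact \<sigma> (number 1 T)) ` (S \<times> {\<sigma>. \<sigma> permutes {1..n}})"
      using mem(2) inv by (intro image_eqI[of _ _ "(erase u, inv \<tau>)"]) simp_all
  qed
qed

lemma sign_tact_number:
  assumes "is_shape n T" "\<sigma> permutes {1..n}"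
  shows "isgn lweight (leaves (tact \<sigma> (number 1 T))) = sign \<sigma>"
proof -
  have "length (leaves T) = n" using assms by (simp add: is_shape_def)
  then have "isgn lweight (leaves (tact \<sigma> (number 1 T))) = sign (inv \<sigma>)"
    using isgn_permutation[OF permutes_inv[OF assms(2)]] by (simp only: leaves_tact_number)
  also have "\<dots> = sign \<sigma>" using assms permutation_permutes by (intro sign_inverse) blast
  finally show ?thesis .
qed

text \<open>
  Each class of tree monomials contains exactly one shuffle tree, so the two sums run over the same
  labelled trees.
\<close>

theorem lin_alternate_shuffle_sum:
  fixes wt :: "tree \<Rightarrow> 'k::comm_ring_1"
  assumes fin: "finite S" and S: "\<And>T. T \<in> S \<Longrightarrow> is_shape n T \<and> good T"
    and closed: "\<And>T T'. T \<in> S \<Longrightarrow> swap1 T T' \<Longrightarrow> T' \<in> S \<and> wt T' = wt T"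
  shows "lin alternate (\<Sum>T\<in>S. smul (wt T * of_int (tsign cweight T)) (shuffle_sum (number 1 T))) =
    (\<Sum>\<sigma> | \<sigma> permutes {1..n}. smul (of_int (sign \<sigma>)) (lin (\<lambda>m. monomial (tact \<sigma> m))
      (\<Sum>T\<in>S. smul (wt T * of_int (tsign cweight T)) (monomial (number 1 T)))))"
proof -
  let ?P = "{\<sigma>. \<sigma> permutes {1..n}}"
  let ?X = "labellings n S"
  let ?Y = "{T \<in> ?X. shuffle_tree T}"
  \<comment> \<open>The coefficient of a labelled tree in the sum over all labellings: the
    coefficient of its shape times the signature of its leaf word.\<close>
  define \<epsilon> where "\<epsilon> T = wt (erase T) * of_int (tsign cweight T * isgn lweight (leaves T))" for T
  have bij: "bij_betw (\<lambda>(T, \<sigma>). tact \<sigma> (number 1 T)) (S \<times> ?P) ?X"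
    by (rule bij_betw_labellings) (use S in blast)
  have finP: "finite ?P" by (rule finite_permutations) simp
  have finX: "finite ?X" using bij_betw_finite[OF bij] fin finP by simp
  have \<epsilon>_tact: "\<epsilon> (tact \<sigma> (number 1 T)) = of_int (sign \<sigma>) * (wt T * of_int (tsign cweight T))"
    if "T \<in> S" "\<sigma> permutes {1..n}" for T \<sigma>
  proof -
    note T = S[OF that(1), THEN conjunct1]
    have "tsign cweight (tact \<sigma> (number 1 T)) = tsign cweight T"
      using tact_number_mem(2)[OF T that(2)] tsign_cweight_erase by metis
    then show ?thesis
      unfolding \<epsilon>_def tact_number_mem(2)[OF T that(2)] sign_tact_number[OF T that(2)]
      by (simp only: of_int_mult ac_simps)
  qed
  have sum_X: "(\<Sum>T\<in>S. \<Sum>\<sigma>\<in>?P. smul (of_int (sign \<sigma>) * (wt T * of_int (tsign cweight T)))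
      (F (tact \<sigma> (number 1 T)))) = (\<Sum>u\<in>?X. smul (\<epsilon> u) (F u))" for F :: "tree \<Rightarrow> tree \<Rightarrow>\<^sub>0 'k"
    unfolding sum.reindex_bij_betw[OF bij, symmetric] sum.cartesian_product
  proof (rule sum.cong[OF refl], clarify)
    fix T \<sigma> assume "T \<in> S" "\<sigma> permutes {1..n}"
    then show "smul (of_int (sign \<sigma>) * (wt T * of_int (tsign cweight T))) (F (tact \<sigma> (number 1 T))) =
      smul (\<epsilon> (tact \<sigma> (number 1 T))) (F (tact \<sigma> (number 1 T)))"
      by (simp only: \<epsilon>_tact)
  qed
  have len: "length (leaves (number 1 T)) = n" if "T \<in> S" for T
    using S[OF that] by (simp add: leaves_number(1) is_shape_def)
  \<comment> \<open>\<open>erase\<close> maps a move of labelled trees to a move of their shapes,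
    and \<open>S\<close> is closed under the latter.\<close>
  have X_class: "rearr u u' \<Longrightarrow> u' \<in> ?X \<and> wt (erase u') = wt (erase u)" if "u \<in> ?X" for u u'
  proof (induction rule: rtranclp_induct)
    case (step v w)
    have "swap1 (erase v) (erase w)" unfolding erase_def relabel_def by (rule swap1_tsubst[OF step(2)])
    with step(3) have "erase w \<in> S \<and> wt (erase w) = wt (erase v)"
      using closed[of "erase v" "erase w"] by (simp add: labellings_def)
    moreover have "w \<in> tree_monomials n"
      using step(3) rearr_leaves[OF r_into_rtranclp, OF step(2)] swap1_invariants(3)[OF step(2)]
      by (simp add: labellings_def tree_monomials_def)
    ultimately show ?case using step(3) by (simp add: labellings_def)
  qed (use that in simp)
  \<comment> \<open>Along a class, \<epsilon> and \<open>orient\<close> change by the same sign. So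
    the antisymmetrization of \<open>u\<close>, scaled by \<open>\<epsilon> u\<close>, is the part
    of the full sum that lives on the class of \<open>u\<close>.\<close>
  have \<epsilon>_class: "\<epsilon> u * of_int (orient u * orient u') = \<epsilon> u'" if u: "u \<in> ?X" and r: "rearr u u'" for u u'
  proof -
    have "well_formed u" "distinct (leaves u)" "good u"
      using u S good_relabel[of "\<lambda>_. 1" u]
      by (auto simp: labellings_def tree_monomials_def erase_def)
    note * = tsign_good_rearr[OF r this]
    have "tsign cweight u * isgn lweight (leaves u) * (orient u * orient u') =
      tsign cweight u' * isgn lweight (leaves u') * (orient u' * orient u')"
      using * by (metis mult.assoc)
    then have "tsign cweight u * isgn lweight (leaves u) * (orient u * orient u') =
      tsign cweight u' * isgn lweight (leaves u')" by simp
    then show ?thesis using X_class[OF u r] unfolding \<epsilon>_def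
      by (metis mult.assoc of_int_mult)
  qed
  have "lin alternate (\<Sum>T\<in>S. smul (wt T * of_int (tsign cweight T)) (shuffle_sum (number 1 T))) =
    (\<Sum>T\<in>S. \<Sum>\<sigma>\<in>?P. smul (of_int (sign \<sigma>) * (wt T * of_int (tsign cweight T)))
      (if shuffle_tree (tact \<sigma> (number 1 T)) then alternate (tact \<sigma> (number 1 T)) else 0))"
    unfolding lin_sum lin_smul shuffle_sum_def lin_monomial smul_sum smul_smul
  proof (rule sum.cong[OF refl])
    fix T assume "T \<in> S"
    have "{\<sigma>. \<sigma> permutes {1..length (leaves (number 1 T))} \<and> shuffle_tree (tact \<sigma> (number 1 T))} =
      {\<sigma> \<in> ?P. shuffle_tree (tact \<sigma> (number 1 T))}" using len[OF \<open>T \<in> S\<close>] by simp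
    then show "(\<Sum>\<sigma> | \<sigma> permutes {1..length (leaves (number 1 T))} \<and> shuffle_tree (tact \<sigma> (number 1 T)).
        smul (wt T * of_int (tsign cweight T) * of_int (sign \<sigma>)) (alternate (tact \<sigma> (number 1 T)))) =
      (\<Sum>\<sigma>\<in>?P. smul (of_int (sign \<sigma>) * (wt T * of_int (tsign cweight T)))
      (if shuffle_tree (tact \<sigma> (number 1 T)) then alternate (tact \<sigma> (number 1 T)) else 0))"
      using finP by (simp only: sum.inter_filter if_distrib[of "smul _"] smul_zero mult.commute)
  qed
  also have "\<dots> = (\<Sum>u\<in>?X. smul (\<epsilon> u) (if shuffle_tree u then alternate u else 0))"
    by (rule sum_X[where F = "\<lambda>u. if shuffle_tree u then alternate u else 0"])
  also have "\<dots> = (\<Sum>u\<in>?Y. smul (\<epsilon> u) (alternate u))"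
    using finX by (simp only: sum.inter_filter if_distrib[of "smul _"] smul_zero)
  also have "\<dots> = (\<Sum>u\<in>?Y. \<Sum>u'\<in>rclass u. smul (\<epsilon> u') (monomial u'))"
    unfolding alternate_def smul_sum smul_smul
    by (intro sum.cong refl) (simp add: rclass_def \<epsilon>_class del: of_int_mult)
  also have "\<dots> = (\<Sum>u\<in>(\<Union>u\<in>?Y. rclass u). smul (\<epsilon> u) (monomial u))"
  proof (rule sum.UNION_disjoint[symmetric])
    show "finite ?Y" using finX by simp
    show "\<forall>u\<in>?Y. finite (rclass u)" using finite_rclass by blast
    show "\<forall>u\<in>?Y. \<forall>v\<in>?Y. u \<noteq> v \<longrightarrow> rclass u \<inter> rclass v = {}"
    proof (intro ballI impI, rule ccontr)
      fix u v assume uv: "u \<in> ?Y" "v \<in> ?Y" "u \<noteq> v" "rclass u \<inter> rclass v \<noteq> {}"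
      then obtain w where "rearr u w" "rearr v w" by (auto simp: rclass_def)
      then have "rearr u v" using rearr_sym rtranclp_trans by metis
      then have "u = v" using uv(1,2) by (intro shuffle_unique) simp_all
      with uv(3) show False by contradiction
    qed
  qed
  also have "(\<Union>u\<in>?Y. rclass u) = ?X"
  proof (intro equalityI subsetI)
    fix w assume "w \<in> (\<Union>u\<in>?Y. rclass u)"
    then show "w \<in> ?X" using X_class by (auto simp: rclass_def)
  next
    fix w assume w: "w \<in> ?X"
    then have "well_formed w" "distinct (leaves w)" by (simp_all add: labellings_def tree_monomials_def)
    then obtain u where u: "rearr w u" "shuffle_tree u" using shuffle_exists by blast
    then have "u \<in> ?Y" using X_class[OF w] by simp
    moreover have "w \<in> rclass u" using rearr_sym[OF u(1)] by (simp add: rclass_def)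
    ultimately show "w \<in> (\<Union>u\<in>?Y. rclass u)" by blast
  qed
  also have "(\<Sum>u\<in>?X. smul (\<epsilon> u) (monomial u)) = (\<Sum>T\<in>S. \<Sum>\<sigma>\<in>?P.
      smul (of_int (sign \<sigma>) * (wt T * of_int (tsign cweight T))) (monomial (tact \<sigma> (number 1 T))))"
    by (rule sum_X[symmetric])
  also have "\<dots> = (\<Sum>\<sigma>\<in>?P. smul (of_int (sign \<sigma>)) (lin (\<lambda>m. monomial (tact \<sigma> m))
      (\<Sum>T\<in>S. smul (wt T * of_int (tsign cweight T)) (monomial (number 1 T)))))"
    unfolding lin_sum lin_smul lin_monomial smul_sum smul_smul by (rule sum.swap)
  finally show ?thesis .
qed

section \<open>Shapes of the terms of the differential\<close>

definition blank :: "rb_gen \<Rightarrow> tree" where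
  "blank g = Node g (replicate (arity g) (Leaf 1))"

lemma erase_corolla: "erase (corolla g) = blank g"
  by (simp add: corolla_eq blank_def comp_def map_replicate_const del: upt_Suc)

lemma blank_facts [simp]:
  "leaves (blank g) = replicate (arity g) 1" "tdeg (blank g) = gdeg g" "erase (blank g) = blank g"
  "tsign cweight (blank g) = 1" "good (blank g)" "well_formed (blank g) = is_gen g" "blank g \<noteq> Leaf i"
proof -
  have "concat (map leaves (replicate k (Leaf 1))) = replicate k 1" for k by (induction k) simp_all
  then show "leaves (blank g) = replicate (arity g) 1" by (simp only: blank_def leaves.simps)
  show "tdeg (blank g) = gdeg g" by (simp add: blank_def sum_list_replicate)
  show "erase (blank g) = blank g" by (simp add: blank_def)
  have "isgn cweight (replicate k (Leaf 1)) = 1" for k by (rule isgn_eq_one) (simp add: cweight_def)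
  then show "tsign cweight (blank g) = 1" by (simp add: blank_def)
  have "sorted_wrt pair_ok (replicate k (Leaf 1))" for k
    by (induction k) (simp_all add: pair_ok_def)
  then show "good (blank g)" by (simp add: blank_def)
  show "well_formed (blank g) = is_gen g" by (simp add: blank_def)
  show "blank g \<noteq> Leaf i" by (simp add: blank_def)
qed

lemma blank_inject [simp]: "blank g = blank h \<longleftrightarrow> g = h"
  by (auto simp: blank_def)

lemma graft_number:
  "graft g kbs = number 1 (Node g
     (map (\<lambda>c. case map_of kbs c of None \<Rightarrow> Leaf 1 | Some b \<Rightarrow> erase b) [1..<arity g + 1]))"
proof -
  have "map erase (map (\<lambda>c. case map_of kbs c of None \<Rightarrow> Leaf 1 | Some b \<Rightarrow> b) [1..<arity g + 1]) =
    map (\<lambda>c. case map_of kbs c of None \<Rightarrow> Leaf 1 | Some b \<Rightarrow> erase b) [1..<arity g + 1]"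
    unfolding map_map by (intro map_cong refl) (simp split: option.split)
  then show ?thesis unfolding graft_def
    using number_erase(1)[of 1 "Node g (map (\<lambda>c. case map_of kbs c of None \<Rightarrow> Leaf 1 | Some b \<Rightarrow> b) [1..<arity g + 1])"]
    by (simp only: erase_simps)
qed

definition one_at :: "nat \<Rightarrow> nat \<Rightarrow> tree \<Rightarrow> tree list" where
  "one_at m i X = replicate (i - 1) (Leaf 1) @ X # replicate (m - i) (Leaf 1)"

lemma graft_single:
  assumes "i \<in> {1..arity g}"
  shows "graft g [(i, b)] = number 1 (Node g (one_at (arity g) i (erase b)))"
proof -
  have "map (\<lambda>c. case map_of [(i, b)] c of None \<Rightarrow> Leaf 1 | Some b \<Rightarrow> erase b) [1..<arity g + 1] =
    one_at (arity g) i (erase b)"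
  proof (rule nth_equalityI)
    fix n assume "n < length (map (\<lambda>c. case map_of [(i, b)] c of None \<Rightarrow> Leaf 1 | Some b \<Rightarrow> erase b) [1..<arity g + 1])"
    then have n: "n < arity g" by (simp del: upt_Suc)
    then show "map (\<lambda>c. case map_of [(i, b)] c of None \<Rightarrow> Leaf 1 | Some b \<Rightarrow> erase b) [1..<arity g + 1] ! n =
       one_at (arity g) i (erase b) ! n"
      using assms by (auto simp: one_at_def nth_append nth_Cons' simp del: upt_Suc)
  qed (use assms in \<open>auto simp: one_at_def\<close>)
  then show ?thesis unfolding graft_number by simp
qed

lemma mset_one_at:
  assumes "i \<in> {1..m}"
  shows "mset (one_at m i X) = add_mset X (replicate_mset (m - 1) (Leaf 1))"
proof -
  have "m - 1 = (i - 1) + (m - i)" using assms by auto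
  then have "replicate_mset (m - 1) (Leaf 1) = replicate_mset (i - 1) (Leaf 1) + replicate_mset (m - i) (Leaf 1)"
    by (metis repeat_mset_distrib2 repeat_mset_replicate_mset mult.right_neutral repeat_mset_distrib)
  then show ?thesis by (simp add: one_at_def)
qed

lemma length_one_at: "i \<in> {1..m} \<Longrightarrow> length (one_at m i X) = m"
  by (auto simp: one_at_def)

lemma mset_eq_one_at:
  assumes "mset ts = add_mset X (replicate_mset k (Leaf 1))"
  obtains i where "i \<in> {1..k + 1}" "ts = one_at (k + 1) i X"
proof -
  have "X \<in> set ts" using assms by (metis set_mset_mset union_single_eq_member)
  then obtain as bs where ts: "ts = as @ X # bs" by (meson split_list)
  then have ms: "mset as + mset bs = replicate_mset k (Leaf 1)" using assms by simp
  have "set as \<union> set bs \<subseteq> {Leaf 1}"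
    using arg_cong[OF ms, of set_mset] by (auto split: if_splits)
  then have "as = replicate (length as) (Leaf 1)" "bs = replicate (length bs) (Leaf 1)"
    by (auto intro!: replicate_eqI)
  moreover have "length as + length bs = k" using arg_cong[OF ms, of size] by simp
  ultimately have "ts = one_at (k + 1) (length as + 1) X" "length as + 1 \<in> {1..k + 1}"
    unfolding one_at_def ts by auto
  then show thesis using that by blast
qed

text \<open>The position can be read off as the number of leading leaves, since neither
  \<open>X\<close> nor \<open>Y\<close> is \<open>Leaf 1\<close>.\<close>

lemma one_at_inject:
  assumes "one_at m i X = one_at m j Y" "X \<noteq> Leaf 1" "Y \<noteq> Leaf 1" "1 \<le> i" "1 \<le> j"
  shows "i = j \<and> X = Y"
proof -
  have "takeWhile (\<lambda>t. t = Leaf 1) (one_at m i X) = replicate (i - 1) (Leaf 1)" if "X \<noteq> Leaf 1" for i X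
  proof -
    have "takeWhile (\<lambda>t. t = Leaf 1) (replicate k (Leaf 1) @ X # ys) = replicate k (Leaf 1)" for k ys
      using that by (induction k) simp_all
    then show ?thesis unfolding one_at_def .
  qed
  then have "replicate (i - 1) (Leaf 1) = replicate (j - 1) (Leaf 1)" using assms(1-3) by metis
  then have "length (replicate (i - 1) (Leaf 1)) = length (replicate (j - 1) (Leaf 1))" by (rule arg_cong)
  then have "i = j" using assms(4,5) by simp
  then show ?thesis using assms(1) by (simp add: one_at_def)
qed

lemma isgn_one_at: "isgn cweight (one_at m i X) = (-1) ^ ((m - i) * (length (leaves X) - 1))"
proof -
  have rep: "isgn cweight (replicate k (Leaf 1)) = 1" for k by (rule isgn_eq_one) (simp add: cweight_def)
  have zero: "cross cweight (replicate k (Leaf 1)) ys = 0" for k ys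
  proof -
    have "cross cweight (replicate k (Leaf 1)) ys = cross (\<lambda>_ _. 0) (replicate k (Leaf 1 :: tree)) ys"
      by (rule cross_cong) (simp add: cweight_def)
    then show ?thesis by (simp add: cross_def)
  qed
  have sl: "sum_list (map (cweight X) (replicate (m - i) (Leaf 1))) = (m - i) * (length (leaves X) - 1)"
    by (simp add: cweight_def sum_list_replicate)
  show ?thesis unfolding one_at_def isgn_append isgn.simps rep zero sl by simp
qed

lemma tsign_one_at:
  "tsign cweight (Node g (one_at m i X)) = (-1) ^ ((m - i) * (length (leaves X) - 1)) * tsign cweight X"
  unfolding tsign.simps isgn_one_at by (simp add: one_at_def)

lemma good_one_at:
  assumes "good X" "leaves X \<noteq> []"
  shows "good (Node g (one_at m i X))"
proof -
  have leaf: "pair_ok (Leaf i) X" "pair_ok X (Leaf i)" "pair_ok (Leaf i) (Leaf i)" for i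
    using assms(2) by (auto simp: pair_ok_def Suc_le_eq)
  have "sorted_wrt pair_ok (replicate k (Leaf 1))" for k
    by (induction k) (simp_all add: leaf)
  then show ?thesis using assms(1) leaf by (auto simp: one_at_def sorted_wrt_append)
qed

fun is_leaf :: "tree \<Rightarrow> bool" where
  "is_leaf (Leaf i) = True"
| "is_leaf (Node g ts) = False"

fun leafkids :: "tree \<Rightarrow> nat" where
  "leafkids (Leaf i) = 0"
| "leafkids (Node g ts) = length (filter is_leaf ts)"

text \<open>What remains of each coefficient after \<open>tsign cweight\<close> is taken out. It
  uses only data unchanged by rearrangement: the generator at the root and a number of free inputs.
  In the last sum of the differential, \<open>q - 1\<close> of the \<open>p\<close> inputs are
  occupied and \<open>p - q + 1\<close> are free, whence the \<open>- 1\<close> in the exponent of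
  \<open>lam\<close>.\<close>

fun coef :: "'k::comm_ring_1 \<Rightarrow> rb_gen \<Rightarrow> tree \<Rightarrow> 'k" where
  "coef lam (Op n) (Node h ts) = (-1) ^ arity h"
| "coef lam (RB n) (Node (Op k) ts) = -1"
| "coef lam (RB n) (Node (RB r) ts) = (-1) ^ (1 + r) * lam ^ (sum_list (map leafkids ts) - 1)"
| "coef lam g (Leaf i) = 0"

text \<open>The children of the root are prescribed only as a multiset, leaving the position of the
  grafted vertex open; this makes the closure under rearrangement visible.\<close>

definition shapes_op :: "nat \<Rightarrow> tree set" where
  "shapes_op n = {T. is_shape n T \<and> (\<exists>m j ts. T = Node (Op m) ts \<and>
     mset ts = add_mset (blank (Op j)) (replicate_mset (m - 1) (Leaf 1)))}"

definition shapes_rb1 :: "nat \<Rightarrow> tree set" where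
  "shapes_rb1 n = {T. is_shape n T \<and> (\<exists>k ts. T = Node (Op k) ts \<and> (\<forall>t\<in>set ts. \<exists>l. t = blank (RB l)))}"

text \<open>\<open>Leaf 1 \<in> set us\<close> expresses \<open>q \<le> p\<close>: at most
  \<open>p - 1\<close> inputs of \<open>Op p\<close> carry a further corolla.\<close>

definition shapes_rb2 :: "nat \<Rightarrow> tree set" where
  "shapes_rb2 n = {T. is_shape n T \<and> (\<exists>r p ts us. T = Node (RB r) ts \<and>
     mset ts = add_mset (Node (Op p) us) (replicate_mset (r - 1) (Leaf 1)) \<and> Leaf 1 \<in> set us \<and>
     (\<forall>u\<in>set us. u = Leaf 1 \<or> (\<exists>l. u = blank (RB l))))}"

fun shapes :: "rb_gen \<Rightarrow> tree set" where
  "shapes (Op n) = shapes_op n"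
| "shapes (RB n) = shapes_rb1 n \<union> shapes_rb2 n"

lemma swap1_blank: "swap1 (blank g) v \<Longrightarrow> v = blank g"
  unfolding blank_def
proof (erule swap1_NodeD)
  fix as x y bs assume *: "replicate (arity g) (Leaf 1) = as @ x # y # bs" "v = Node g (as @ y # x # bs)"
  then have "x = Leaf 1" "y = Leaf 1" by (metis in_set_conv_decomp in_set_replicate append_Cons append_Nil append_assoc)+
  then show "v = Node g (replicate (arity g) (Leaf 1))" using * by simp
next
  fix as t bs u assume *: "replicate (arity g) (Leaf 1) = as @ t # bs" "swap1 t u"
  then have "t = Leaf 1" by (metis in_set_conv_decomp in_set_replicate)
  then show "v = Node g (replicate (arity g) (Leaf 1))" using * swap1_LeafD by blast
qed

text \<open>Moves above the root act on leaves or unlabelled corollas and change nothing, so only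
  permutations of the children remain.\<close>

lemma swap1_flat:
  assumes "swap1 (Node g us) v" "\<And>u. u \<in> set us \<Longrightarrow> u = Leaf 1 \<or> (\<exists>h. u = blank h)"
  obtains us' where "v = Node g us'" "mset us' = mset us"
  using assms(1)
proof (cases rule: swap1_NodeD)
  case (1 as x y bs)
  then have "mset (as @ y # x # bs) = mset us" by (simp add: add_mset_commute)
  then show ?thesis using that 1 by blast
next
  case (2 as t bs u)
  then have "t = Leaf 1 \<or> (\<exists>h. t = blank h)" using assms(2)[of t] by simp
  then have "u = t" using 2(2) swap1_LeafD swap1_blank by blast
  then show ?thesis using that 2 by blast
qed

lemma leafkids_swap1: "swap1 t t' \<Longrightarrow> leafkids t' = leafkids t"
proof (induction rule: swap1.induct)
  case (cong t t' g as bs)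
  have "is_leaf t' = is_leaf t" using cong.hyps by (cases rule: swap1.cases) simp_all
  then show ?case by simp
qed simp

lemma coef_swap1:
  assumes "swap1 t t'"
  shows "coef lam g t' = coef lam g t"
  using assms
proof (cases rule: swap1.cases)
  case (swap h as x y bs)
  then show ?thesis by (cases g; cases h) (simp_all add: add.left_commute)
next
  case (cong u u' h as bs)
  then show ?thesis using leafkids_swap1[OF cong(3)] by (cases g; cases h) simp_all
qed

lemma is_shape_swap1:
  assumes "is_shape n T" "swap1 T T'"
  shows "is_shape n T'"
proof -
  have "well_formed T'" "length (leaves T') = n"
    using assms swap1_invariants(3)[OF assms(2)] mset_eq_length[OF swap1_invariants(1)[OF assms(2)]]
    by (simp_all add: is_shape_def)
  moreover have "set (leaves T') = set (leaves T)"
    using swap1_invariants(1)[OF assms(2)] by (rule mset_eq_setD)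
  moreover have "set (leaves T) \<subseteq> {1}"
  proof -
    have "relabel (\<lambda>_. 1) T = T" using assms(1) by (simp only: is_shape_def erase_def)
    then have "leaves (relabel (\<lambda>_. 1) T) = leaves T" by (rule arg_cong)
    then have "leaves T = map (\<lambda>_. 1) (leaves T)" unfolding leaves_relabel by (rule sym)
    then show ?thesis by (metis (no_types, lifting) imageE list.set_map singletonI subsetI)
  qed
  ultimately show ?thesis unfolding is_shape_def erase_def by (auto intro!: relabel_id)
qed

lemma shapes_closed:
  assumes "T \<in> shapes g" "swap1 T T'"
  shows "T' \<in> shapes g \<and> coef lam g T' = coef lam g T"
proof -
  have op: "T' \<in> shapes_op n" if "T \<in> shapes_op n" for n
  proof -
    from that obtain m j ts where T: "T = Node (Op m) ts"
      "mset ts = add_mset (blank (Op j)) (replicate_mset (m - 1) (Leaf 1))"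
      and sh: "is_shape n T" unfolding shapes_op_def by blast
    have "set ts \<subseteq> insert (blank (Op j)) {Leaf 1}"
      using arg_cong[OF T(2), of set_mset] by (auto split: if_splits)
    then have "\<And>u. u \<in> set ts \<Longrightarrow> u = Leaf 1 \<or> (\<exists>h. u = blank h)" by blast
    with assms(2)[unfolded T(1)] obtain us' where "T' = Node (Op m) us'" "mset us' = mset ts"
      by (rule swap1_flat)
    then show ?thesis using is_shape_swap1[OF sh assms(2)] T(2) unfolding shapes_op_def by simp
  qed
  have rb1: "T' \<in> shapes_rb1 n" if "T \<in> shapes_rb1 n" for n
  proof -
    from that obtain k ts where T: "T = Node (Op k) ts" "\<forall>t\<in>set ts. \<exists>l. t = blank (RB l)"
      and sh: "is_shape n T" unfolding shapes_rb1_def by blast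
    have "\<And>u. u \<in> set ts \<Longrightarrow> u = Leaf 1 \<or> (\<exists>h. u = blank h)" using T(2) by blast
    with assms(2)[unfolded T(1)] obtain us' where "T' = Node (Op k) us'" "mset us' = mset ts"
      by (rule swap1_flat)
    then show ?thesis using is_shape_swap1[OF sh assms(2)] T(2) mset_eq_setD[of us' ts]
      unfolding shapes_rb1_def by simp
  qed
  have rb2: "T' \<in> shapes_rb2 n" if "T \<in> shapes_rb2 n" for n
  proof -
    from that obtain r p ts us where T: "T = Node (RB r) ts"
      "mset ts = add_mset (Node (Op p) us) (replicate_mset (r - 1) (Leaf 1))" "Leaf 1 \<in> set us"
      "\<forall>u\<in>set us. u = Leaf 1 \<or> (\<exists>l. u = blank (RB l))"
      and sh: "is_shape n T" unfolding shapes_rb2_def by blast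
    note sh' = is_shape_swap1[OF sh assms(2)]
    from assms(2)[unfolded T(1)] show ?thesis
    proof (cases rule: swap1_NodeD)
      case (1 as x y bs)
      then have "mset (as @ y # x # bs) = mset ts" by (simp add: add_mset_commute)
      then have "mset (as @ y # x # bs) = add_mset (Node (Op p) us) (replicate_mset (r - 1) (Leaf 1))"
        unfolding T(2) .
      then show ?thesis using sh' T(3,4) 1(2) unfolding shapes_rb2_def by blast
    next
      case (2 as t bs v)
      have "t \<in># mset ts" using 2 by simp
      then have "t = Leaf 1 \<or> t = Node (Op p) us" unfolding T(2) by (auto split: if_splits)
      then have t: "t = Node (Op p) us" using 2(2) swap1_LeafD by blast
      have "\<And>u. u \<in> set us \<Longrightarrow> u = Leaf 1 \<or> (\<exists>h. u = blank h)" using T(4) by blast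
      with 2(2)[unfolded t] obtain us' where v: "v = Node (Op p) us'" "mset us' = mset us"
        by (rule swap1_flat)
      have "mset (as @ v # bs) = add_mset (Node (Op p) us') (replicate_mset (r - 1) (Leaf 1))"
        using T(2) unfolding 2(1) t v(1) by simp
      moreover have "set us' = set us" using v(2) by (rule mset_eq_setD)
      ultimately have "mset (as @ v # bs) = add_mset (Node (Op p) us') (replicate_mset (r - 1) (Leaf 1)) \<and>
          Leaf 1 \<in> set us' \<and> (\<forall>u\<in>set us'. u = Leaf 1 \<or> (\<exists>l. u = blank (RB l)))"
        using T(3,4) by (simp only:)
      then show ?thesis using sh' 2(3) unfolding shapes_rb2_def by blast
    qed
  qed
  show ?thesis using assms(1) op rb1 rb2 coef_swap1[OF assms(2)] by (cases g) auto
qed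

text \<open>\<open>RB l\<close> has degree \<open>l - 1\<close>. With \<open>l = Suc a\<close> and
  \<open>k = Suc b\<close> the exponent becomes \<open>2 * (a * b + a + b + 1)\<close>.\<close>

lemma pair_ok_blank_RB: "1 \<le> l \<Longrightarrow> 1 \<le> k \<Longrightarrow> pair_ok (blank (RB l)) (blank (RB k))"
proof -
  assume "1 \<le> l" "1 \<le> k"
  then obtain a b where "l = Suc a" "k = Suc b" by (metis Suc_le_D One_nat_def)
  moreover have "Suc a * Suc b + a + b + 1 + a * b = 2 * (a * b + a + b + 1)" by simp
  then have "even (Suc a * Suc b + a + b + 1 + a * b)" by (metis dvd_triv_left)
  ultimately show ?thesis by (simp only: pair_ok_def blank_facts length_replicate arity.simps gdeg.simps diff_Suc_1)
qed

lemma pair_ok_Leaf: "leaves x \<noteq> [] \<Longrightarrow> pair_ok x (Leaf i) \<and> pair_ok (Leaf i) x"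
  by (auto simp: pair_ok_def Suc_le_eq)

lemma good_RB_list:
  assumes "\<And>u. u \<in> set us \<Longrightarrow> u = Leaf 1 \<or> (\<exists>l. u = blank (RB l))" "\<And>u. u \<in> set us \<Longrightarrow> well_formed u"
  shows "good (Node g us)"
proof -
  have form: "u = Leaf 1 \<or> (\<exists>l\<ge>1. u = blank (RB l))" if "u \<in> set us" for u
    using assms(1)[OF that] assms(2)[OF that] by auto
  have "pair_ok u v" if "u \<in> set us" "v \<in> set us" for u v
    using form[OF that(1)] form[OF that(2)] pair_ok_blank_RB
      pair_ok_Leaf[OF leaves_nonempty[OF assms(2)[OF that(1)]]]
      pair_ok_Leaf[OF leaves_nonempty[OF assms(2)[OF that(2)]]] by blast
  then have "sorted_wrt pair_ok us" by (induction us) simp_all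
  moreover have "good u" if "u \<in> set us" for u using form[OF that] by auto
  ultimately show ?thesis by simp
qed

text \<open>The condition is not automatic: two siblings \<open>blank (Op 2)\<close> would give the
  odd exponent 7. In the terms of the differential, however, a vertex has at most one child that is
  not a leaf, or all such children are corollas \<open>RB l\<close>.\<close>

lemma good_shapes:
  assumes "T \<in> shapes g"
  shows "good T"
proof -
  have op: "good T" if "T \<in> shapes_op n" for n
  proof -
    from that obtain m j ts where T: "T = Node (Op m) ts"
      "mset ts = add_mset (blank (Op j)) (replicate_mset (m - 1) (Leaf 1))"
      and sh: "is_shape n T" unfolding shapes_op_def by blast
    from T(2) obtain i where ts: "ts = one_at (m - 1 + 1) i (blank (Op j))" by (rule mset_eq_one_at)
    have "blank (Op j) \<in> set ts" unfolding ts by (simp add: one_at_def)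
    moreover have "\<forall>t\<in>set ts. well_formed t" using sh unfolding is_shape_def T(1) by simp
    ultimately have "well_formed (blank (Op j))" by blast
    then show ?thesis unfolding T(1) ts by (intro good_one_at leaves_nonempty) simp
  qed
  have rb1: "good T" if "T \<in> shapes_rb1 n" for n
  proof -
    from that obtain k ts where T: "T = Node (Op k) ts" "\<forall>t\<in>set ts. \<exists>l. t = blank (RB l)"
      and sh: "is_shape n T" unfolding shapes_rb1_def by blast
    show ?thesis unfolding T(1) using T(2) sh unfolding is_shape_def T(1) by (intro good_RB_list) auto
  qed
  have rb2: "good T" if "T \<in> shapes_rb2 n" for n
  proof -
    from that obtain r p ts us where T: "T = Node (RB r) ts"
      "mset ts = add_mset (Node (Op p) us) (replicate_mset (r - 1) (Leaf 1))" "Leaf 1 \<in> set us"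
      "\<forall>u\<in>set us. u = Leaf 1 \<or> (\<exists>l. u = blank (RB l))"
      and sh: "is_shape n T" unfolding shapes_rb2_def by blast
    from T(2) obtain i where ts: "ts = one_at (r - 1 + 1) i (Node (Op p) us)" by (rule mset_eq_one_at)
    have "Node (Op p) us \<in> set ts" unfolding ts by (simp add: one_at_def)
    moreover have "\<forall>t\<in>set ts. well_formed t" using sh unfolding is_shape_def T(1) by simp
    ultimately have wf: "well_formed (Node (Op p) us)" by blast
    have "good (Node (Op p) us)"
      by (rule good_RB_list) (use T(4) wf in auto)
    then show ?thesis unfolding T(1) ts using leaves_nonempty[OF wf] by (rule good_one_at)
  qed
  show ?thesis using assms op rb1 rb2 by (cases g) auto
qed

lemma length_leaves_Node: "length (leaves (Node g ts)) = (\<Sum>t\<leftarrow>ts. length (leaves t))"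
  by (simp add: length_concat comp_def)

lemma length_leaves_one_at:
  assumes "i \<in> {1..m}"
  shows "length (leaves (Node g (one_at m i X))) = m - 1 + length (leaves X)"
  using assms unfolding length_leaves_Node by (auto simp: one_at_def sum_list_replicate)

lemma erase_one_at: "map erase (one_at m i X) = one_at m i (erase X)"
  by (simp add: one_at_def)

lemma set_one_at: "set (one_at m i X) \<subseteq> {Leaf 1, X}" "X \<in> set (one_at m i X)"
  by (auto simp: one_at_def)

lemma is_shape_one_at:
  assumes "is_gen g" "arity g = m" "i \<in> {1..m}" "well_formed X" "erase X = X"
    "m + length (leaves X) = n + 1"
  shows "is_shape n (Node g (one_at m i X))"
proof -
  have "well_formed (Node g (one_at m i X))"
    using assms length_one_at[OF assms(3)] set_one_at(1)[of m i X] by auto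
  moreover have "length (leaves (Node g (one_at m i X))) = n"
    unfolding length_leaves_one_at[OF assms(3)] using assms(3,6) by auto
  ultimately show ?thesis using assms(5) unfolding is_shape_def by (simp only: erase_simps erase_one_at)
qed

lemma is_shape_one_atD:
  assumes "is_shape n (Node g (one_at m i X))" "i \<in> {1..m}"
  shows "is_gen g" "arity g = m" "well_formed X" "m + length (leaves X) = n + 1"
proof -
  from assms(1) have *: "well_formed (Node g (one_at m i X))" "length (leaves (Node g (one_at m i X))) = n"
    by (simp_all only: is_shape_def)
  from *(1) show "is_gen g" "arity g = m" "well_formed X"
    using length_one_at[OF assms(2), of X] set_one_at(2)[of X m i] unfolding well_formed.simps by auto
  from *(2) show "m + length (leaves X) = n + 1"
    unfolding length_leaves_one_at[OF assms(2)] using assms(2) by auto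
qed

section \<open>The differential of \<open>Op n\<close>\<close>

lemma bij_betw_shapes_op:
  "bij_betw (\<lambda>(j, i). Node (Op (n - j + 1)) (one_at (n - j + 1) i (blank (Op j))))
    (SIGMA j:{2..n-1}. {1..n-j+1}) (shapes_op n)"
  unfolding bij_betw_def
proof
  let ?f = "\<lambda>(j, i). Node (Op (n - j + 1)) (one_at (n - j + 1) i (blank (Op j)))"
  show "inj_on ?f (SIGMA j:{2..n-1}. {1..n-j+1})"
  proof (rule inj_onI)
    fix x y assume xy: "x \<in> (SIGMA j:{2..n-1}. {1..n-j+1})" "y \<in> (SIGMA j:{2..n-1}. {1..n-j+1})" "?f x = ?f y"
    obtain j i j' i' where x: "x = (j, i)" and y: "y = (j', i')" by (cases x; cases y) blast
    have *: "j \<in> {2..n-1}" "i \<in> {1..n-j+1}" "j' \<in> {2..n-1}" "i' \<in> {1..n-j'+1}"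
      "Op (n - j + 1) = Op (n - j' + 1)"
      "one_at (n - j + 1) i (blank (Op j)) = one_at (n - j' + 1) i' (blank (Op j'))"
      using xy unfolding x y by (simp_all only: case_prod_conv tree.inject mem_Sigma_iff)
    have "n - j + 1 = n - j' + 1" using *(5) by simp
    then have "j = j'" using *(1,3) by auto
    moreover have "i = i'"
      using one_at_inject[OF *(6)[folded \<open>j = j'\<close>]] *(2,4) by simp
    ultimately show "x = y" using x y by simp
  qed
  show "?f ` (SIGMA j:{2..n-1}. {1..n-j+1}) = shapes_op n"
  proof (intro equalityI subsetI)
    fix T assume "T \<in> ?f ` (SIGMA j:{2..n-1}. {1..n-j+1})"
    then obtain j i where j: "j \<in> {2..n-1}" and i: "i \<in> {1..n-j+1}"
      and T: "T = Node (Op (n - j + 1)) (one_at (n - j + 1) i (blank (Op j)))" by auto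
    have "is_shape n T" unfolding T using j i by (intro is_shape_one_at) auto
    then show "T \<in> shapes_op n" unfolding shapes_op_def using T mset_one_at[OF i] by blast
  next
    fix T assume "T \<in> shapes_op n"
    then obtain m j ts where T: "T = Node (Op m) ts"
      "mset ts = add_mset (blank (Op j)) (replicate_mset (m - 1) (Leaf 1))"
      and sh: "is_shape n T" unfolding shapes_op_def by blast
    from T(2) obtain i where i: "i \<in> {1..m - 1 + 1}" and ts: "ts = one_at (m - 1 + 1) i (blank (Op j))"
      by (rule mset_eq_one_at)
    note D = is_shape_one_atD[OF sh[unfolded T(1) ts] i]
    have m: "m - 1 + 1 = m" "2 \<le> m" "2 \<le> j" "m + j = n + 1" using D by simp_all
    then have "m = n - j + 1" "j \<in> {2..n-1}" by auto
    moreover have "i \<in> {1..m}" "T = Node (Op m) (one_at m i (blank (Op j)))" using i ts T(1) m(1) by simp_all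
    ultimately show "T \<in> ?f ` (SIGMA j:{2..n-1}. {1..n-j+1})"
      by (intro image_eqI[of _ _ "(j, i)"]) simp_all
  qed
qed


lemma diff_gen_op:
  fixes E :: "tree \<Rightarrow> (tree \<Rightarrow>\<^sub>0 'k::comm_ring_1)"
  shows "diff_gen E lam (Op n) =
    (\<Sum>T\<in>shapes_op n. smul (coef lam (Op n) T * of_int (tsign cweight T)) (E (number 1 T)))"
proof -
  let ?F = "\<lambda>T. smul (coef lam (Op n) T * of_int (tsign cweight T)) (E (number 1 T))"
  have "diff_gen E lam (Op n) = (\<Sum>j\<in>{2..n-1}. \<Sum>i\<in>{1..n-j+1}.
     ?F (Node (Op (n - j + 1)) (one_at (n - j + 1) i (blank (Op j)))))"
    unfolding diff_gen.simps
  proof (intro sum.cong refl)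
    fix j i assume j: "j \<in> {2..n-1}" and i: "i \<in> {1..n-j+1}"
    let ?m = "n - j + 1"
    have "graft (Op ?m) [(i, corolla (Op j))] = number 1 (Node (Op ?m) (one_at ?m i (blank (Op j))))"
      using graft_single[of i "Op ?m" "corolla (Op j)"] i by (simp add: erase_corolla)
    moreover have "coef lam (Op n) (Node (Op ?m) (one_at ?m i (blank (Op j)))) *
        of_int (tsign cweight (Node (Op ?m) (one_at ?m i (blank (Op j))))) = (-1) ^ (i + j * (n - i))"
    proof -
      obtain a where a: "?m = i + a" using i le_Suc_ex[of i ?m] by auto
      obtain b where b: "j = Suc b" using j by (cases j) auto
      have n: "n = a + b + i" using a b j by auto
      have "coef lam (Op n) (Node (Op ?m) (one_at ?m i (blank (Op j)))) *
        of_int (tsign cweight (Node (Op ?m) (one_at ?m i (blank (Op j))))) = (-1) ^ (?m + a * b)"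
        unfolding tsign_one_at using a b by (simp add: power_add)
      also have "\<dots> = (-1) ^ (i + j * (n - i))"
      proof (rule neg_one_power_eq)
        \<comment> \<open>Here \<open>a\<close> counts the inputs to the right of \<open>i\<close>,
          and \<open>b = j - 1\<close>. The two exponents differ modulo 2 by
          \<open>b * (b + 1)\<close>, a product of consecutive numbers.\<close>
        have "?m + a * b + (i + j * (n - i)) = 2 * (i + a + a * b) + b * (b + 1)"
          unfolding a by (simp add: b n algebra_simps)
        moreover have "even (2 * (i + a + a * b) + b * (b + 1))" by simp
        ultimately show "even (?m + a * b + (i + j * (n - i)))" by (simp only:)
      qed
      finally show ?thesis .
    qed
    ultimately show "smul ((-1) ^ (i + j * (n - i))) (E (graft (Op ?m) [(i, corolla (Op j))])) =
       ?F (Node (Op ?m) (one_at ?m i (blank (Op j))))" by (simp only:)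
  qed
  also have "\<dots> = (\<Sum>T\<in>shapes_op n. ?F T)"
    unfolding sum.reindex_bij_betw[OF bij_betw_shapes_op, symmetric]
    by (subst sum.Sigma) (auto simp: case_prod_unfold)
  finally show ?thesis .
qed


section \<open>The first sum in the differential of \<open>RB n\<close>\<close>

lemma length_leaves_RB_list:
  "(\<Sum>t\<leftarrow>map (\<lambda>l. blank (RB l)) ls. length (leaves t)) = sum_list ls"
  by (induction ls) simp_all

definition rb1_index :: "nat \<Rightarrow> nat \<Rightarrow> nat list set" where
  "rb1_index n k = {ls. length ls = k \<and> sum_list ls = n \<and> (\<forall>l\<in>set ls. 1 \<le> l)}"

lemma finite_rb1_index: "finite (rb1_index n k)"
proof (rule finite_subset)
  show "rb1_index n k \<subseteq> {ls. set ls \<subseteq> {..n} \<and> length ls = k}"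
    by (auto simp: rb1_index_def member_le_sum_list)
qed (rule finite_lists_length_eq, simp)

lemma bij_betw_shapes_rb1:
  "bij_betw (\<lambda>(k, ls). Node (Op k) (map (\<lambda>l. blank (RB l)) ls)) (SIGMA k:{2..n}. rb1_index n k) (shapes_rb1 n)"
  unfolding bij_betw_def
proof
  let ?c = "\<lambda>l. blank (RB l)"
  let ?f = "\<lambda>(k, ls). Node (Op k) (map ?c ls)"
  have inj: "inj ?c" by (simp add: inj_def)
  show "inj_on ?f (SIGMA k:{2..n}. rb1_index n k)"
    using inj by (auto simp: inj_on_def inj_map_eq_map)
  show "?f ` (SIGMA k:{2..n}. rb1_index n k) = shapes_rb1 n"
  proof (intro equalityI subsetI)
    fix T assume "T \<in> ?f ` (SIGMA k:{2..n}. rb1_index n k)"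
    then obtain k ls where k: "k \<in> {2..n}" and ls: "ls \<in> rb1_index n k"
      and T: "T = Node (Op k) (map ?c ls)" by auto
    have "well_formed T" using k ls unfolding T by (auto simp: rb1_index_def)
    moreover have "length (leaves T) = n"
      unfolding T length_leaves_Node length_leaves_RB_list using ls by (simp add: rb1_index_def)
    moreover have "erase T = T" unfolding T by simp
    ultimately show "T \<in> shapes_rb1 n" unfolding shapes_rb1_def is_shape_def using T by auto
  next
    fix T assume "T \<in> shapes_rb1 n"
    then obtain k ts where T: "T = Node (Op k) ts" "\<forall>t\<in>set ts. \<exists>l. t = ?c l"
      and sh: "is_shape n T" unfolding shapes_rb1_def by blast
    then obtain \<rho> where \<rho>: "\<And>t. t \<in> set ts \<Longrightarrow> t = ?c (\<rho> t)" by metis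
    let ?ls = "map \<rho> ts"
    have ts: "map ?c ?ls = ts" unfolding map_map by (rule map_idI) (simp add: \<rho>[symmetric])
    have wf: "well_formed (Node (Op k) (map ?c ?ls))" using sh T(1) ts by (simp only: is_shape_def)
    then have k: "2 \<le> k" "length ?ls = k" and ge: "\<forall>l\<in>set ?ls. 1 \<le> l" by auto
    have sum: "sum_list ?ls = n"
      using sh length_leaves_RB_list[of ?ls] unfolding is_shape_def T(1) length_leaves_Node ts by simp
    \<comment> \<open>Every part is at least 1, so there are at most \<open>n\<close> of them; this
      is the upper bound of the index \<open>k\<close>.\<close>
    have "length xs \<le> sum_list xs" if "\<forall>l\<in>set xs. 1 \<le> l" for xs :: "nat list"
      using that by (induction xs) auto
    then have "k \<le> n" using ge sum k(2) by metis
    then show "T \<in> ?f ` (SIGMA k:{2..n}. rb1_index n k)"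
      using k ge sum ts T(1) by (intro image_eqI[of _ _ "(k, ?ls)"]) (auto simp: rb1_index_def)
  qed
qed

lemma map_of_zip_upt:
  assumes "c \<in> {1..length ys}"
  shows "map_of (zip [1..<length ys + 1] ys) c = Some (ys ! (c - 1))"
proof -
  have "map_of (zip [1..<length ys + 1] ys) ([1..<length ys + 1] ! (c - 1)) = Some (ys ! (c - 1))"
    using assms by (intro map_of_zip_nth) (auto simp del: upt_Suc)
  then show ?thesis using assms by (auto simp del: upt_Suc)
qed

text \<open>The sum in \<open>alpha'\<close> is the exponent of \<open>cweight\<close> on the
  children, whose numbers of leaves are the entries of \<open>ls\<close>; the leading 1 of
  \<open>alpha'\<close> is the -1 in \<open>coef\<close>.\<close>

lemma diff_gen_rb1:
  fixes E :: "tree \<Rightarrow> (tree \<Rightarrow>\<^sub>0 'k::comm_ring_1)"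
  shows "(\<Sum>k\<in>{2..n}. \<Sum>ls\<in>{ls. length ls = k \<and> sum_list ls = n \<and> (\<forall>l\<in>set ls. 1 \<le> l)}.
       smul ((-1) ^ alpha' ls) (E (graft (Op k) (zip [1..<k+1] (map (\<lambda>l. corolla (RB l)) ls))))) =
    (\<Sum>T\<in>shapes_rb1 n. smul (coef lam (RB n) T * of_int (tsign cweight T)) (E (number 1 T)))"
proof -
  let ?c = "\<lambda>l. blank (RB l)"
  let ?F = "\<lambda>T. smul (coef lam (RB n) T * of_int (tsign cweight T)) (E (number 1 T))"
  have "(\<Sum>k\<in>{2..n}. \<Sum>ls\<in>rb1_index n k.
       smul ((-1) ^ alpha' ls) (E (graft (Op k) (zip [1..<k+1] (map (\<lambda>l. corolla (RB l)) ls))))) =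
     (\<Sum>k\<in>{2..n}. \<Sum>ls\<in>rb1_index n k. ?F (Node (Op k) (map ?c ls)))"
  proof (intro sum.cong refl)
    fix k ls assume "ls \<in> rb1_index n k"
    then have len: "length ls = k" by (simp add: rb1_index_def)
    let ?kbs = "zip [1..<k+1] (map (\<lambda>l. corolla (RB l)) ls)"
    have "map (\<lambda>c. case map_of ?kbs c of None \<Rightarrow> Leaf 1 | Some b \<Rightarrow> erase b) [1..<arity (Op k) + 1] = map ?c ls"
    proof (rule nth_equalityI)
      fix i assume "i < length (map (\<lambda>c. case map_of ?kbs c of None \<Rightarrow> Leaf 1 | Some b \<Rightarrow> erase b) [1..<arity (Op k) + 1])"
      then have i: "i < k" by (simp del: upt_Suc)
      have "map_of ?kbs (i + 1) = Some (corolla (RB (ls ! i)))"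
        using map_of_zip_upt[of "i + 1" "map (\<lambda>l. corolla (RB l)) ls"] i len by (simp del: upt_Suc)
      then show "map (\<lambda>c. case map_of ?kbs c of None \<Rightarrow> Leaf 1 | Some b \<Rightarrow> erase b) [1..<arity (Op k) + 1] ! i = map ?c ls ! i"
        using i len by (simp add: erase_corolla del: upt_Suc)
    qed (use len in simp)
    then have "graft (Op k) ?kbs = number 1 (Node (Op k) (map ?c ls))" unfolding graft_number by (simp only:)
    moreover have "coef lam (RB n) (Node (Op k) (map ?c ls)) *
       of_int (tsign cweight (Node (Op k) (map ?c ls))) = (-1) ^ alpha' ls"
    proof -
      have "isgn cweight (map ?c ls) = isgn (\<lambda>x y. x - 1) ls"
        unfolding isgn_map by (rule isgn_cong) (simp add: cweight_def)
      also have "\<dots> = (-1) ^ (\<Sum>j=1..length ls. (length ls - j) * (ls ! (j - 1) - 1))"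
        by (rule isgn_left_weight[of "\<lambda>x. x - 1"])
      finally have "tsign cweight (Node (Op k) (map ?c ls)) =
          (-1) ^ (\<Sum>j=1..length ls. (length ls - j) * (ls ! (j - 1) - 1))"
        by (simp add: comp_def map_replicate_const)
      then show ?thesis by (simp add: alpha'_def Let_def)
    qed
    ultimately show "smul ((-1) ^ alpha' ls) (E (graft (Op k) ?kbs)) = ?F (Node (Op k) (map ?c ls))"
      by (simp only:)
  qed
  also have "\<dots> = (\<Sum>T\<in>shapes_rb1 n. ?F T)"
    unfolding sum.reindex_bij_betw[OF bij_betw_shapes_rb1, symmetric]
    by (subst sum.Sigma) (auto simp: case_prod_unfold finite_rb1_index)
  finally show ?thesis unfolding rb1_index_def .
qed

section \<open>The second sum in the differential of \<open>RB n\<close>\<close>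

definition fill :: "nat \<Rightarrow> nat list \<Rightarrow> nat list \<Rightarrow> tree list" where
  "fill p ks rs = map (\<lambda>c. case map_of (zip ks rs) c of None \<Rightarrow> Leaf 1 | Some r \<Rightarrow> blank (RB r)) [1..<p+1]"

definition positions :: "nat \<Rightarrow> nat list \<Rightarrow> bool" where
  "positions p ks \<longleftrightarrow> sorted_wrt (<) ks \<and> set ks \<subseteq> {1..p}"

lemma positions_distinct: "positions p ks \<Longrightarrow> distinct ks"
  by (simp add: positions_def strict_sorted_iff)

lemma length_fill [simp]: "length (fill p ks rs) = p"
  by (simp add: fill_def del: upt_Suc)

lemma fill_nth:
  assumes "c \<in> {1..p}"
  shows "fill p ks rs ! (c - 1) = (case map_of (zip ks rs) c of None \<Rightarrow> Leaf 1 | Some r \<Rightarrow> blank (RB r))"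
  using assms by (auto simp: fill_def simp del: upt_Suc)

lemma fill_in:
  assumes "positions p ks" "length rs = length ks" "t < length ks"
  shows "fill p ks rs ! (ks ! t - 1) = blank (RB (rs ! t))"
proof -
  have "set ks \<subseteq> {1..p}" using assms(1) by (simp add: positions_def)
  then have "ks ! t \<in> {1..p}" using nth_mem[OF assms(3)] by blast
  moreover have "map_of (zip ks rs) (ks ! t) = Some (rs ! t)"
    using assms positions_distinct[OF assms(1)] by (intro map_of_zip_nth) simp_all
  ultimately show ?thesis by (simp only: fill_nth option.case)
qed

lemma fill_out:
  assumes "length rs = length ks" "c \<in> {1..p}" "c \<notin> set ks"
  shows "fill p ks rs ! (c - 1) = Leaf 1"
proof -
  have "map_of (zip ks rs) c = None" using assms by (simp add: map_of_zip_is_None)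
  then show ?thesis by (simp only: fill_nth[OF assms(2)] option.case)
qed

lemma set_fill:
  assumes "positions p ks" "length rs = length ks" "u \<in> set (fill p ks rs)"
  shows "u = Leaf 1 \<or> (\<exists>r\<in>set rs. u = blank (RB r))"
proof -
  obtain i where i: "i < p" "u = fill p ks rs ! i" using assms(3) by (metis in_set_conv_nth length_fill)
  show ?thesis
  proof (cases "i + 1 \<in> set ks")
    case True
    then obtain t where "t < length ks" "ks ! t = i + 1" by (metis in_set_conv_nth)
    then show ?thesis using fill_in[OF assms(1,2)] i(2) assms(2) nth_mem[of t rs] by fastforce
  next
    case False
    then show ?thesis using fill_out[OF assms(2), of "i + 1" p] i by simp
  qed
qed

lemma sum_list_nth_upt:
  "sum_list (map f us) = (\<Sum>c\<in>{1..length us}. f (us ! (c - 1)) :: nat)"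
proof -
  have "sum_list (map f us) = (\<Sum>i<length us. f (us ! i))"
    by (simp add: sum_list_sum_nth lessThan_atLeast0)
  also have "\<dots> = (\<Sum>c\<in>{1..length us}. f (us ! (c - 1)))"
    by (rule sum.reindex_bij_witness[of _ "\<lambda>c. c - 1" Suc]) auto
  finally show ?thesis .
qed

text \<open>Free inputs contribute 0, so only the positions in \<open>ks\<close> remain. Different
  choices of \<phi> and \<open>h\<close> yield the number of leaves, the exponent of
  \<open>cweight\<close> and the number of occupied inputs.\<close>

lemma sum_fill:
  assumes "positions p ks" "length rs = length ks" "\<phi> (Leaf 1) = (0 :: nat)"
  shows "(\<Sum>c\<in>{1..p}. h c * \<phi> (fill p ks rs ! (c - 1))) =
    (\<Sum>t<length ks. h (ks ! t) * \<phi> (blank (RB (rs ! t))))"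
proof -
  have "(\<Sum>c\<in>{1..p}. h c * \<phi> (fill p ks rs ! (c - 1))) = (\<Sum>c\<in>set ks. h c * \<phi> (fill p ks rs ! (c - 1)))"
  proof (rule sum.mono_neutral_right)
    show "set ks \<subseteq> {1..p}" using assms(1) by (simp add: positions_def)
    show "\<forall>c\<in>{1..p} - set ks. h c * \<phi> (fill p ks rs ! (c - 1)) = 0"
      using fill_out[OF assms(2)] assms(3) by simp
  qed simp
  also have "\<dots> = (\<Sum>t<length ks. h (ks ! t) * \<phi> (fill p ks rs ! (ks ! t - 1)))"
    by (rule sum.reindex_bij_betw[symmetric, OF bij_betw_nth[OF positions_distinct[OF assms(1)]]]) simp_all
  also have "\<dots> = (\<Sum>t<length ks. h (ks ! t) * \<phi> (blank (RB (rs ! t))))"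
    by (intro sum.cong refl) (simp only: fill_in[OF assms(1,2)] lessThan_iff)
  finally show ?thesis .
qed

text \<open>The occupied positions are those not holding a leaf, and an increasing list is
  determined by its set.\<close>

lemma fill_inject:
  assumes "positions p ks" "length rs = length ks" "positions p ks'" "length rs' = length ks'"
    and eq: "fill p ks rs = fill p ks' rs'"
  shows "ks = ks' \<and> rs = rs'"
proof -
  have char: "set ks = {c \<in> {1..p}. fill p ks rs ! (c - 1) \<noteq> Leaf 1}"
    if pos: "positions p ks" "length rs = length ks" for ks rs
  proof (intro equalityI subsetI)
    fix c assume c: "c \<in> set ks"
    then obtain t where "t < length ks" "ks ! t = c" by (metis in_set_conv_nth)
    then have "fill p ks rs ! (c - 1) = blank (RB (rs ! t))" using fill_in[OF pos] by blast
    then show "c \<in> {c \<in> {1..p}. fill p ks rs ! (c - 1) \<noteq> Leaf 1}"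
      using c pos(1) by (auto simp: positions_def)
  next
    fix c assume "c \<in> {c \<in> {1..p}. fill p ks rs ! (c - 1) \<noteq> Leaf 1}"
    then show "c \<in> set ks" using fill_out[OF pos(2)] by blast
  qed
  have "set ks = set ks'" unfolding char[OF assms(1,2)] char[OF assms(3,4)] eq ..
  then have ks: "ks = ks'" using assms(1,3) by (simp add: positions_def strict_sorted_equal)
  have "rs = rs'"
  proof (rule nth_equalityI)
    show "length rs = length rs'" using assms(2,4) ks by simp
    fix t assume "t < length rs"
    then have "t < length ks" using assms(2) by simp
    then have "blank (RB (rs ! t)) = blank (RB (rs' ! t))"
      using fill_in[OF assms(1,2)] fill_in[OF assms(3,4)] eq ks by metis
    then show "rs ! t = rs' ! t" by simp
  qed
  with ks show ?thesis by simp
qed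

lemma fill_surj:
  assumes "\<And>u. u \<in> set us \<Longrightarrow> u = Leaf 1 \<or> (\<exists>l. u = blank (RB l))"
  obtains ks rs where "positions (length us) ks" "length rs = length ks" "us = fill (length us) ks rs"
proof -
  let ?p = "length us"
  let ?ks = "filter (\<lambda>c. us ! (c - 1) \<noteq> Leaf 1) [1..<?p+1]"
  have "\<exists>l. us ! (c - 1) = blank (RB l)" if "c \<in> set ?ks" for c
  proof -
    have "c - 1 < ?p" "us ! (c - 1) \<noteq> Leaf 1" using that by (auto simp del: upt_Suc)
    then show ?thesis using assms[OF nth_mem] by blast
  qed
  then obtain \<rho> where \<rho>: "\<And>c. c \<in> set ?ks \<Longrightarrow> us ! (c - 1) = blank (RB (\<rho> c))" by metis
  have pos: "positions ?p ?ks"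
    unfolding positions_def by (auto intro!: sorted_wrt_filter simp del: upt_Suc)
  have eq: "us = fill ?p ?ks (map \<rho> ?ks)"
  proof (rule nth_equalityI)
    fix i assume i: "i < length us"
    have "fill ?p ?ks (map \<rho> ?ks) ! (i + 1 - 1) = us ! (i + 1 - 1)"
    proof (cases "i + 1 \<in> set ?ks")
      case True
      then have "map_of (zip ?ks (map \<rho> ?ks)) (i + 1) = Some (\<rho> (i + 1))"
        by (simp only: map_of_zip_map if_True)
      then show ?thesis using \<rho>[OF True] i by (subst fill_nth) simp_all
    next
      case False
      then have "us ! (i + 1 - 1) = Leaf 1" using i by (auto simp del: upt_Suc)
      moreover have "fill ?p ?ks (map \<rho> ?ks) ! (i + 1 - 1) = Leaf 1"
        using False i by (intro fill_out) (simp_all del: upt_Suc)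
      ultimately show ?thesis by (simp only:)
    qed
    then show "us ! i = fill ?p ?ks (map \<rho> ?ks) ! i" by simp
  qed (simp only: length_fill)
  show thesis by (rule that[OF pos length_map eq])
qed

lemma graft_fill:
  "graft (Op p) (zip ks (map (\<lambda>r. corolla (RB r)) rs)) = number 1 (Node (Op p) (fill p ks rs))"
proof -
  have "map_of (zip ks (map (\<lambda>r. corolla (RB r)) rs)) = map_option (\<lambda>r. corolla (RB r)) \<circ> map_of (zip ks rs)"
    unfolding zip_map2 by (rule map_of_map)
  then have "map (\<lambda>c. case map_of (zip ks (map (\<lambda>r. corolla (RB r)) rs)) c of
      None \<Rightarrow> Leaf 1 | Some b \<Rightarrow> erase b) [1..<arity (Op p) + 1] = fill p ks rs"
    unfolding fill_def by (intro map_cong) (auto simp: erase_corolla split: option.split)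
  then show ?thesis unfolding graft_number by (simp only:)
qed

lemma erase_fill:
  assumes "positions p ks" "length rs = length ks"
  shows "map erase (fill p ks rs) = fill p ks rs"
proof (rule map_idI)
  fix u assume "u \<in> set (fill p ks rs)"
  then have "u = Leaf 1 \<or> (\<exists>r\<in>set rs. u = blank (RB r))" by (rule set_fill[OF assms])
  then show "erase u = u" by auto
qed

text \<open>Each of the \<open>p\<close> inputs counts for one leaf, and a corolla with
  \<open>r\<close> inputs adds \<open>r - 1\<close> more.\<close>

lemma leaves_fill:
  assumes "positions p ks" "length rs = length ks" "\<And>r. r \<in> set rs \<Longrightarrow> 1 \<le> r"
  shows "length (leaves (Node g (fill p ks rs))) = p + (\<Sum>t<length ks. rs ! t - 1)"
proof -
  let ?\<phi> = "\<lambda>u. length (leaves u) - 1"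
  have "(\<Sum>u\<leftarrow>fill p ks rs. length (leaves u)) = (\<Sum>u\<leftarrow>fill p ks rs. 1 + ?\<phi> u)"
    using set_fill[OF assms(1,2)] assms(3) by (intro arg_cong[where f = sum_list] map_cong refl) fastforce
  also have "\<dots> = p + sum_list (map ?\<phi> (fill p ks rs))"
    unfolding sum_list_addf by (simp add: map_replicate_const sum_list_replicate)
  also have "sum_list (map ?\<phi> (fill p ks rs)) = (\<Sum>c\<in>{1..p}. 1 * ?\<phi> (fill p ks rs ! (c - 1)))"
    unfolding sum_list_nth_upt by simp
  also have "\<dots> = (\<Sum>t<length ks. rs ! t - 1)"
    by (subst sum_fill[OF assms(1,2), where \<phi> = ?\<phi> and h = "\<lambda>_. 1"]) simp_all
  finally show ?thesis unfolding length_leaves_Node .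
qed

lemma tsign_fill:
  assumes "positions p ks" "length rs = length ks"
  shows "tsign cweight (Node g (fill p ks rs)) = (-1) ^ (\<Sum>t<length ks. (p - ks ! t) * (rs ! t - 1))"
proof -
  let ?\<phi> = "\<lambda>u. length (leaves u) - 1"
  have "isgn cweight (fill p ks rs) = isgn (\<lambda>x y. ?\<phi> x) (fill p ks rs)"
    by (rule isgn_cong) (simp add: cweight_def)
  also have "\<dots> = (-1) ^ (\<Sum>c=1..p. (p - c) * ?\<phi> (fill p ks rs ! (c - 1)))"
    unfolding isgn_left_weight[of ?\<phi>] length_fill ..
  also have "(\<Sum>c=1..p. (p - c) * ?\<phi> (fill p ks rs ! (c - 1))) = (\<Sum>t<length ks. (p - ks ! t) * (rs ! t - 1))"
    using sum_fill[OF assms, where \<phi> = ?\<phi> and h = "\<lambda>c. p - c"] by simp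
  finally have "isgn cweight (fill p ks rs) = (-1) ^ (\<Sum>t<length ks. (p - ks ! t) * (rs ! t - 1))" .
  moreover have "prod_list (map (tsign cweight) us) = 1"
    if "\<And>u. u \<in> set us \<Longrightarrow> tsign cweight u = 1" for us
    using that by (induction us) simp_all
  then have "prod_list (map (tsign cweight) (fill p ks rs)) = 1"
    using set_fill[OF assms] by fastforce
  ultimately show ?thesis by simp
qed

lemma leafkids_fill:
  assumes "positions p ks" "length rs = length ks"
  shows "leafkids (Node g (fill p ks rs)) = p - length ks"
proof -
  let ?\<phi> = "\<lambda>u. if is_leaf u then 0 else 1 :: nat"
  have "length (filter is_leaf us) + sum_list (map ?\<phi> us) = length us" for us
    by (induction us) simp_all
  from this[of "fill p ks rs"] have "leafkids (Node g (fill p ks rs)) + sum_list (map ?\<phi> (fill p ks rs)) = p"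
    by simp
  moreover have "sum_list (map ?\<phi> (fill p ks rs)) = (\<Sum>c\<in>{1..p}. 1 * ?\<phi> (fill p ks rs ! (c - 1)))"
    unfolding sum_list_nth_upt by simp
  moreover have "\<dots> = (\<Sum>t<length ks. 1 * ?\<phi> (blank (RB (rs ! t))))"
    by (rule sum_fill[OF assms]) simp
  ultimately show ?thesis by (simp add: blank_def)
qed

lemma leaf_mem_fill:
  assumes "positions p ks" "length rs = length ks"
  shows "Leaf 1 \<in> set (fill p ks rs) \<longleftrightarrow> length ks < p"
proof
  assume "Leaf 1 \<in> set (fill p ks rs)"
  then obtain i where i: "i < p" "fill p ks rs ! i = Leaf 1" by (metis in_set_conv_nth length_fill)
  have "i + 1 \<notin> set ks"
  proof
    assume "i + 1 \<in> set ks"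
    then obtain t where "t < length ks" "ks ! t = i + 1" by (metis in_set_conv_nth)
    then have "blank (RB (rs ! t)) = Leaf 1" using fill_in[OF assms, of t] i(2) by simp
    then show False by simp
  qed
  then have "set ks \<subset> {1..p}" using assms(1) i(1) by (auto simp: positions_def)
  then have "card (set ks) < card {1..p}" by (intro psubset_card_mono) simp_all
  then show "length ks < p" using distinct_card[OF positions_distinct[OF assms(1)]] by simp
next
  assume "length ks < p"
  then have "card (set ks) < card {1..p}" using distinct_card[OF positions_distinct[OF assms(1)]] by simp
  then have "\<not> {1..p} \<subseteq> set ks" using card_mono[of "set ks" "{1..p}"] by auto
  then obtain c where c: "c \<in> {1..p}" "c \<notin> set ks" by blast
  then have "fill p ks rs ! (c - 1) = Leaf 1" by (rule fill_out[OF assms(2)])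
  moreover have "c - 1 < length (fill p ks rs)" using c(1) by auto
  ultimately show "Leaf 1 \<in> set (fill p ks rs)" by (metis nth_mem)
qed

definition rb2_rs :: "nat \<Rightarrow> nat \<Rightarrow> nat \<Rightarrow> nat list set" where
  "rb2_rs n p q = {rs. length rs = q \<and> sum_list rs + (p - q) = n \<and> (\<forall>r\<in>set rs. 1 \<le> r)}"

definition rb2_ks :: "nat \<Rightarrow> nat \<Rightarrow> nat list set" where
  "rb2_ks p q = {ks. length ks = q - 1 \<and> sorted_wrt (<) ks \<and> set ks \<subseteq> {1..p}}"

definition rb2_index :: "nat \<Rightarrow> (nat \<times> nat \<times> nat list \<times> nat \<times> nat list) set" where
  "rb2_index n = (SIGMA p:{2..n}. SIGMA q:{1..p}. SIGMA rs:rb2_rs n p q. {1..rs ! 0} \<times> rb2_ks p q)"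

fun rb2_tree :: "nat \<times> nat \<times> nat list \<times> nat \<times> nat list \<Rightarrow> tree" where
  "rb2_tree (p, q, rs, i, ks) = Node (RB (rs ! 0)) (one_at (rs ! 0) i (Node (Op p) (fill p ks (tl rs))))"

lemma rb2_indexD:
  assumes "(p, q, rs, i, ks) \<in> rb2_index n"
  obtains r rs' where "rs = r # rs'" "2 \<le> p" "p \<le> n" "length rs' = length ks" "q = length ks + 1" "length ks < p"
    "1 \<le> r" "\<forall>r\<in>set rs'. 1 \<le> r" "r + sum_list rs' + (p - q) = n" "i \<in> {1..r}" "positions p ks"
proof -
  from assms have p: "p \<in> {2..n}" and q: "q \<in> {1..p}" and rs: "rs \<in> rb2_rs n p q"
    and i: "i \<in> {1..rs ! 0}" and ks: "ks \<in> rb2_ks p q" by (simp_all add: rb2_index_def)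
  obtain r rs' where "rs = r # rs'" using rs q by (cases rs) (auto simp: rb2_rs_def)
  then show thesis
    by (intro that) (use p q rs i ks in \<open>auto simp: rb2_rs_def rb2_ks_def positions_def\<close>)
qed

lemma sum_list_pred:
  fixes rs :: "nat list"
  shows "(\<forall>r\<in>set rs. 1 \<le> r) \<Longrightarrow> (\<Sum>t<length rs. rs ! t - 1) + length rs = sum_list rs"
  by (induction rs) (simp_all add: sum.lessThan_Suc_shift del: sum.lessThan_Suc)

text \<open>The indices can be read off a shape: the arities of the root and of \<open>Op p\<close>
  from these vertices, \<open>i\<close> from the place of the only child of the root that is not a
  leaf, \<open>ks\<close> and the remaining arities from the occupied inputs of
  \<open>Op p\<close>.\<close>

lemma bij_betw_shapes_rb2: "bij_betw rb2_tree (rb2_index n) (shapes_rb2 n)"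
  unfolding bij_betw_def
proof
  show "inj_on rb2_tree (rb2_index n)"
  proof (rule inj_onI)
    fix x y assume x: "x \<in> rb2_index n" and y: "y \<in> rb2_index n" and eq: "rb2_tree x = rb2_tree y"
    obtain p q rs i ks where xe: "x = (p, q, rs, i, ks)" by (cases x) auto
    obtain p' q' rs' i' ks' where ye: "y = (p', q', rs', i', ks')" by (cases y) auto
    from x[unfolded xe] obtain r s where X: "rs = r # s" "length s = length ks" "q = length ks + 1"
      "i \<in> {1..r}" "positions p ks" by (rule rb2_indexD)
    from y[unfolded ye] obtain r' s' where Y: "rs' = r' # s'" "length s' = length ks'" "q' = length ks' + 1"
      "i' \<in> {1..r'}" "positions p' ks'" by (rule rb2_indexD)
    have eq': "Node (RB r) (one_at r i (Node (Op p) (fill p ks s))) =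
        Node (RB r') (one_at r' i' (Node (Op p') (fill p' ks' s')))"
      using eq unfolding xe ye X(1) Y(1) rb2_tree.simps nth_Cons_0 list.sel .
    note c = tree.inject(2)[THEN iffD1, OF eq']
    have r: "r = r'" using c by simp
    note one = c[THEN conjunct2]
    have nd: "i = i' \<and> Node (Op p) (fill p ks s) = Node (Op p') (fill p' ks' s')"
      by (rule one_at_inject[OF one[folded r]]) (use X(4) Y(4) in simp_all)
    note i = nd[THEN conjunct1]
    have p: "p = p'" using nd by simp
    note f = tree.inject(2)[THEN iffD1, OF nd[THEN conjunct2], THEN conjunct2, folded p]
    have "ks = ks' \<and> s = s'" using fill_inject[OF X(5,2) Y(5)[folded p] Y(2) f] .
    then show "x = y" unfolding xe ye using X Y r i p by simp
  qed
  show "rb2_tree ` rb2_index n = shapes_rb2 n"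
  proof (intro equalityI subsetI)
    fix T assume "T \<in> rb2_tree ` rb2_index n"
    then obtain x where x: "x \<in> rb2_index n" and Tx: "T = rb2_tree x" by auto
    obtain p q rs i ks where xe: "x = (p, q, rs, i, ks)" by (cases x) auto
    from x[unfolded xe] obtain r s where X: "rs = r # s" "2 \<le> p" "length s = length ks" "q = length ks + 1"
      "length ks < p" "1 \<le> r" "\<forall>r\<in>set s. 1 \<le> r" "r + sum_list s + (p - q) = n"
      "i \<in> {1..r}" "positions p ks" by (rule rb2_indexD)
    let ?us = "fill p ks s"
    have T: "T = Node (RB r) (one_at r i (Node (Op p) ?us))" using Tx xe X(1) by simp
    have us: "u = Leaf 1 \<or> (\<exists>r\<in>set s. u = blank (RB r))" if "u \<in> set ?us" for u
      using set_fill[OF X(10,3) that] .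
    have "is_shape n T"
      unfolding T
    proof (rule is_shape_one_at)
      have "well_formed u" if "u \<in> set ?us" for u using us[OF that] X(7) by auto
      then show "well_formed (Node (Op p) ?us)" using X(2) by simp
      show "erase (Node (Op p) ?us) = Node (Op p) ?us" using erase_fill[OF X(10,3)] by simp
      have "(\<Sum>t<length ks. s ! t - 1) + length ks = sum_list s" using sum_list_pred[OF X(7)] X(3) by simp
      then show "r + length (leaves (Node (Op p) ?us)) = n + 1"
        using leaves_fill[OF X(10,3), of "Op p"] X(4,5,7,8) by simp
    qed (use X in auto)
    moreover have "Leaf 1 \<in> set ?us" using leaf_mem_fill[OF X(10,3)] X(5) by simp
    moreover have "\<forall>u\<in>set ?us. u = Leaf 1 \<or> (\<exists>l. u = blank (RB l))" using us by blast
    ultimately show "T \<in> shapes_rb2 n"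
      using mset_one_at[OF X(9)] T unfolding shapes_rb2_def by blast
  next
    fix T assume "T \<in> shapes_rb2 n"
    then obtain r p ts us where T: "T = Node (RB r) ts"
      "mset ts = add_mset (Node (Op p) us) (replicate_mset (r - 1) (Leaf 1))" "Leaf 1 \<in> set us"
      "\<forall>u\<in>set us. u = Leaf 1 \<or> (\<exists>l. u = blank (RB l))"
      and sh: "is_shape n T" unfolding shapes_rb2_def by blast
    from T(2) obtain i where i: "i \<in> {1..r - 1 + 1}" and ts: "ts = one_at (r - 1 + 1) i (Node (Op p) us)"
      by (rule mset_eq_one_at)
    note D = is_shape_one_atD[OF sh[unfolded T(1) ts] i]
    have r: "r - 1 + 1 = r" "1 \<le> r" and p: "2 \<le> p" "length us = p" and wf: "\<forall>u\<in>set us. well_formed u"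
      and len: "r + length (leaves (Node (Op p) us)) = n + 1"
      using D by simp_all
    have form: "\<And>u. u \<in> set us \<Longrightarrow> u = Leaf 1 \<or> (\<exists>l. u = blank (RB l))" using T(4) by blast
    obtain ks s where ks: "positions p ks" "length s = length ks" "us = fill p ks s"
      using fill_surj[of us, OF form] unfolding p(2) by blast
    have ge: "1 \<le> l" if l: "l \<in> set s" for l
    proof -
      obtain t where t: "t < length s" "l = s ! t" using l by (metis in_set_conv_nth)
      then have eq: "us ! (ks ! t - 1) = blank (RB l)" using fill_in[OF ks(1,2)] ks(2,3) by simp
      have "set ks \<subseteq> {1..p}" using ks(1) by (simp add: positions_def)
      moreover have "ks ! t \<in> set ks" using t(1) ks(2) by simp
      ultimately have "ks ! t \<in> {1..p}" by blast
      then have "us ! (ks ! t - 1) \<in> set us" using p(2) by (intro nth_mem) auto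
      then have "well_formed (blank (RB l))" using wf eq by metis
      then show ?thesis by simp
    qed
    have lt: "length ks < p" using leaf_mem_fill[OF ks(1,2)] T(3) ks(3) by simp
    have "(\<Sum>t<length ks. s ! t - 1) + length ks = sum_list s" using sum_list_pred[of s] ge ks(2) by simp
    moreover have "length (leaves (Node (Op p) us)) = p + (\<Sum>t<length ks. s ! t - 1)"
      using leaves_fill[OF ks(1,2) ge] unfolding ks(3) .
    \<comment> \<open>Both follow from counting leaves; the bound on \<open>p\<close> uses
      \<open>1 \<le> r\<close>.\<close>
    ultimately have sum: "r + sum_list s + (p - (length ks + 1)) = n" and pn: "p \<le> n" using len lt r(2) by auto
    have "(p, length ks + 1, r # s, i, ks) \<in> rb2_index n"
      using p pn lt sum r i ge ks by (auto simp: rb2_index_def rb2_rs_def rb2_ks_def positions_def)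
    moreover have "T = rb2_tree (p, length ks + 1, r # s, i, ks)" using T(1) ts r(1) ks(3) by simp
    ultimately show "T \<in> rb2_tree ` rb2_index n" by blast
  qed
qed

lemma finite_rb2:
  "finite (rb2_rs n p q)" "finite (rb2_ks p q)"
proof -
  have "rb2_rs n p q \<subseteq> {ls. set ls \<subseteq> {..n} \<and> length ls = q}"
    by (auto simp: rb2_rs_def dest: member_le_sum_list)
  then show "finite (rb2_rs n p q)" by (rule finite_subset) (rule finite_lists_length_eq, simp)
  have "rb2_ks p q \<subseteq> {ks. set ks \<subseteq> {1..p} \<and> length ks = q - 1}" by (auto simp: rb2_ks_def)
  then show "finite (rb2_ks p q)" by (rule finite_subset) (rule finite_lists_length_eq, simp)
qed

text \<open>\<open>beta'\<close> multiplies \<open>r - i\<close> by the number of leaves above input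
  \<open>i\<close>, and \<open>cweight\<close> by one less, where \<open>r\<close> is the first
  entry of \<open>rs\<close>. The surplus \<open>r - i\<close> combines with \<open>1 + i\<close> to
  \<open>1 + r\<close>, which is the sign in \<open>coef\<close>.\<close>

lemma coef_rb2:
  assumes "(p, q, rs, i, ks) \<in> rb2_index n"
  shows "coef lam (RB n) (rb2_tree (p, q, rs, i, ks)) * of_int (tsign cweight (rb2_tree (p, q, rs, i, ks))) =
    (-1) ^ beta' p rs i ks * (lam :: 'k::comm_ring_1) ^ (p - q)"
proof -
  from assms obtain r s where X: "rs = r # s" "2 \<le> p" "length s = length ks" "q = length ks + 1"
    "length ks < p" "\<forall>r\<in>set s. 1 \<le> r" "i \<in> {1..r}" "positions p ks" by (rule rb2_indexD)
  let ?X = "Node (Op p) (fill p ks s)"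
  let ?A = "\<Sum>t<length ks. s ! t - 1"
  let ?B = "\<Sum>t<length ks. (p - ks ! t) * (s ! t - 1)"
  have T: "rb2_tree (p, q, rs, i, ks) = Node (RB r) (one_at r i ?X)" by (simp add: X(1))
  have len: "length (leaves ?X) - 1 = p + ?A - 1" using leaves_fill[OF X(8,3), of "Op p"] X(6) by simp
  have "sum_list (map leafkids (one_at r i ?X)) = leafkids ?X"
    by (simp add: one_at_def sum_list_replicate)
  then have lk: "sum_list (map leafkids (one_at r i ?X)) - 1 = p - q"
    unfolding leafkids_fill[OF X(8,3)] using X(4) by simp
  have beta: "beta' p rs i ks = 1 + i + (p + ?A) * (r - i) + ?B"
  proof -
    have 1: "(\<Sum>j=2..length rs. rs ! (j - 1) - 1) = ?A"
      by (rule sum.reindex_bij_witness[of _ "\<lambda>t. t + 2" "\<lambda>j. j - 2"])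
         (use X(1,3) in \<open>auto simp: nth_Cons' numeral_2_eq_2\<close>)
    have 2: "(\<Sum>j=2..length rs. (rs ! (j - 1) - 1) * (p - ks ! (j - 2))) = ?B"
      by (rule sum.reindex_bij_witness[of _ "\<lambda>t. t + 2" "\<lambda>j. j - 2"])
         (use X(1,3) in \<open>auto simp: nth_Cons' numeral_2_eq_2\<close>)
    show ?thesis unfolding beta'_def Let_def 1 2 using X(1) by simp
  qed
  have "coef lam (RB n) (rb2_tree (p, q, rs, i, ks)) * of_int (tsign cweight (rb2_tree (p, q, rs, i, ks))) =
    (-1) ^ ((1 + r) + (r - i) * (p + ?A - 1) + ?B) * lam ^ (p - q)"
    unfolding T tsign_one_at tsign_fill[OF X(8,3)] len coef.simps lk
    by (simp only: of_int_mult of_int_power of_int_minus of_int_1 power_add ac_simps)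
  also have "(-1 :: 'k) ^ ((1 + r) + (r - i) * (p + ?A - 1) + ?B) = (-1) ^ beta' p rs i ks"
  proof (rule neg_one_power_eq)
    obtain a where a: "r = i + a" using X(7) le_Suc_ex[of i r] by auto
    obtain w where w: "p + ?A = Suc w" using X(2) by (cases "p + ?A") auto
    have "(1 + r) + (r - i) * (p + ?A - 1) + ?B + beta' p rs i ks = 2 * (1 + i + a + a * w + ?B)"
      unfolding beta w by (simp add: a algebra_simps)
    then show "even ((1 + r) + (r - i) * (p + ?A - 1) + ?B + beta' p rs i ks)" by (metis dvd_triv_left)
  qed
  finally show ?thesis .
qed

lemma diff_gen_rb2:
  fixes E :: "tree \<Rightarrow> (tree \<Rightarrow>\<^sub>0 'k::comm_ring_1)"
  shows "(\<Sum>p\<in>{2..n}. \<Sum>q\<in>{1..p}.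
     \<Sum>rs\<in>{rs. length rs = q \<and> sum_list rs + (p - q) = n \<and> (\<forall>r\<in>set rs. 1 \<le> r)}.
     \<Sum>i\<in>{1..rs ! 0}.
     \<Sum>ks\<in>{ks. length ks = q - 1 \<and> sorted_wrt (<) ks \<and> set ks \<subseteq> {1..p}}.
       smul ((-1) ^ beta' p rs i ks * lam ^ (p - q))
         (E (graft (RB (rs ! 0))
              [(i, graft (Op p) (zip ks (map (\<lambda>r. corolla (RB r)) (tl rs))))]))) =
    (\<Sum>T\<in>shapes_rb2 n. smul (coef lam (RB n) T * of_int (tsign cweight T)) (E (number 1 T)))"
proof -
  let ?F = "\<lambda>T. smul (coef lam (RB n) T * of_int (tsign cweight T)) (E (number 1 T))"
  let ?G = "\<lambda>p q rs i ks. smul ((-1) ^ beta' p rs i ks * lam ^ (p - q))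
    (E (graft (RB (rs ! 0)) [(i, graft (Op p) (zip ks (map (\<lambda>r. corolla (RB r)) (tl rs))))]))"
  have "(\<Sum>p\<in>{2..n}. \<Sum>q\<in>{1..p}. \<Sum>rs\<in>rb2_rs n p q. \<Sum>i\<in>{1..rs ! 0}. \<Sum>ks\<in>rb2_ks p q. ?G p q rs i ks) =
    (\<Sum>(p, q, rs, i, ks)\<in>rb2_index n. ?G p q rs i ks)"
    unfolding rb2_index_def by (simp add: sum.Sigma sum.cartesian_product finite_rb2 split_def)
  also have "\<dots> = (\<Sum>x\<in>rb2_index n. ?F (rb2_tree x))"
  proof (rule sum.cong[OF refl])
    fix x assume x: "x \<in> rb2_index n"
    obtain p q rs i ks where xe: "x = (p, q, rs, i, ks)" by (cases x) auto
    from x[unfolded xe] obtain r s where X: "rs = r # s" "length s = length ks" "i \<in> {1..r}" "positions p ks"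
      by (rule rb2_indexD)
    have "erase (graft (Op p) (zip ks (map (\<lambda>r. corolla (RB r)) s))) = Node (Op p) (fill p ks s)"
      unfolding graft_fill erase_number erase_simps erase_fill[OF X(4,2)] ..
    then have "graft (RB (rs ! 0)) [(i, graft (Op p) (zip ks (map (\<lambda>r. corolla (RB r)) (tl rs))))] =
      number 1 (rb2_tree x)"
      using graft_single[of i "RB r"] X(1,3) xe by simp
    then show "(case x of (p, q, rs, i, ks) \<Rightarrow> ?G p q rs i ks) = ?F (rb2_tree x)"
      using coef_rb2[OF x[unfolded xe], of lam] unfolding xe case_prod_conv by (simp only:)
  qed
  also have "\<dots> = (\<Sum>T\<in>shapes_rb2 n. ?F T)"
    by (rule sum.reindex_bij_betw[OF bij_betw_shapes_rb2])
  finally show ?thesis unfolding rb2_rs_def rb2_ks_def .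
qed

lemma finite_shapes: "finite (shapes g)"
proof -
  have "finite (shapes_op n)" for n using bij_betw_finite[OF bij_betw_shapes_op, of n] by simp
  moreover have "finite (shapes_rb1 n)" for n
    using bij_betw_finite[OF bij_betw_shapes_rb1, of n] by (simp add: finite_rb1_index)
  moreover have "finite (shapes_rb2 n)" for n
    using bij_betw_finite[OF bij_betw_shapes_rb2, of n] unfolding rb2_index_def by (simp add: finite_rb2)
  ultimately show ?thesis by (cases g) simp_all
qed

text \<open>Both differentials take this form with the same coefficients; only \<open>E\<close>
  differs. Since \<open>coef\<close> is constant on classes, this is the input that
  \<open>lin_alternate_shuffle_sum\<close> asks for.\<close>

theorem diff_gen_shapes:
  fixes E :: "tree \<Rightarrow> (tree \<Rightarrow>\<^sub>0 'k::comm_ring_1)"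
  shows "diff_gen E lam g =
    (\<Sum>T\<in>shapes g. smul (coef lam g T * of_int (tsign cweight T)) (E (number 1 T)))"
proof (cases g)
  case (Op n)
  then show ?thesis by (simp only: diff_gen_op shapes.simps)
next
  case (RB n)
  \<comment> \<open>The roots differ: \<open>Op k\<close> in the first set and \<open>RB r\<close>
    in the second.\<close>
  have "shapes_rb1 n \<inter> shapes_rb2 n = {}" by (auto simp: shapes_rb1_def shapes_rb2_def)
  moreover have "finite (shapes_rb1 n)" "finite (shapes_rb2 n)" using finite_shapes[of "RB n"] by simp_all
  ultimately show ?thesis unfolding RB shapes.simps diff_gen.simps
    by (simp only: sum.union_disjoint diff_gen_rb1[where lam = lam] diff_gen_rb2)
qed

section \<open>The morphism\<close>

lemma tdeg_erase [simp]: "tdeg (erase t) = tdeg t"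
  by (simp add: erase_def)

text \<open>A leaf and a corolla \<open>RB l\<close> both have degree one less than their number of
  leaves.\<close>

lemma tdeg_RB_list:
  assumes "\<And>u. u \<in> set us \<Longrightarrow> u = Leaf 1 \<or> (\<exists>l. u = blank (RB l))" "\<And>u. u \<in> set us \<Longrightarrow> well_formed u"
  shows "sum_list (map tdeg us) + length us = (\<Sum>u\<leftarrow>us. length (leaves u))"
  using assms
proof (induction us)
  case (Cons u us)
  have "tdeg u + 1 = length (leaves u)"
    using Cons.prems(1)[of u] Cons.prems(2)[of u] by auto
  then show ?case using Cons by simp
qed simp

lemma tdeg_shapes:
  assumes "T \<in> shapes g"
  shows "tdeg T + 1 = gdeg g"
proof -
  have op: "tdeg T + 1 = n - 2" if "T \<in> shapes_op n" for n
  proof -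
    from that obtain m j ts where T: "T = Node (Op m) ts"
      "mset ts = add_mset (blank (Op j)) (replicate_mset (m - 1) (Leaf 1))"
      and sh: "is_shape n T" unfolding shapes_op_def by blast
    from T(2) obtain i where i: "i \<in> {1..m - 1 + 1}" and ts: "ts = one_at (m - 1 + 1) i (blank (Op j))"
      by (rule mset_eq_one_at)
    note D = is_shape_one_atD[OF sh[unfolded T(1) ts] i]
    have "sum_list (map tdeg ts) = j - 2" unfolding ts by (simp add: one_at_def sum_list_replicate)
    then show ?thesis unfolding T(1) using D by simp
  qed
  have rb1: "tdeg T + 1 = n - 1" if "T \<in> shapes_rb1 n" for n
  proof -
    from that obtain k ts where T: "T = Node (Op k) ts" "\<forall>t\<in>set ts. \<exists>l. t = blank (RB l)"
      and sh: "is_shape n T" unfolding shapes_rb1_def by blast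
    have wf: "2 \<le> k" "length ts = k" "\<forall>t\<in>set ts. well_formed t" and len: "(\<Sum>t\<leftarrow>ts. length (leaves t)) = n"
      using sh unfolding is_shape_def T(1) length_leaves_Node by simp_all
    have "sum_list (map tdeg ts) + length ts = n"
      unfolding len[symmetric] by (rule tdeg_RB_list) (use T(2) wf(3) in blast)+
    then show ?thesis unfolding T(1) using wf by simp
  qed
  have rb2: "tdeg T + 1 = n - 1" if "T \<in> shapes_rb2 n" for n
  proof -
    from that obtain r p ts us where T: "T = Node (RB r) ts"
      "mset ts = add_mset (Node (Op p) us) (replicate_mset (r - 1) (Leaf 1))"
      "\<forall>u\<in>set us. u = Leaf 1 \<or> (\<exists>l. u = blank (RB l))"
      and sh: "is_shape n T" unfolding shapes_rb2_def by blast
    from T(2) obtain i where i: "i \<in> {1..r - 1 + 1}" and ts: "ts = one_at (r - 1 + 1) i (Node (Op p) us)"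
      by (rule mset_eq_one_at)
    note D = is_shape_one_atD[OF sh[unfolded T(1) ts] i]
    have us: "sum_list (map tdeg us) + length us = (\<Sum>u\<leftarrow>us. length (leaves u))"
      by (rule tdeg_RB_list) (use T(3) D(3) in auto)
    have "sum_list (map tdeg ts) = tdeg (Node (Op p) us)" unfolding ts by (simp add: one_at_def sum_list_replicate)
    moreover have "1 \<le> r" "2 \<le> p" "length us = p" "r + (\<Sum>u\<leftarrow>us. length (leaves u)) = n + 1"
      using D unfolding length_leaves_Node by simp_all
    ultimately show ?thesis unfolding T(1) tdeg.simps gdeg.simps using us by linarith
  qed
  show ?thesis using assms op rb1 rb2 by (cases g) auto
qed

lemma is_shape_shapes: "T \<in> shapes g \<Longrightarrow> is_shape (arity g) T"
  by (cases g) (auto simp: shapes_op_def shapes_rb1_def shapes_rb2_def)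

lemma labellings_admissible:
  assumes "m \<in> labellings (arity g) (shapes g)"
  shows "well_formed m \<and> mset (leaves m) = mset [1..<arity g + 1] \<and> tdeg m + 1 = gdeg g"
proof -
  have m: "m \<in> tree_monomials (arity g)" "erase m \<in> shapes g" using assms by (simp_all add: labellings_def)
  have "tdeg m + 1 = gdeg g" using tdeg_shapes[OF m(2)] by simp
  then show ?thesis using m(1) leaves_tree_monomial[OF m(1)] by (simp only: tree_monomials_def mem_Collect_eq simp_thms)
qed

lemma admissible_diff_gen:
  fixes E :: "tree \<Rightarrow> (tree \<Rightarrow>\<^sub>0 'k::comm_ring_1)"
  assumes "\<And>g T. T \<in> shapes g \<Longrightarrow> Poly_Mapping.keys (E (number 1 T)) \<subseteq> labellings (arity g) (shapes g)"
  shows "admissible (diff_gen E lam)"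
proof -
  have "Poly_Mapping.keys (diff_gen E lam g) \<subseteq> labellings (arity g) (shapes g)" for g
    unfolding diff_gen_shapes by (intro keys_sum_subset order_trans[OF keys_smul] assms)
  then show ?thesis unfolding admissible_def using labellings_admissible by blast
qed

lemma tact_number_labellings:
  assumes "T \<in> shapes g" "\<sigma> permutes {1..arity g}"
  shows "tact \<sigma> (number 1 T) \<in> labellings (arity g) (shapes g)"
  using tact_number_mem[OF is_shape_shapes[OF assms(1)] assms(2)] assms(1) by (simp add: labellings_def)

lemma admissible_monomial: "admissible (diff_gen monomial lam)"
proof (rule admissible_diff_gen)
  fix g T assume T: "T \<in> shapes g"
  have "tact id (number 1 T) = number 1 T" unfolding tact_def by (intro relabel_id) simp
  then have "number 1 T \<in> labellings (arity g) (shapes g)"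
    using tact_number_labellings[OF T permutes_id] by simp
  then show "Poly_Mapping.keys (monomial (number 1 T)) \<subseteq> labellings (arity g) (shapes g)"
    using keys_monomial by (metis empty_subsetI insert_subset order_trans)
qed

lemma admissible_shuffle_sum: "admissible (diff_gen shuffle_sum lam)"
proof (rule admissible_diff_gen)
  fix g T assume T: "T \<in> shapes g"
  have len: "length (leaves (number 1 T)) = arity g"
    using is_shape_shapes[OF T] by (simp add: leaves_number(1) is_shape_def)
  show "Poly_Mapping.keys (shuffle_sum (number 1 T)) \<subseteq> labellings (arity g) (shapes g)"
    unfolding shuffle_sum_def len
  proof (intro keys_sum_subset order_trans[OF keys_smul] order_trans[OF keys_monomial])
    fix \<sigma> assume "\<sigma> \<in> {\<sigma>. \<sigma> permutes {1..arity g} \<and> shuffle_tree (tact \<sigma> (number 1 T))}"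
    then show "{tact \<sigma> (number 1 T)} \<subseteq> labellings (arity g) (shapes g)"
      using tact_number_labellings[OF T] by blast
  qed
qed

lemma lin_alternate_diff_gen:
  "lin alternate (diff_gen shuffle_sum lam g) = (\<Sum>\<sigma> | \<sigma> permutes {1..arity g}.
     smul (of_int (sign \<sigma>)) (lin (\<lambda>m. monomial (tact \<sigma> m)) (diff_gen monomial lam g)))"
  unfolding diff_gen_shapes
  by (rule lin_alternate_shuffle_sum) (use finite_shapes is_shape_shapes good_shapes shapes_closed in blast)+

lemma lin_alternate_derivation:
  assumes "Poly_Mapping.keys x \<subseteq> tree_monomials n"
  shows "lin alternate (lin (derivation (diff_gen shuffle_sum lam)) x) =
    lin (derivation (diff_gen monomial lam)) (lin alternate x)"
  unfolding lin_lin
proof (rule lin_cong)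
  fix t assume "t \<in> Poly_Mapping.keys x"
  then have "t \<in> tree_monomials n" using assms by blast
  then show "lin alternate (derivation (diff_gen shuffle_sum lam) t) = lin (derivation (diff_gen monomial lam)) (alternate t)"
    by (intro alternate_derivation admissible_monomial admissible_shuffle_sum lin_alternate_diff_gen)
       (simp_all add: tree_monomials_def)
qed

section \<open>Relabellings, the symmetric group action and partial compositions\<close>

lemma isgn_symbols_zero: "isgn kweight (symbols (\<lambda>_. 0) t) = 1"
proof (rule isgn_eq_one)
  have *: "fst p = 0 \<or> snd p = 0" if "p \<in> set (symbols (\<lambda>_. 0) t)" for p
    using that by (induction t) auto
  show "kweight p q = 0" if "p \<in> set (symbols (\<lambda>_. 0) t)" "q \<in> set (symbols (\<lambda>_. 0) t)" for p q
    using *[OF that(1)] by (auto simp: kweight_def)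
qed

lemma composable_relabel:
  assumes "well_formed t" "distinct (leaves t)" "0 \<notin> set (leaves t)" "inj_on f (set (leaves t))"
  shows "composable t (\<lambda>i. Leaf (f i))"
  using assms leaves_relabel[of f t] unfolding relabel_def by (simp add: composable_def distinct_map)

text \<open>Relabelling is the grafting of leaves, which have degree 0, so
  \<open>orient_compose\<close> applies without Koszul signs. Minima may move, hence only the
  product of two orientations is invariant, not each of them.\<close>

lemma orient_relabel:
  assumes "well_formed t" "distinct (leaves t)" "0 \<notin> set (leaves t)" "inj_on f (set (leaves t))"
    and "rearr t t'"
  shows "orient (relabel f t) * orient (relabel f t') = orient t * orient t'"
  using orient_compose[OF composable_relabel[OF assms(1-4)] assms(5), of "\<lambda>i. Leaf (f i)"]
  by (simp add: isgn_symbols_zero relabel_def)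

lemma rclass_relabel:
  assumes "distinct (leaves t)"
  shows "rclass (relabel f t) = relabel f ` rclass t"
proof (intro equalityI subsetI)
  fix u assume "u \<in> rclass (relabel f t)"
  then have "rearr (tsubst (\<lambda>i. Leaf (f i)) t) u" by (simp add: rclass_def relabel_def)
  then obtain t' s' where u: "u = tsubst s' t'" "rearr t t'" "\<forall>i\<in>set (leaves t). rearr (Leaf (f i)) (s' i)"
    using rearr_tsubstD[OF _ assms] by blast
  have "u = relabel f t'" unfolding u(1) relabel_def
    using u(3) rearr_leaves(1)[OF u(2)] by (intro tsubst_cong) (auto dest: rearr_LeafD)
  then show "u \<in> relabel f ` rclass t" using u(2) by (auto simp: rclass_def)
next
  fix u assume "u \<in> relabel f ` rclass t"
  then obtain t' where "u = relabel f t'" "rearr t t'" by (auto simp: rclass_def)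
  then show "u \<in> rclass (relabel f t)"
    using rearr_tsubst[of t t' "\<lambda>i. Leaf (f i)" "\<lambda>i. Leaf (f i)"] by (simp add: rclass_def relabel_def)
qed

lemma inj_on_relabel:
  assumes "inj_on f (set (leaves t))"
  shows "inj_on (relabel f) (rclass t)"
proof (rule inj_on_inverseI)
  fix u assume "u \<in> rclass t"
  then have "set (leaves u) = set (leaves t)" by (simp add: rclass_def rearr_leaves(1))
  then show "relabel (the_inv_into (set (leaves t)) f) (relabel f u) = u"
    using the_inv_into_f_f[OF assms] unfolding relabel_relabel by (intro relabel_id) simp
qed

lemma sum_rclass_relabel:
  assumes "well_formed t" "distinct (leaves t)" "0 \<notin> set (leaves t)" "inj_on f (set (leaves t))"
  shows "(\<Sum>u\<in>rclass (relabel f t). F (orient (relabel f t) * orient u) u) =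
    (\<Sum>t'\<in>rclass t. F (orient t * orient t') (relabel f t'))"
  unfolding rclass_relabel[OF assms(2)] sum.reindex[OF inj_on_relabel[OF assms(4)]] comp_def
  by (intro sum.cong refl) (simp add: rclass_def orient_relabel[OF assms])

lemma alternate_relabel:
  assumes "well_formed t" "distinct (leaves t)" "0 \<notin> set (leaves t)" "inj_on f (set (leaves t))"
  shows "alternate (relabel f t) = lin (\<lambda>u. monomial (relabel f u)) (alternate t)"
  unfolding alternate_def lin_sum lin_smul lin_monomial
  by (rule sum_rclass_relabel[OF assms, where F = "\<lambda>e u. smul (of_int e) (monomial u)"])

lemma alternate_tact:
  assumes "t \<in> tree_monomials n" "\<sigma> permutes {1..n}"
  shows "alternate (tact \<sigma> t) = lin (\<lambda>u. monomial (tact \<sigma> u)) (alternate t)"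
  unfolding tact_def
  using assms permutes_inj_on[OF permutes_inv[OF assms(2)]]
  by (intro alternate_relabel) (simp_all add: tree_monomials_def)

definition insert_at :: "nat \<Rightarrow> nat \<Rightarrow> tree \<Rightarrow> nat \<Rightarrow> tree" where
  "insert_at n i u = (\<lambda>j. if j < i then Leaf j else if j = i then relabel (\<lambda>l. l + i - 1) u
     else Leaf (j + n - 1))"

lemma compose_at_eq: "compose_at n i t u = compose_all t (insert_at n i u)"
  by (simp add: compose_at_def insert_at_def)

lemma leaves_insert_at:
  assumes "u \<in> tree_monomials n"
  shows "set (leaves (insert_at n i u j)) = (if j < i then {j} else if j = i then (\<lambda>l. l + i - 1) ` {1..n} else {j + n - 1})"
  using assms by (simp add: insert_at_def tree_monomials_def)

text \<open>The grafted trees use the labels below \<open>i\<close>, the interval from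
  \<open>i\<close> to \<open>i + n - 1\<close>, and the shifted labels above it; these partition
  \<open>{1..m + n - 1}\<close>.\<close>

lemma tree_monomials_insert_at:
  assumes t: "t \<in> tree_monomials m" and u: "u \<in> tree_monomials n" and i: "i \<in> {1..m}"
  shows "composable t (insert_at n i u)" "tsubst (insert_at n i u) t \<in> tree_monomials (m + n - 1)"
proof -
  have t': "well_formed t" "distinct (leaves t)" "set (leaves t) = {1..m}"
    and u': "well_formed u" "distinct (leaves u)" "set (leaves u) = {1..n}"
    using t u by (simp_all add: tree_monomials_def)
  \<comment> \<open>Every tree has a leaf, so \<open>n\<close> is positive and the subtraction in
    \<open>j + n - 1\<close> never shifts a label down.\<close>
  have n: "1 \<le> n" using leaves_nonempty[OF u'(1)] u'(3) by (cases n) auto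
  have wf: "well_formed (insert_at n i u j)" for j using u' by (simp add: insert_at_def)
  have img: "(\<lambda>l. l + i - 1) ` {1..n} = {i..i + n - 1}"
  proof (intro equalityI subsetI)
    fix x assume "x \<in> {i..i + n - 1}"
    then show "x \<in> (\<lambda>l. l + i - 1) ` {1..n}" using n by (intro image_eqI[of _ _ "x + 1 - i"]) auto
  qed (use i in auto)
  have L: "set (leaves (insert_at n i u j)) =
      (if j < i then {j} else if j = i then {i..i + n - 1} else {j + n - 1})" for j
    unfolding leaves_insert_at[OF u] img ..
  have "inj_on (\<lambda>l. l + i - 1) {1..n}" using i by (auto simp: inj_on_def)
  then have dist1: "distinct (leaves (insert_at n i u j))" for j
    using u' by (simp add: insert_at_def distinct_map)
  have disj: "set (leaves (insert_at n i u j)) \<inter> set (leaves (insert_at n i u k)) = {}" if "j \<noteq> k" for j k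
    unfolding L using that n by auto
  have dist: "distinct (leaves (tsubst (insert_at n i u) t))"
    unfolding distinct_leaves_tsubst[OF t'(2)] using dist1 disj by blast
  show "composable t (insert_at n i u)" unfolding composable_def using t' dist wf by simp
  have "set (leaves (tsubst (insert_at n i u) t)) =
      (\<Union>j\<in>{1..m}. if j < i then {j} else if j = i then {i..i + n - 1} else {j + n - 1})"
    unfolding leaves_tsubst set_concat by (simp add: t'(3) L)
  also have "\<dots> = {1..m + n - 1}"
  proof (intro equalityI subsetI)
    fix x assume "x \<in> (\<Union>j\<in>{1..m}. if j < i then {j} else if j = i then {i..i + n - 1} else {j + n - 1})"
    then obtain j where j: "j \<in> {1..m}"
      "x \<in> (if j < i then {j} else if j = i then {i..i + n - 1} else {j + n - 1})" by blast
    then show "x \<in> {1..m + n - 1}" using n i by (auto split: if_splits)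
  next
    fix x assume x: "x \<in> {1..m + n - 1}"
    consider "x < i" | "x \<in> {i..i + n - 1}" | "i + n - 1 < x" by fastforce
    then show "x \<in> (\<Union>j\<in>{1..m}. if j < i then {j} else if j = i then {i..i + n - 1} else {j + n - 1})"
    proof cases
      case 1
      then show ?thesis using x i by (intro UN_I[of x]) auto
    next
      case 2
      then show ?thesis using i by (intro UN_I[of i]) auto
    next
      case 3
      then show ?thesis using x i n by (intro UN_I[of "x + 1 - n"]) auto
    qed
  qed
  finally show "tsubst (insert_at n i u) t \<in> tree_monomials (m + n - 1)"
    using dist well_formed_tsubst[OF t'(1) wf] by (simp add: tree_monomials_def)
qed

lemma compose_all_cong:
  assumes "\<And>i. i \<in> set (leaves t) \<Longrightarrow> s i = s' i"
  shows "compose_all t s = compose_all t s'"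
proof -
  have "symbols (\<lambda>i. tdeg (s i)) t = symbols (\<lambda>i. tdeg (s' i)) t"
    using assms by (intro symbols_cong) simp
  moreover have "tsubst s t = tsubst s' t" using assms by (rule tsubst_cong)
  ultimately show ?thesis by (simp only: compose_all_eq)
qed

text \<open>All grafted trees except the one at \<open>i\<close> are single leaves, with singleton
  classes and orientation 1. The product over the leaves of \<open>t\<close> thus collapses to the
  class of the relabelled \<open>u\<close>.\<close>

lemma alternate_compose_at:
  assumes t: "t \<in> tree_monomials m" and u: "u \<in> tree_monomials n" and i: "i \<in> {1..m}"
  shows "lin alternate (compose_at n i t u) =
    (lin (\<lambda>t'. lin (compose_at n i t') (alternate u)) (alternate t) :: tree \<Rightarrow>\<^sub>0 'k::comm_ring_1)"
proof -
  let ?s = "insert_at n i u"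
  let ?I = "{1..m}"
  let ?f = "\<lambda>l. l + i - 1"
  have leaves: "set (leaves t) = ?I" using t by (simp add: tree_monomials_def)
  have u': "well_formed u" "distinct (leaves u)" "0 \<notin> set (leaves u)" "inj_on ?f (set (leaves u))"
    using u i by (auto simp: tree_monomials_def inj_on_def)
  let ?r = "restrict ?s (?I - {i})"
  have other: "rclass (?s j) = {?s j}" "orient (?s j) = 1" if "j \<in> ?I - {i}" for j
    using that by (simp_all add: insert_at_def)
  have "Pi\<^sub>E (?I - {i}) (\<lambda>j. rclass (?s j)) = Pi\<^sub>E (?I - {i}) (\<lambda>j. {?r j})"
    using other by (intro PiE_cong) simp
  also have "\<dots> = {?r}" by (intro PiE_singleton restrict_extensional)
  finally have R: "Pi\<^sub>E (?I - {i}) (\<lambda>j. rclass (?s j)) = {?r}" .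
  have si: "?s i = relabel ?f u" by (simp add: insert_at_def)
  have "(lin alternate (compose_at n i t u) :: tree \<Rightarrow>\<^sub>0 'k) = (\<Sum>t'\<in>rclass t. \<Sum>x\<in>rclass (relabel ?f u).
     smul (of_int (orient t * orient t' * (\<Prod>j\<in>?I. orient (?s j) * orient ((?r(i := x)) j))))
       (compose_all t' (?r(i := x))))"
    unfolding compose_at_eq lin_alternate_compose_all[OF tree_monomials_insert_at(1)[OF assms]] leaves
      sum_PiE_split[OF i] R si by simp
  also have "\<dots> = (\<Sum>t'\<in>rclass t. \<Sum>x\<in>rclass (relabel ?f u).
     smul (of_int (orient t * orient t' * (orient (relabel ?f u) * orient x))) (compose_all t' (?r(i := x))))"
  proof (intro sum.cong refl)
    fix t' x
    have "(\<Prod>j\<in>?I. orient (?s j) * orient ((?r(i := x)) j)) =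
      (orient (?s i) * orient x) * (\<Prod>j\<in>?I - {i}. orient (?s j) * orient ((?r(i := x)) j))"
      by (subst prod.remove[OF _ i]) simp_all
    also have "(\<Prod>j\<in>?I - {i}. orient (?s j) * orient ((?r(i := x)) j)) = 1"
      using other(2) by (intro prod.neutral) simp
    finally show "smul (of_int (orient t * orient t' * (\<Prod>j\<in>?I. orient (?s j) * orient ((?r(i := x)) j))))
        (compose_all t' (?r(i := x)) :: tree \<Rightarrow>\<^sub>0 'k) =
      smul (of_int (orient t * orient t' * (orient (relabel ?f u) * orient x))) (compose_all t' (?r(i := x)))"
      by (simp only: si mult_1_right)
  qed
  also have "\<dots> = (\<Sum>t'\<in>rclass t. \<Sum>u'\<in>rclass u.
     smul (of_int (orient t * orient t' * (orient u * orient u'))) (compose_all t' (?r(i := relabel ?f u'))))"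
  proof (rule sum.cong[OF refl])
    fix t'
    show "(\<Sum>x\<in>rclass (relabel ?f u).
      smul (of_int (orient t * orient t' * (orient (relabel ?f u) * orient x))) (compose_all t' (?r(i := x)) :: tree \<Rightarrow>\<^sub>0 'k)) =
      (\<Sum>u'\<in>rclass u.
      smul (of_int (orient t * orient t' * (orient u * orient u'))) (compose_all t' (?r(i := relabel ?f u'))))"
      by (rule sum_rclass_relabel[OF u', where
          F = "\<lambda>e x. smul (of_int (orient t * orient t' * e)) (compose_all t' (?r(i := x)))"])
  qed
  also have "\<dots> = (\<Sum>t'\<in>rclass t. \<Sum>u'\<in>rclass u.
     smul (of_int (orient t * orient t') * of_int (orient u * orient u')) (compose_at n i t' u'))"
  proof (intro sum.cong refl)
    fix t' u' assume "t' \<in> rclass t"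
    then have "set (leaves t') = ?I" using rearr_leaves(1)[of t t'] leaves by (simp add: rclass_def)
    then have "compose_all t' (?r(i := relabel ?f u')) = (compose_at n i t' u' :: tree \<Rightarrow>\<^sub>0 'k)"
      unfolding compose_at_eq by (intro compose_all_cong) (auto simp: insert_at_def)
    then show "smul (of_int (orient t * orient t' * (orient u * orient u'))) (compose_all t' (?r(i := relabel ?f u'))) =
      smul (of_int (orient t * orient t') * of_int (orient u * orient u')) (compose_at n i t' u' :: tree \<Rightarrow>\<^sub>0 'k)"
      by (simp only: of_int_mult mult.assoc)
  qed
  also have "\<dots> = lin (\<lambda>t'. lin (compose_at n i t') (alternate u)) (alternate t)"
    unfolding alternate_def lin_sum lin_smul lin_monomial smul_sum smul_smul ..
  finally show ?thesis .
qed

lemma keys_alternate: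
  assumes "t \<in> tree_monomials n"
  shows "Poly_Mapping.keys (alternate t) \<subseteq> {t' \<in> tree_monomials n. tdeg t' = tdeg t}"
  unfolding alternate_def
proof (intro keys_sum_subset order_trans[OF keys_smul] order_trans[OF keys_monomial])
  fix t' assume "t' \<in> rclass t"
  then have "rearr t t'" by (simp add: rclass_def)
  then show "{t'} \<subseteq> {t' \<in> tree_monomials n. tdeg t' = tdeg t}"
    using assms rearr_leaves[of t t'] rearr_invariants(2,3)[of t t'] by (simp add: tree_monomials_def)
qed

lemma keys_compose:
  assumes "Poly_Mapping.keys x \<subseteq> tree_monomials m" "Poly_Mapping.keys y \<subseteq> tree_monomials n" "i \<in> {1..m}"
  shows "Poly_Mapping.keys (lin (\<lambda>t. lin (compose_at n i t) y) x) \<subseteq> tree_monomials (m + n - 1)"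
proof (intro keys_lin)
  fix t u assume "t \<in> Poly_Mapping.keys x" "u \<in> Poly_Mapping.keys y"
  then have "t \<in> tree_monomials m" "u \<in> tree_monomials n" using assms by blast+
  then have "{tsubst (insert_at n i u) t} \<subseteq> tree_monomials (m + n - 1)"
    using tree_monomials_insert_at(2) assms(3) by simp
  then show "Poly_Mapping.keys (compose_at n i t u) \<subseteq> tree_monomials (m + n - 1)"
    unfolding compose_at_eq using keys_compose_all by (rule order_trans[rotated])
qed

lemma lin_alternate_compose:
  assumes "Poly_Mapping.keys x \<subseteq> tree_monomials m" "Poly_Mapping.keys y \<subseteq> tree_monomials n" "i \<in> {1..m}"
  shows "lin alternate (lin (\<lambda>t. lin (compose_at n i t) y) x) =
    lin (\<lambda>t. lin (compose_at n i t) (lin alternate y)) (lin alternate x)"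
proof -
  have "lin alternate (lin (\<lambda>t. lin (compose_at n i t) y) x) =
    lin (\<lambda>t. lin (\<lambda>u. lin (\<lambda>t'. lin (compose_at n i t') (alternate u)) (alternate t)) y) x"
    unfolding lin_lin
  proof (intro lin_cong)
    fix t u assume "t \<in> Poly_Mapping.keys x" "u \<in> Poly_Mapping.keys y"
    then show "lin alternate (compose_at n i t u) = lin (\<lambda>t'. lin (compose_at n i t') (alternate u)) (alternate t)"
      using assms by (intro alternate_compose_at[of t m]) blast+
  qed
  also have "\<dots> = lin (\<lambda>t. lin (\<lambda>t'. lin (\<lambda>u. lin (compose_at n i t') (alternate u)) y) (alternate t)) x"
  proof (rule lin_cong)
    fix t
    show "lin (\<lambda>u. lin (\<lambda>t'. lin (compose_at n i t') (alternate u)) (alternate t)) y =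
      lin (\<lambda>t'. lin (\<lambda>u. lin (compose_at n i t') (alternate u)) y) (alternate t)"
      unfolding lin_def[of _ "alternate t"] lin_fun_sum lin_fun_smul ..
  qed
  also have "\<dots> = lin (\<lambda>t. lin (compose_at n i t) (lin alternate y)) (lin alternate x)"
    unfolding lin_lin ..
  finally show ?thesis .
qed

lemma lin_alternate_tact:
  assumes "Poly_Mapping.keys x \<subseteq> tree_monomials n" "\<sigma> permutes {1..n}"
  shows "lin alternate (lin (\<lambda>t. monomial (tact \<sigma> t)) x) = lin (\<lambda>t. monomial (tact \<sigma> t)) (lin alternate x)"
  unfolding lin_lin lin_monomial
proof (rule lin_cong)
  fix t assume "t \<in> Poly_Mapping.keys x"
  then show "alternate (tact \<sigma> t) = lin (\<lambda>t. monomial (tact \<sigma> t)) (alternate t)"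
    using assms by (intro alternate_tact[of t n]) blast+
qed

section \<open>Passage to the quotient by the sign relations\<close>

lemma tact_tree_monomials:
  assumes "t \<in> tree_monomials n" "\<sigma> permutes {1..n}"
  shows "tact \<sigma> t \<in> tree_monomials n"
  using assms permutes_image[OF permutes_inv[OF assms(2)]] permutes_inj_on[OF permutes_inv[OF assms(2)]]
  by (simp add: tree_monomials_def tact_def distinct_map)

lemma corolla_tree_monomials: "is_gen g \<Longrightarrow> corolla g \<in> tree_monomials (arity g)"
  unfolding tree_monomials_def corolla_eq by (auto simp: comp_def simp del: upt_Suc)

text \<open>A permuted corolla lies in the class of the corolla with relative orientation
  \<open>sign \<sigma>\<close>, so the two terms of the relation have the same image.\<close>

lemma lin_alternate_sign_relation:
  fixes x :: "tree \<Rightarrow>\<^sub>0 'k::comm_ring_1"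
  assumes "x \<in> sign_relations n"
  shows "Poly_Mapping.keys x \<subseteq> tree_monomials n \<and> lin alternate x = 0"
proof -
  from assms obtain g \<sigma> where g: "is_gen g" "arity g = n" "\<sigma> permutes {1..n}"
    and x: "x = gen_tensor g \<sigma> - smul (of_int (sign \<sigma>)) (monomial (corolla g))"
    unfolding sign_relations_def by blast
  have cor: "corolla g \<in> tree_monomials n" using corolla_tree_monomials[OF g(1)] g(2) by simp
  have x': "x = monomial (tact \<sigma> (corolla g)) + smul (- of_int (sign \<sigma>)) (monomial (corolla g))"
    unfolding x gen_tensor_def by (rule poly_mapping_eqI) (simp add: lookup_add lookup_minus)
  have "tact \<sigma> (corolla g) \<in> rclass (corolla g)"
    using bij_betwE[OF bij_betw_corolla, of g] g by blast
  then have "(alternate (tact \<sigma> (corolla g)) :: tree \<Rightarrow>\<^sub>0 'k) = smul (of_int (sign \<sigma>)) (alternate (corolla g))"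
    using alternate_rearr[of "corolla g" "tact \<sigma> (corolla g)", where ?'a = 'k] orient_tact_corolla[of \<sigma> g] g
    by (simp add: rclass_def orient_corolla)
  then have "lin alternate x = smul (of_int (sign \<sigma>)) (alternate (corolla g)) + smul (- of_int (sign \<sigma>)) (alternate (corolla g))"
    unfolding x' by (simp only: lin_add lin_smul lin_monomial)
  then have "lin alternate x = 0" unfolding smul_add_left[symmetric] by simp
  moreover have "Poly_Mapping.keys (monomial (tact \<sigma> (corolla g)) :: tree \<Rightarrow>\<^sub>0 'k) \<subseteq> tree_monomials n"
    using tact_tree_monomials[OF cor g(3)] by (intro order_trans[OF keys_monomial]) simp
  moreover have "Poly_Mapping.keys (smul (- of_int (sign \<sigma>)) (monomial (corolla g)) :: tree \<Rightarrow>\<^sub>0 'k) \<subseteq> tree_monomials n"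
    using cor by (intro order_trans[OF keys_smul] order_trans[OF keys_monomial]) simp
  ultimately show ?thesis unfolding x' by (intro conjI order_trans[OF Poly_Mapping.keys_add] Un_least)
qed

lemma RBL_free_simps:
  "Carrier (RBL_free lam) n = {x. Poly_Mapping.keys x \<subseteq> tree_monomials n}"
  "Homog (RBL_free lam) n d = {x. Poly_Mapping.keys x \<subseteq> {t \<in> tree_monomials n. int (tdeg t) = d}}"
  "Zero (RBL_free lam) n = 0" "Add (RBL_free lam) n x y = x + y" "Smult (RBL_free lam) n c x = smul c x"
  "Unit (RBL_free lam) = monomial (Leaf 1)"
  "Compose (RBL_free lam) m n i x y = lin (\<lambda>t. lin (compose_at n i t) y) x"
  "Act (RBL_free lam) n s x = lin (\<lambda>t. monomial (tact s t)) x"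
  "Diff (RBL_free lam) n x = lin (derivation (diff_gen shuffle_sum lam)) x"
  by (simp_all add: RBL_free_def free_regular_operad_def)

lemma RBA_inf_simps:
  "Carrier (RBA_inf lam) n = {x. Poly_Mapping.keys x \<subseteq> tree_monomials n}"
  "Homog (RBA_inf lam) n d = {x. Poly_Mapping.keys x \<subseteq> {t \<in> tree_monomials n. int (tdeg t) = d}}"
  "Add (RBA_inf lam) n x y = x + y" "Smult (RBA_inf lam) n c x = smul c x"
  "Unit (RBA_inf lam) = monomial (Leaf 1)"
  "Compose (RBA_inf lam) m n i x y = lin (\<lambda>t. lin (compose_at n i t) y) x"
  "Act (RBA_inf lam) n s x = lin (\<lambda>t. monomial (tact s t)) x"
  "Diff (RBA_inf lam) n x = lin (derivation (diff_gen monomial lam)) x"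
  by (simp_all add: RBA_inf_def free_regular_operad_def)

text \<open>The kernel of \<open>alternate\<close> is closed under all operations that generate the
  ideal. The bound on the keys is carried along because compatibility with compositions and with the
  action has been shown for tree monomials of the right arity.\<close>

lemma RBL_ideal_killed:
  assumes "RBL_ideal lam n x"
  shows "Poly_Mapping.keys x \<subseteq> tree_monomials n \<and> lin alternate x = 0"
  using assms unfolding RBL_ideal_def
proof (induction rule: operad_ideal.induct)
  case (rel x n)
  then show ?case by (rule lin_alternate_sign_relation)
next
  case (zero n)
  then show ?case by (simp add: RBL_free_simps)
next
  case (add n x y)
  then show ?case using Poly_Mapping.keys_add[of x y] by (auto simp: RBL_free_simps lin_add)
next
  case (smult n x c)
  then show ?case using keys_smul[of c x] by (auto simp: RBL_free_simps lin_smul)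
next
  case (act n x s)
  have "Poly_Mapping.keys (lin (\<lambda>t. monomial (tact s t)) x) \<subseteq> tree_monomials n"
  proof (intro keys_lin order_trans[OF keys_monomial])
    fix t assume "t \<in> Poly_Mapping.keys x"
    then show "{tact s t} \<subseteq> tree_monomials n" using act tact_tree_monomials[of t n s] by blast
  qed
  then show ?case using act lin_alternate_tact[of x n s] by (simp add: RBL_free_simps)
next
  case (comp_left m x y n i)
  then have y: "Poly_Mapping.keys y \<subseteq> tree_monomials n" by (simp add: RBL_free_simps)
  show ?case unfolding RBL_free_simps
    using keys_compose[of x m y n i] lin_alternate_compose[of x m y n i] comp_left y by simp
next
  case (comp_right x m n y i)
  then have x: "Poly_Mapping.keys x \<subseteq> tree_monomials m" by (simp add: RBL_free_simps)
  show ?case unfolding RBL_free_simps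
    using keys_compose[of x m y n i] lin_alternate_compose[of x m y n i] comp_right x by simp
qed

lemma RBL_ideal_0: "RBL_ideal lam n 0"
  using operad_ideal.zero[of "RBL_free lam" sign_relations n] by (simp add: RBL_ideal_def RBL_free_simps)

text \<open>
  All representatives of a coset have the same antisymmetrization, so the choice is immaterial. This
  also applies to the differential of a coset, which is a priori only a union of cosets.
\<close>

definition antisymmetrization :: "nat \<Rightarrow> (tree \<Rightarrow>\<^sub>0 'k) set \<Rightarrow> (tree \<Rightarrow>\<^sub>0 'k::comm_ring_1)" where
  "antisymmetrization n X = lin alternate (SOME x. x \<in> X)"

lemma antisymmetrization_eq:
  assumes "x \<in> X" "\<And>y. y \<in> X \<Longrightarrow> lin alternate y = v"
  shows "antisymmetrization n X = v"
  unfolding antisymmetrization_def using assms someI[of "\<lambda>x. x \<in> X" x] by blast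

context
  fixes lam :: "'k::comm_ring_1"
begin

abbreviation RBL_coset :: "nat \<Rightarrow> (tree \<Rightarrow>\<^sub>0 'k) \<Rightarrow> (tree \<Rightarrow>\<^sub>0 'k) set" where
  "RBL_coset \<equiv> coset (RBL_free lam) (RBL_ideal lam)"

lemma coset_self: "x \<in> RBL_coset n x"
  unfolding coset_def using RBL_ideal_0[of lam n] by (force simp: RBL_free_simps)

lemma coset_mem:
  assumes "y \<in> RBL_coset n x"
  shows "lin alternate y = lin alternate x"
    and "Poly_Mapping.keys x \<subseteq> tree_monomials n \<Longrightarrow> Poly_Mapping.keys y \<subseteq> tree_monomials n"
proof -
  from assms obtain z where z: "y = x + z" "RBL_ideal lam n z"
    unfolding coset_def by (auto simp: RBL_free_simps)
  note kill = RBL_ideal_killed[OF z(2)]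
  show "lin alternate y = lin alternate x" unfolding z(1) lin_add using kill by simp
  show "Poly_Mapping.keys y \<subseteq> tree_monomials n" if "Poly_Mapping.keys x \<subseteq> tree_monomials n"
    unfolding z(1) using that kill Poly_Mapping.keys_add[of x z] by blast
qed

lemma antisymmetrization_coset: "antisymmetrization n (RBL_coset n x) = lin alternate x"
  by (rule antisymmetrization_eq[OF coset_self]) (rule coset_mem(1))

text \<open>Operations of the quotient are unions of cosets over all representatives, so what has to
  be checked is that the image does not depend on the representative.\<close>

lemma antisymmetrization_UN:
  assumes "x \<in> X" "\<And>y. y \<in> X \<Longrightarrow> lin alternate (f y) = v"
  shows "antisymmetrization m (\<Union>y\<in>X. RBL_coset n (f y)) = v"
proof (rule antisymmetrization_eq)
  show "f x \<in> (\<Union>y\<in>X. RBL_coset n (f y))" using assms(1) coset_self by blast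
  fix w assume "w \<in> (\<Union>y\<in>X. RBL_coset n (f y))"
  then obtain y where "y \<in> X" "w \<in> RBL_coset n (f y)" by blast
  then show "lin alternate w = v" using assms(2) coset_mem(1) by metis
qed

lemma antisymmetrization_UN2:
  assumes "x \<in> X" "y \<in> Y" "\<And>x y. x \<in> X \<Longrightarrow> y \<in> Y \<Longrightarrow> lin alternate (f x y) = v"
  shows "antisymmetrization m (\<Union>x\<in>X. \<Union>y\<in>Y. RBL_coset n (f x y)) = v"
proof (rule antisymmetrization_eq)
  show "f x y \<in> (\<Union>x\<in>X. \<Union>y\<in>Y. RBL_coset n (f x y))" using assms(1,2) coset_self by blast
  fix w assume "w \<in> (\<Union>x\<in>X. \<Union>y\<in>Y. RBL_coset n (f x y))"
  then obtain x' y' where "x' \<in> X" "y' \<in> Y" "w \<in> RBL_coset n (f x' y')" by blast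
  then show "lin alternate w = v" using assms(3) coset_mem(1) by metis
qed

lemma keys_lin_alternate:
  assumes "Poly_Mapping.keys x \<subseteq> {t \<in> tree_monomials n. P (tdeg t)}"
  shows "Poly_Mapping.keys (lin alternate x) \<subseteq> {t \<in> tree_monomials n. P (tdeg t)}"
proof (rule keys_lin)
  fix t assume "t \<in> Poly_Mapping.keys x"
  then have "t \<in> tree_monomials n" "P (tdeg t)" using assms by auto
  then show "Poly_Mapping.keys (alternate t) \<subseteq> {t \<in> tree_monomials n. P (tdeg t)}"
    using keys_alternate[of t n] by fastforce
qed

lemma morphism_antisymmetrization:
  "dg_operad_morphism (RBL_inf lam) (RBA_inf lam) antisymmetrization"
  unfolding dg_operad_morphism_def
proof (intro conjI allI ballI impI)
  have carrier: "\<exists>x. X = RBL_coset n x \<and> Poly_Mapping.keys x \<subseteq> tree_monomials n"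
    if "X \<in> Carrier (RBL_inf lam) n" for X n
    using that by (auto simp: RBL_inf_def quotient_operad_def RBL_free_simps)
  {
    fix n X assume "X \<in> Carrier (RBL_inf lam) n"
    then obtain x where x: "X = RBL_coset n x" "Poly_Mapping.keys x \<subseteq> tree_monomials n" using carrier by blast
    then show "antisymmetrization n X \<in> Carrier (RBA_inf lam) n"
      using keys_lin_alternate[of x n "\<lambda>_. True"] by (simp add: RBA_inf_simps antisymmetrization_coset)
  next
    fix n d X assume "X \<in> Homog (RBL_inf lam) n d"
    then obtain x where x: "X = RBL_coset n x" "Poly_Mapping.keys x \<subseteq> {t \<in> tree_monomials n. int (tdeg t) = d}"
      by (auto simp: RBL_inf_def quotient_operad_def RBL_free_simps)
    show "antisymmetrization n X \<in> Homog (RBA_inf lam) n d"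
      unfolding x(1) antisymmetrization_coset RBA_inf_simps mem_Collect_eq
      by (rule keys_lin_alternate[OF x(2)])
  next
    fix n X Y assume "X \<in> Carrier (RBL_inf lam) n" "Y \<in> Carrier (RBL_inf lam) n"
    then obtain x y where x: "X = RBL_coset n x" and y: "Y = RBL_coset n y" using carrier by blast
    have "Add (RBL_inf lam) n X Y = (\<Union>u\<in>X. \<Union>v\<in>Y. RBL_coset n (u + v))"
      by (simp add: RBL_inf_def quotient_operad_def RBL_free_simps)
    moreover have "antisymmetrization n (\<Union>u\<in>X. \<Union>v\<in>Y. RBL_coset n (u + v)) = lin alternate x + lin alternate y"
    proof (rule antisymmetrization_UN2)
      show "x \<in> X" "y \<in> Y" unfolding x y by (rule coset_self)+
      fix u v assume "u \<in> X" "v \<in> Y"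
      then show "lin alternate (u + v) = lin alternate x + lin alternate y"
        unfolding x y lin_add by (simp only: coset_mem(1))
    qed
    ultimately show "antisymmetrization n (Add (RBL_inf lam) n X Y) =
      Add (RBA_inf lam) n (antisymmetrization n X) (antisymmetrization n Y)"
      unfolding x y RBA_inf_simps antisymmetrization_coset by simp
  next
    fix n c X assume "X \<in> Carrier (RBL_inf lam) n"
    then obtain x where x: "X = RBL_coset n x" using carrier by blast
    have "Smult (RBL_inf lam) n c X = (\<Union>u\<in>X. RBL_coset n (smul c u))"
      by (simp add: RBL_inf_def quotient_operad_def RBL_free_simps)
    moreover have "antisymmetrization n (\<Union>u\<in>X. RBL_coset n (smul c u)) = smul c (lin alternate x)"
    proof (rule antisymmetrization_UN)
      show "x \<in> X" unfolding x by (rule coset_self)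
      fix u assume "u \<in> X"
      then show "lin alternate (smul c u) = smul c (lin alternate x)" unfolding x lin_smul by (simp only: coset_mem(1))
    qed
    ultimately show "antisymmetrization n (Smult (RBL_inf lam) n c X) =
      Smult (RBA_inf lam) n c (antisymmetrization n X)"
      unfolding x RBA_inf_simps antisymmetrization_coset by simp
  next
    have "Unit (RBL_inf lam) = RBL_coset 1 (monomial (Leaf 1))"
      by (simp add: RBL_inf_def quotient_operad_def RBL_free_simps)
    then show "antisymmetrization 1 (Unit (RBL_inf lam)) = Unit (RBA_inf lam)"
      unfolding RBA_inf_simps by (simp only: antisymmetrization_coset lin_monomial alternate_Leaf)
  next
    fix m n i X Y assume i: "i \<in> {1..m}" and "X \<in> Carrier (RBL_inf lam) m" "Y \<in> Carrier (RBL_inf lam) n"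
    then obtain x y where x: "X = RBL_coset m x" "Poly_Mapping.keys x \<subseteq> tree_monomials m"
      and y: "Y = RBL_coset n y" "Poly_Mapping.keys y \<subseteq> tree_monomials n" using carrier by blast
    let ?c = "\<lambda>u v. lin (\<lambda>t. lin (compose_at n i t) v) u"
    have "Compose (RBL_inf lam) m n i X Y = (\<Union>u\<in>X. \<Union>v\<in>Y. RBL_coset (m + n - 1) (?c u v))"
      by (simp add: RBL_inf_def quotient_operad_def RBL_free_simps)
    moreover have "antisymmetrization (m + n - 1) (\<Union>u\<in>X. \<Union>v\<in>Y. RBL_coset (m + n - 1) (?c u v)) =
      ?c (lin alternate x) (lin alternate y)"
    proof (rule antisymmetrization_UN2)
      show "x \<in> X" "y \<in> Y" unfolding x(1) y(1) by (rule coset_self)+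
      fix u v assume u: "u \<in> X" and v: "v \<in> Y"
      \<comment> \<open>The second part of \<open>coset_mem\<close> keeps all representatives in the
        carrier, where \<open>alternate\<close> is compatible with composition; the first part makes
        the result independent of the choice.\<close>
      note u' = coset_mem[OF u[unfolded x(1)]] and v' = coset_mem[OF v[unfolded y(1)]]
      show "lin alternate (?c u v) = ?c (lin alternate x) (lin alternate y)"
        unfolding lin_alternate_compose[OF u'(2)[OF x(2)] v'(2)[OF y(2)] i] u'(1) v'(1) ..
    qed
    ultimately show "antisymmetrization (m + n - 1) (Compose (RBL_inf lam) m n i X Y) =
      Compose (RBA_inf lam) m n i (antisymmetrization m X) (antisymmetrization n Y)"
      unfolding x(1) y(1) RBA_inf_simps antisymmetrization_coset by simp
  next
    fix n s X assume "X \<in> Carrier (RBL_inf lam) n" and s: "s permutes {1..n}"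
    then obtain x where x: "X = RBL_coset n x" "Poly_Mapping.keys x \<subseteq> tree_monomials n" using carrier by blast
    let ?a = "lin (\<lambda>t. monomial (tact s t))"
    have "Act (RBL_inf lam) n s X = (\<Union>u\<in>X. RBL_coset n (?a u))"
      by (simp add: RBL_inf_def quotient_operad_def RBL_free_simps)
    moreover have "antisymmetrization n (\<Union>u\<in>X. RBL_coset n (?a u)) = ?a (lin alternate x)"
    proof (rule antisymmetrization_UN)
      show "x \<in> X" unfolding x(1) by (rule coset_self)
      fix u assume u: "u \<in> X"
      note u' = coset_mem[OF u[unfolded x(1)]]
      show "lin alternate (?a u) = ?a (lin alternate x)"
        unfolding lin_alternate_tact[OF u'(2)[OF x(2)] s] u'(1) ..
    qed
    ultimately show "antisymmetrization n (Act (RBL_inf lam) n s X) = Act (RBA_inf lam) n s (antisymmetrization n X)"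
      unfolding x(1) RBA_inf_simps antisymmetrization_coset by simp
  next
    fix n X assume "X \<in> Carrier (RBL_inf lam) n"
    then obtain x where x: "X = RBL_coset n x" "Poly_Mapping.keys x \<subseteq> tree_monomials n" using carrier by blast
    let ?d = "lin (derivation (diff_gen shuffle_sum lam))" and ?d' = "lin (derivation (diff_gen monomial lam))"
    have "Diff (RBL_inf lam) n X = (\<Union>u\<in>X. RBL_coset n (?d u))"
      by (simp add: RBL_inf_def quotient_operad_def RBL_free_simps)
    moreover have "antisymmetrization n (\<Union>u\<in>X. RBL_coset n (?d u)) = ?d' (lin alternate x)"
    proof (rule antisymmetrization_UN)
      show "x \<in> X" unfolding x(1) by (rule coset_self)
      fix u assume u: "u \<in> X"
      note u' = coset_mem[OF u[unfolded x(1)]]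
      show "lin alternate (?d u) = ?d' (lin alternate x)"
        unfolding lin_alternate_derivation[OF u'(2)[OF x(2)]] u'(1) ..
    qed
    ultimately show "antisymmetrization n (Diff (RBL_inf lam) n X) = Diff (RBA_inf lam) n (antisymmetrization n X)"
      unfolding x(1) RBA_inf_simps antisymmetrization_coset by simp
  }
qed

lemma antisymmetrization_generator:
  "antisymmetrization (arity g) (RBL_gen lam g) =
    (\<Sum>\<sigma> | \<sigma> permutes {1..arity g}. smul (of_int (sign \<sigma>)) (gen_tensor g \<sigma>))"
  unfolding RBL_gen_def antisymmetrization_coset lin_monomial by (rule alternate_corolla)

end

theorem theorem3:
  fixes lam :: "'k::field_char_0"
  shows "\<exists>\<Phi>. dg_operad_morphism (RBL_inf lam) (RBA_inf lam) \<Phi> \<and>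
    (\<forall>n\<ge>2. \<Phi> n (RBL_gen lam (Op n)) =
       (\<Sum>\<sigma> | \<sigma> permutes {1..n}. smul (of_int (sign \<sigma>)) (gen_tensor (Op n) \<sigma>))) \<and>
    (\<forall>n\<ge>1. \<Phi> n (RBL_gen lam (RB n)) =
       (\<Sum>\<sigma> | \<sigma> permutes {1..n}. smul (of_int (sign \<sigma>)) (gen_tensor (RB n) \<sigma>)))"
proof (intro exI conjI allI impI)
  show "dg_operad_morphism (RBL_inf lam) (RBA_inf lam) antisymmetrization"
    by (rule morphism_antisymmetrization)
  show "antisymmetrization n (RBL_gen lam (Op n)) =
      (\<Sum>\<sigma> | \<sigma> permutes {1..n}. smul (of_int (sign \<sigma>)) (gen_tensor (Op n) \<sigma>))" for n
    using antisymmetrization_generator[where g = "Op n"] by (simp only: arity.simps)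
  show "antisymmetrization n (RBL_gen lam (RB n)) =
      (\<Sum>\<sigma> | \<sigma> permutes {1..n}. smul (of_int (sign \<sigma>)) (gen_tensor (RB n) \<sigma>))" for n
    using antisymmetrization_generator[where g = "RB n"] by (simp only: arity.simps)
qed

end
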